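(* There exists an absolute constant $C>0$ such that the following holds. Let $X,Y$ be independent random variables with $\mathrm{Var}(X)=\mathrm{Var}(Y)=1$, and let $0<\sigma\le1$. Then the regularized random variables $X_\sigma$ and $Y_\sigma$ satisfy $$D(X_\sigma+Y_\sigma)\ \ge\ \exp\Big\{-\frac{C\,\log^3(2+1/D)}{\sigma^2D^2}\Big\},$$ where $D=D(X_\sigma)+D(Y_\sigma)$. (If $D=0$ the right-hand side is interpreted as $0$.)
   Context: Regularization: for $\sigma>0$, $X_\sigma=X+\sigma Z$ and $Y_\sigma=Y+\sigma Z'$, where $Z,Z'$ are standard normal and $X,Y,Z,Z'$ are independent; thus $X_\sigma$ and $Y_\sigma$ are independent and $X_\sigma+Y_\sigma$ has the distribution of $X+Y+\sigma\sqrt2\,Z$. Entropic distance: for a random variable $X$ with a density $p$, mean $a=\mathbf{E}X$ and finite variance $v^2=\mathrm{Var}(X)>0$, $$D(X)=\int_{-\infty}^\infty p(x)\log\frac{p(x)}{\varphi_{a,v}(x)}\,dx\in[0,\infty],\qquad \varphi_{a,v}(x)=\frac{1}{v\sqrt{2\pi}}e^{-(x-a)^2/2v^2}.$$ Here $\log$ is the natural logarithm and $\log^3(t)=(\log t)^3$. *)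

theory Defs
  imports "HOL-Probability.Probability"
begin

definition regularize :: "('a \<Rightarrow> real) \<Rightarrow> real \<Rightarrow> ('a \<Rightarrow> real) \<Rightarrow> 'a \<Rightarrow> real" where
  "regularize X \<sigma> Z = (\<lambda>\<omega>. X \<omega> + \<sigma> * Z \<omega>)"

text \<open>
  The density of the law of \<open>X\<close> is taken to be its Radon-Nikodym derivative with respect to
  Lebesgue measure; it is meaningful only if the law is absolutely continuous.
\<close>

definition rv_density :: "'a measure \<Rightarrow> ('a \<Rightarrow> real) \<Rightarrow> real \<Rightarrow> real" where
  "rv_density M X = (\<lambda>x. enn2real (RN_deriv lborel (distr M borel X) x))"

text \<open>
  The integral takes values in the extended reals, as positive part minus negative part
  (a Bochner integral would be \<open>0\<close> where the entropic distance is infinite). For a density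
  with finite variance the negative part is integrable, so \<open>\<infinity> - \<infinity>\<close> does not occur.
  Since \<open>ln 0 = 0\<close>, the integrand is \<open>0\<close> where \<open>p\<close> vanishes.
\<close>

definition entropic_distance :: "'a measure \<Rightarrow> ('a \<Rightarrow> real) \<Rightarrow> ereal" where
  "entropic_distance M X =
    (let p = rv_density M X;
         a = prob_space.expectation M X;
         v = sqrt (prob_space.variance M X);
         f = (\<lambda>x. p x * ln (p x / normal_density a v x))
     in enn2ereal (\<integral>\<^sup>+ x. ennreal (f x) \<partial>lborel) - enn2ereal (\<integral>\<^sup>+ x. ennreal (- f x) \<partial>lborel))"

text \<open>
  The value at \<open>D = \<infinity>\<close> is that of the formula with \<open>1/\<infinity> = 0\<close>; for regularized
  random variables with finite variance \<open>D\<close> is in fact finite.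
\<close>

definition entropic_lower_bound :: "real \<Rightarrow> real \<Rightarrow> ereal \<Rightarrow> ereal" where
  "entropic_lower_bound C \<sigma> D =
    (if D = 0 then 0
     else if D = \<infinity> then 1
     else ereal (let d = real_of_ereal D in exp (- (C * ln (2 + 1 / d) ^ 3 / (\<sigma>\<^sup>2 * d\<^sup>2)))))"

definition regularized_pair ::
  "'a measure \<Rightarrow> ('a \<Rightarrow> real) \<Rightarrow> ('a \<Rightarrow> real) \<Rightarrow> ('a \<Rightarrow> real) \<Rightarrow> ('a \<Rightarrow> real) \<Rightarrow> bool" where
  "regularized_pair M X Y Z Z' \<longleftrightarrow>
     prob_space M \<and>
     prob_space.indep_vars M (\<lambda>_. borel) (\<lambda>i::nat. [X, Y, Z, Z'] ! i) {..<4} \<and>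
     distributed M lborel Z std_normal_density \<and>
     distributed M lborel Z' std_normal_density \<and>
     integrable M (\<lambda>\<omega>. (X \<omega>)\<^sup>2) \<and> prob_space.variance M X = 1 \<and>
     integrable M (\<lambda>\<omega>. (Y \<omega>)\<^sup>2) \<and> prob_space.variance M Y = 1"

text \<open>
  \<open>C\<close> is an admissible constant for random variables defined on the sample space \<open>M\<close>. The
  predicate serves to say that one and the same constant is admissible for sample spaces of
  every type: a formula of the form \<open>\<exists>C. \<forall>M :: 'a measure. \<dots>\<close> would only provide a
  constant for each type \<open>'a\<close>. Constants admissible for all measures on quadruples of reals
  (a fixed type, on which every joint law of \<open>(X, Y, Z, Z')\<close> is realized) are asserted to
  exist, and to be admissible for measures on an arbitrary type \<open>'a\<close>.
\<close>

definition admissible_constant :: "real \<Rightarrow> 'a measure \<Rightarrow> bool" where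
  "admissible_constant C M \<longleftrightarrow>
    (\<forall>X Y Z Z' \<sigma>. regularized_pair M X Y Z Z' \<longrightarrow> 0 < \<sigma> \<longrightarrow> \<sigma> \<le> 1 \<longrightarrow>
      (let X\<^sub>\<sigma> = regularize X \<sigma> Z;
           Y\<^sub>\<sigma> = regularize Y \<sigma> Z';
           D = entropic_distance M X\<^sub>\<sigma> + entropic_distance M Y\<^sub>\<sigma>
       in entropic_distance M (\<lambda>\<omega>. X\<^sub>\<sigma> \<omega> + Y\<^sub>\<sigma> \<omega>) \<ge> entropic_lower_bound C \<sigma> D))"

end

theory Submission
  imports Defs "HOL-Complex_Analysis.Complex_Analysis"
begin

text \<open>
  The statement is a quantitative form of Cramer's theorem: if the sum of two independent variables
  is normal, then so are the summands. Centering does not change the entropic distances, so let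
  \<open>X\<close> and \<open>Y\<close> have mean \<open>0\<close>, and let \<open>\<delta>\<close> be the entropic distance of
  \<open>X\<^sub>\<sigma> + Y\<^sub>\<sigma> = X + Y + U\<close>, where \<open>U\<close> is a centered normal variable of variance \<open>2\<sigma>\<^sup>2\<close>.
  Suppose \<open>\<delta> \<le> exp (- 4000 T\<^sup>2)\<close>. It is shown that \<open>D\<close>, the sum of the entropic distances of
  \<open>X\<^sub>\<sigma>\<close> and \<open>Y\<^sub>\<sigma>\<close>, satisfies \<open>T\<^sup>2 \<le> C log\<^sup>3(2 + 1/D) / (\<sigma>\<^sup>2 D\<^sup>2)\<close>; the choice
  \<open>T\<^sup>2 = ln (1/\<delta>) / 4000\<close> turns this into the asserted lower bound for \<open>\<delta>\<close>.

  Entropy dominates the squared Hellinger distance, so the law of \<open>X + Y + U\<close> is within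
  \<open>2 exp (- 2000 T\<^sup>2)\<close> of a normal law in \<open>L\<^sup>1\<close> (\<open>L1_distance_le_relative_entropy\<close>). Hence
  \<open>X\<close> and \<open>Y\<close> have Gaussian tails down to that level, and truncating them at \<open>200 T\<close> changes
  little. The truncated variables have entire moment generating functions \<open>F\<close> and \<open>G\<close>, and on the
  disc \<open>|z| \<le> T\<close> the product \<open>F G\<close> differs from \<open>exp z\<^sup>2\<close> by less than the minimum
  \<open>exp (- T\<^sup>2)\<close> of \<open>|exp z\<^sup>2|\<close> (\<open>mgf_product_close\<close>). This is the decisive point: \<open>F\<close> has no
  zeros there, so it has a holomorphic logarithm, whose real part is at most of order \<open>T\<^sup>2\<close> because
  \<open>|F z| \<le> F (Re z)\<close> and \<open>G\<close> is bounded below on the real axis by convexity. The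
  Borel--Caratheodory inequality and Cauchy's estimates bound the third order Taylor remainder of the
  logarithm by \<open>O(|z|\<^sup>3 / T)\<close>, while its first two derivatives at \<open>0\<close> are the mean and the variance
  (\<open>Sapogov_char_estimate\<close>). So the characteristic function of \<open>X\<close> differs from
  \<open>exp (- t\<^sup>2/2)\<close> by \<open>O(1/T)\<close> in \<open>L\<^sup>1\<close> on an interval of length proportional to \<open>T\<close>.

  Convolving with a kernel whose Fourier transform lives on that interval, and using that a density
  smoothed at scale \<open>\<sigma>\<close> varies slowly at scale \<open>1/T\<close> when \<open>\<sigma> T\<close> is large, one obtains that the
  densities of \<open>X\<^sub>\<sigma>\<close> and of the normal law with the same variance differ by at most
  \<open>\<eta> = O(1 / (\<sigma> T))\<close> everywhere (\<open>gauss_smoothing_sup_bound\<close>). For densities with equal second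
  moments, one of them normal, this gives an entropic distance of order \<open>\<eta> log\<^sup>3\<^sup>/\<^sup>2(2 + 1/\<eta>)\<close>
  (\<open>relative_entropy_le_of_sup_close\<close>), and inverting this relation (\<open>log_inversion\<close>) gives the
  inequality between \<open>T\<close> and \<open>D\<close>.

  The constant obtained in this way is admissible for every sample space. The second half of the
  theorem starts from an arbitrary admissible constant; there everything depends on the joint law of
  \<open>(X, Y, Z, Z')\<close> only, which lives on quadruples of reals (\<open>admissible_constant_transfer\<close>).
\<close>

section \<open>Elementary estimates\<close>

lemma exp_half_le_2: "exp (1/2::real) \<le> 2"
proof (rule power2_le_imp_le)
  show "(exp (1/2::real))\<^sup>2 \<le> 2\<^sup>2" using exp_le by (simp add: power2_eq_square flip: exp_add)
qed simp

lemma ln_two_ge_half: "1 / 2 \<le> ln (2::real)"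
  using exp_half_le_2 by (subst ln_ge_iff) auto

lemma norm_integral_le_integral:
  fixes f :: "'a \<Rightarrow> 'b :: {banach, second_countable_topology}"
  assumes "integrable M f" "integrable M g" "\<And>x. norm (f x) \<le> g x"
  shows "norm (\<integral>x. f x \<partial>M) \<le> (\<integral>x. g x \<partial>M)"
proof -
  have "norm (\<integral>x. f x \<partial>M) \<le> (\<integral>x. norm (f x) \<partial>M)" by (rule integral_norm_bound)
  also have "\<dots> \<le> (\<integral>x. g x \<partial>M)" using assms by (intro Bochner_Integration.integral_mono) auto
  finally show ?thesis .
qed

section \<open>Relative entropy and Hellinger distance\<close>

text \<open>
  The same convention for the integral as in the entropic distance, but for two given functions in
  place of a Radon-Nikodym derivative and the normal density with matching moments.
\<close>

definition relative_entropy :: "(real \<Rightarrow> real) \<Rightarrow> (real \<Rightarrow> real) \<Rightarrow> ereal" where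
  "relative_entropy p q =
     enn2ereal (\<integral>\<^sup>+ x. ennreal (p x * ln (p x / q x)) \<partial>lborel)
     - enn2ereal (\<integral>\<^sup>+ x. ennreal (- (p x * ln (p x / q x))) \<partial>lborel)"

text \<open>
  The inequality \<open>ln t \<le> t - 1\<close> is applied to the square root \<open>t = sqrt (q / p)\<close>. Compared with its
  use for \<open>q / p\<close>, which only shows that the relative entropy is nonnegative, this gains the square.
\<close>

lemma mult_ln_divide_ge_Hellinger:
  fixes p q :: real
  assumes "0 \<le> p" "0 < q"
  shows "p - q + (sqrt p - sqrt q)\<^sup>2 \<le> p * ln (p / q)"
proof (cases "p = 0")
  case False
  hence p: "0 < p" using assms by simp
  have "ln (sqrt (q / p)) \<le> sqrt (q / p) - 1" by (rule ln_le_minus_one) (use p assms in simp)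
  hence "ln (q / p) \<le> 2 * (sqrt (q / p) - 1)" using p assms by (simp add: ln_sqrt)
  hence "p * ln (q / p) \<le> p * (2 * (sqrt (q / p) - 1))" using p by (intro mult_left_mono) auto
  also have "\<dots> = 2 * sqrt (p * q) - 2 * p"
  proof -
    have "p * sqrt (q / p) = sqrt (p * q)"
      using p assms by (simp add: real_sqrt_divide real_sqrt_mult field_simps)
    thus ?thesis by (simp add: algebra_simps)
  qed
  finally have "p * ln (q / p) \<le> 2 * sqrt (p * q) - 2 * p" .
  moreover have "ln (q / p) = - ln (p / q)" using p assms by (simp add: ln_div)
  moreover have "(sqrt p - sqrt q)\<^sup>2 = p + q - 2 * sqrt (p * q)"
    using p assms by (simp add: power2_diff real_sqrt_mult)
  ultimately show ?thesis by simp
qed (use assms in simp)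

text \<open>
  The pointwise inequality is integrated with the negative part of the integrand moved to the other
  side, which is meaningful even if the relative entropy is infinite; the negative part is bounded by \<open>q\<close>.
\<close>

lemma Hellinger_le_relative_entropy:
  assumes [measurable]: "p \<in> borel_measurable borel" "q \<in> borel_measurable borel"
    and p: "\<And>x. 0 \<le> p x" and q: "\<And>x. 0 < q x"
    and pi: "(\<integral>\<^sup>+ x. ennreal (p x) \<partial>lborel) = 1" and qi: "(\<integral>\<^sup>+ x. ennreal (q x) \<partial>lborel) = 1"
  shows "enn2ereal (\<integral>\<^sup>+ x. ennreal ((sqrt (p x) - sqrt (q x))\<^sup>2) \<partial>lborel) \<le> relative_entropy p q"
proof -
  define f where "f x = p x * ln (p x / q x)" for x
  have [measurable]: "f \<in> borel_measurable borel" unfolding f_def by measurable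
  let ?h = "\<lambda>x. ennreal ((sqrt (p x) - sqrt (q x))\<^sup>2)"
  have ge: "p x - q x + (sqrt (p x) - sqrt (q x))\<^sup>2 \<le> f x" for x
    unfolding f_def by (rule mult_ln_divide_ge_Hellinger[OF p q])
  have pt: "ennreal (p x) + ?h x + ennreal (- f x) \<le> ennreal (f x) + ennreal (q x)" for x
  proof -
    have "ennreal (p x) + ?h x + ennreal (- f x) = ennreal (p x + (sqrt (p x) - sqrt (q x))\<^sup>2 + max 0 (- f x))"
      using p[of x] by (subst ennreal_max_0[symmetric, of "- f x"]) (simp flip: ennreal_plus del: ennreal_max_0)
    also have "\<dots> \<le> ennreal (max 0 (f x) + q x)"
      by (rule ennreal_leI) (use ge[of x] in auto)
    also have "\<dots> = ennreal (f x) + ennreal (q x)"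
      using q[of x] by (simp add: ennreal_plus ennreal_max_0)
    finally show ?thesis .
  qed
  have "1 + (\<integral>\<^sup>+ x. ?h x \<partial>lborel) + (\<integral>\<^sup>+ x. ennreal (- f x) \<partial>lborel)
        = (\<integral>\<^sup>+ x. ennreal (p x) + ?h x + ennreal (- f x) \<partial>lborel)"
    by (simp add: nn_integral_add pi)
  also have "\<dots> \<le> (\<integral>\<^sup>+ x. ennreal (f x) + ennreal (q x) \<partial>lborel)"
    by (intro nn_integral_mono pt)
  also have "\<dots> = 1 + (\<integral>\<^sup>+ x. ennreal (f x) \<partial>lborel)"
    by (simp add: nn_integral_add qi add.commute)
  finally have main: "(\<integral>\<^sup>+ x. ?h x \<partial>lborel) + (\<integral>\<^sup>+ x. ennreal (- f x) \<partial>lborel) \<le> (\<integral>\<^sup>+ x. ennreal (f x) \<partial>lborel)"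
    by (simp add: add.assoc)
  have fin: "(\<integral>\<^sup>+ x. ennreal (- f x) \<partial>lborel) \<noteq> \<infinity>"
  proof -
    have "- f x \<le> q x" for x using ge[of x] p[of x] zero_le_power2[of "sqrt (p x) - sqrt (q x)"] by linarith
    hence "(\<integral>\<^sup>+ x. ennreal (- f x) \<partial>lborel) \<le> (\<integral>\<^sup>+ x. ennreal (q x) \<partial>lborel)"
      by (intro nn_integral_mono ennreal_leI)
    thus ?thesis using qi by (auto simp: top_unique)
  qed
  have "enn2ereal (\<integral>\<^sup>+ x. ?h x \<partial>lborel) + enn2ereal (\<integral>\<^sup>+ x. ennreal (- f x) \<partial>lborel)
        \<le> enn2ereal (\<integral>\<^sup>+ x. ennreal (f x) \<partial>lborel)"
    using main by (simp flip: plus_ennreal.rep_eq add: less_eq_ennreal.rep_eq)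
  thus ?thesis
    unfolding relative_entropy_def f_def[symmetric]
    using fin by (simp add: ereal_le_minus_iff)
qed

lemma relative_entropy_nonneg:
  assumes "p \<in> borel_measurable borel" "q \<in> borel_measurable borel"
    and "\<And>x. 0 \<le> p x" and "\<And>x. 0 < q x"
    and "(\<integral>\<^sup>+ x. ennreal (p x) \<partial>lborel) = 1" and "(\<integral>\<^sup>+ x. ennreal (q x) \<partial>lborel) = 1"
  shows "0 \<le> relative_entropy p q"
  using Hellinger_le_relative_entropy[OF assms] by (rule order_trans[rotated]) simp

text \<open>
  A weak form of Pinsker's inequality. Cauchy's inequality for
  \<open>\<bar>p - q\<bar> = \<bar>\<surd>p - \<surd>q\<bar> (\<surd>p + \<surd>q)\<close> is replaced by a weighted inequality between means, with the
  weight chosen from the known bound \<open>b\<close>.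
\<close>

lemma L1_distance_le_relative_entropy:
  assumes [measurable]: "p \<in> borel_measurable borel" "q \<in> borel_measurable borel"
    and p: "\<And>x. 0 \<le> p x" and q: "\<And>x. 0 < q x"
    and pi: "(\<integral>\<^sup>+ x. ennreal (p x) \<partial>lborel) = 1" and qi: "(\<integral>\<^sup>+ x. ennreal (q x) \<partial>lborel) = 1"
    and b: "0 < b" and ent: "relative_entropy p q \<le> ereal (b\<^sup>2)"
  shows "(\<integral>\<^sup>+ x. ennreal \<bar>p x - q x\<bar> \<partial>lborel) \<le> ennreal (2 * b)"
proof -
  let ?h = "\<lambda>x. (sqrt (p x) - sqrt (q x))\<^sup>2"
  have "enn2ereal (\<integral>\<^sup>+ x. ennreal (?h x) \<partial>lborel) \<le> ereal (b\<^sup>2)"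
    using Hellinger_le_relative_entropy[OF assms(1-6)] ent by (rule order_trans)
  hence H: "(\<integral>\<^sup>+ x. ennreal (?h x) \<partial>lborel) \<le> ennreal (b\<^sup>2)"
    by (simp add: less_eq_ennreal.rep_eq enn2ereal_ennreal)
  have pt: "\<bar>p x - q x\<bar> \<le> 1 / b * ?h x + b / 2 * (p x + q x)" for x
  proof -
    define u v where "u = sqrt (p x)" and "v = sqrt (q x)"
    have uv: "0 \<le> u" "0 \<le> v" "p x = u\<^sup>2" "q x = v\<^sup>2"
      using p[of x] q[of x] by (auto simp: u_def v_def less_imp_le)
    have "p x - q x = (u - v) * (u + v)" by (simp add: uv power2_eq_square algebra_simps)
    hence "\<bar>p x - q x\<bar> = \<bar>u - v\<bar> * (u + v)" using uv by (simp add: abs_mult)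
    also have "\<dots> \<le> 1 / b * (u - v)\<^sup>2 + b / 4 * (u + v)\<^sup>2"
    proof -
      have "0 \<le> (\<bar>u - v\<bar> / sqrt b - sqrt b / 2 * (u + v))\<^sup>2" by simp
      also have "\<dots> = 1 / b * (u - v)\<^sup>2 - \<bar>u - v\<bar> * (u + v) + b / 4 * (u + v)\<^sup>2"
        using b by (simp add: power2_diff power_mult_distrib power_divide)
      finally show ?thesis by simp
    qed
    also have "b / 4 * (u + v)\<^sup>2 \<le> b / 4 * (2 * (u\<^sup>2 + v\<^sup>2))"
      using b sum_squares_bound[of u v] by (intro mult_left_mono) (auto simp: power2_sum)
    also have "b / 4 * (2 * (u\<^sup>2 + v\<^sup>2)) = b / 2 * (u\<^sup>2 + v\<^sup>2)" by (simp add: field_simps)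
    finally have "\<bar>p x - q x\<bar> \<le> 1 / b * (u - v)\<^sup>2 + b / 2 * (u\<^sup>2 + v\<^sup>2)" by simp
    moreover have "?h x = (u - v)\<^sup>2" by (simp add: u_def v_def)
    ultimately show ?thesis by (simp only: uv(3,4))
  qed
  have "(\<integral>\<^sup>+ x. ennreal \<bar>p x - q x\<bar> \<partial>lborel)
        \<le> (\<integral>\<^sup>+ x. ennreal (1 / b) * ennreal (?h x) + ennreal (b / 2) * (ennreal (p x) + ennreal (q x)) \<partial>lborel)"
  proof (rule nn_integral_mono)
    fix x
    have "ennreal \<bar>p x - q x\<bar> \<le> ennreal (1 / b * ?h x + b / 2 * (p x + q x))" by (rule ennreal_leI[OF pt])
    also have "\<dots> = ennreal (1 / b) * ennreal (?h x) + ennreal (b / 2) * (ennreal (p x) + ennreal (q x))"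
      using b p[of x] q[of x, THEN less_imp_le]
      by (simp only: ennreal_mult'[symmetric] ennreal_plus[symmetric] zero_le_power2 mult_nonneg_nonneg
          add_nonneg_nonneg divide_nonneg_pos zero_le_one less_imp_le half_gt_zero)
    finally show "ennreal \<bar>p x - q x\<bar> \<le> ennreal (1 / b) * ennreal (?h x) + ennreal (b / 2) * (ennreal (p x) + ennreal (q x))" .
  qed
  also have "\<dots> = ennreal (1 / b) * (\<integral>\<^sup>+ x. ennreal (?h x) \<partial>lborel) + ennreal (b / 2) * (1 + 1)"
    by (simp add: nn_integral_add nn_integral_cmult pi qi)
  also have "\<dots> \<le> ennreal (1 / b) * ennreal (b\<^sup>2) + ennreal (b / 2) * (1 + 1)"
    by (intro add_right_mono mult_left_mono H) auto
  also have "\<dots> = ennreal (2 * b)"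
  proof -
    have "ennreal (1 / b) * ennreal (b\<^sup>2) = ennreal b"
      using b by (subst ennreal_mult[symmetric]) (auto simp: power2_eq_square)
    moreover have "ennreal (b / 2) * (1 + 1) = ennreal b"
    proof -
      have "ennreal (b / 2) * (1 + 1) = ennreal (b / 2) * ennreal 2" by simp
      also have "\<dots> = ennreal b" using b by (subst ennreal_mult[symmetric]) auto
      finally show ?thesis .
    qed
    ultimately show ?thesis using b by (simp flip: ennreal_plus)
  qed
  finally show ?thesis .
qed

section \<open>Relative entropy of densities that are uniformly close\<close>

text \<open>
  For \<open>x\<^sup>2 \<ge> 2 v\<^sup>2\<close> the integrand is at most twice the derivative of \<open>- v\<^sup>2 x \<phi>(x)\<close>.
\<close>

lemma normal_tail_second_moment:
  assumes v: "0 < v" and R: "2 * v\<^sup>2 \<le> R\<^sup>2" "0 < R"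
  shows "(\<integral>\<^sup>+ x. ennreal (x\<^sup>2 * normal_density 0 v x) * indicator {x. R < \<bar>x\<bar>} x \<partial>lborel)
         \<le> ennreal (4 * v\<^sup>2 * R * normal_density 0 v R)"
proof -
  let ?q = "normal_density 0 v"
  let ?f = "\<lambda>x. 2 * (x\<^sup>2 - v\<^sup>2) * ?q x"
  have one: "(\<integral>\<^sup>+ x. ennreal (x\<^sup>2 * ?q x) * indicator {R..} x \<partial>lborel) \<le> ennreal (2 * v\<^sup>2 * R * ?q R)"
  proof -
    have ge: "2 * v\<^sup>2 \<le> x\<^sup>2" if "R \<le> x" for x
      using power_mono[OF that, of 2] R by simp
    have "(\<integral>\<^sup>+ x. ennreal (x\<^sup>2 * ?q x) * indicator {R..} x \<partial>lborel)
          \<le> (\<integral>\<^sup>+ x. ennreal (?f x) * indicator {R..} x \<partial>lborel)"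
      by (intro nn_integral_mono) (use ge in \<open>auto split: split_indicator intro!: ennreal_leI mult_right_mono\<close>)
    also have "\<dots> = ennreal (0 - (- 2 * v\<^sup>2 * R * ?q R))"
    proof (rule nn_integral_FTC_atLeast)
      fix x assume "R \<le> x"
      show "((\<lambda>x. - 2 * v\<^sup>2 * x * ?q x) has_real_derivative ?f x) (at x)"
        unfolding normal_density_def
        by (rule derivative_eq_intros refl | use v in \<open>simp add: field_simps power2_eq_square\<close>)+
      show "0 \<le> ?f x" 
      proof -
        have "v\<^sup>2 \<le> x\<^sup>2" using ge[OF \<open>R \<le> x\<close>] zero_le_power2[of v] by linarith
        thus ?thesis by simp
      qed
    next
      show "((\<lambda>x. - 2 * v\<^sup>2 * x * ?q x) \<longlongrightarrow> 0) at_top"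
        unfolding normal_density_def using v by real_asymp
    qed measurable
    finally show ?thesis by simp
  qed
  have "(\<integral>\<^sup>+ x. ennreal (x\<^sup>2 * ?q x) * indicator {..-R} x \<partial>lborel)
        = (\<integral>\<^sup>+ x. ennreal (x\<^sup>2 * ?q x) * indicator {R..} x \<partial>lborel)"
    by (subst nn_integral_real_affine[where c = "-1" and t = 0])
       (auto simp: normal_density_def indicator_def intro!: nn_integral_cong)
  hence two: "(\<integral>\<^sup>+ x. ennreal (x\<^sup>2 * ?q x) * indicator {..-R} x \<partial>lborel) \<le> ennreal (2 * v\<^sup>2 * R * ?q R)"
    using one by simp
  have "(\<integral>\<^sup>+ x. ennreal (x\<^sup>2 * ?q x) * indicator {x. R < \<bar>x\<bar>} x \<partial>lborel)
        \<le> (\<integral>\<^sup>+ x. ennreal (x\<^sup>2 * ?q x) * indicator {R..} x + ennreal (x\<^sup>2 * ?q x) * indicator {..-R} x \<partial>lborel)"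
    by (intro nn_integral_mono) (auto split: split_indicator)
  also have "\<dots> \<le> ennreal (2 * v\<^sup>2 * R * ?q R) + ennreal (2 * v\<^sup>2 * R * ?q R)"
    by (subst nn_integral_add) (use one two in \<open>auto intro: add_mono\<close>)
  also have "\<dots> = ennreal (4 * v\<^sup>2 * R * ?q R)"
    using R v by (subst ennreal_plus[symmetric]) auto
  finally show ?thesis .
qed

lemma ln_three_halves_power_ge:
  fixes \<eta> :: real assumes "0 < \<eta>"
  shows "1 / 3 \<le> ln (2 + 1 / \<eta>) * sqrt (ln (2 + 1 / \<eta>))"
proof -
  have "1 / 2 \<le> ln (2::real)" by (rule ln_two_ge_half)
  also have "ln 2 \<le> ln (2 + 1 / \<eta>)" by (intro ln_mono) (use assms in auto)
  finally have l: "1 / 2 \<le> ln (2 + 1 / \<eta>)" .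
  have "2 / 3 \<le> sqrt (1 / 2)" by (rule real_le_rsqrt) (simp add: power2_eq_square)
  also have "\<dots> \<le> sqrt (ln (2 + 1 / \<eta>))" using l by simp
  finally have "1 / 2 * (2 / 3) \<le> ln (2 + 1 / \<eta>) * sqrt (ln (2 + 1 / \<eta>))"
    using l by (intro mult_mono) auto
  thus ?thesis by simp
qed

lemma inverse_normal_density_le:
  assumes v: "1 \<le> v" "v\<^sup>2 \<le> 2"
  shows "1 / normal_density 0 v x \<le> 4 * exp (x\<^sup>2 / 2)"
proof -
  have "1 / normal_density 0 v x = sqrt (2 * pi * v\<^sup>2) * exp (x\<^sup>2 / (2 * v\<^sup>2))"
    unfolding normal_density_def by (simp add: exp_minus field_simps)
  also have "\<dots> \<le> 4 * exp (x\<^sup>2 / 2)"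
  proof (intro mult_mono)
    have "2 * pi * v\<^sup>2 \<le> 2 * 4 * 2" using pi_less_4 v by (intro mult_mono) auto
    thus "sqrt (2 * pi * v\<^sup>2) \<le> 4" by (intro real_le_lsqrt) auto
    have "1 \<le> v\<^sup>2" using v by simp
    hence "x\<^sup>2 / (2 * v\<^sup>2) \<le> x\<^sup>2 / 2" by (intro divide_left_mono) auto
    thus "exp (x\<^sup>2 / (2 * v\<^sup>2)) \<le> exp (x\<^sup>2 / 2)" by simp
  qed auto
  finally show ?thesis .
qed

text \<open>
  If \<open>\<eta>\<close> is not small, the factorization \<open>1 + \<eta>/\<phi> \<le> (1 + \<eta>) (1 + 1/\<phi>)\<close> is enough: the first
  logarithm is at most \<open>\<eta>\<close> and the second one is quadratic in \<open>x\<close>.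
\<close>

lemma log_excess_bound_large:
  assumes [measurable]: "p \<in> borel_measurable borel"
    and p: "\<And>x. 0 \<le> p x" and pi: "(\<integral>\<^sup>+ x. ennreal (p x) \<partial>lborel) = 1"
    and p2: "(\<integral>\<^sup>+ x. ennreal (x\<^sup>2 * p x) \<partial>lborel) = ennreal (v\<^sup>2)"
    and v: "1 \<le> v" "v\<^sup>2 \<le> 2" and \<eta>: "1 / 4 < \<eta>"
  shows "(\<integral>\<^sup>+ x. ennreal (p x * ln (1 + \<eta> / normal_density 0 v x)) \<partial>lborel) \<le> ennreal (21 * \<eta>)"
proof -
  have pt: "ln (1 + \<eta> / normal_density 0 v x) \<le> (\<eta> + 4) + x\<^sup>2 / 2" for x
  proof -
    let ?q = "normal_density 0 v x"
    have q: "0 < ?q" using v by (intro normal_density_pos) auto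
    have "1 + \<eta> / ?q \<le> (1 + \<eta>) * (1 + 1 / ?q)"
      using q \<eta> by (simp add: field_simps)
    also have "\<dots> \<le> (1 + \<eta>) * (5 * exp (x\<^sup>2 / 2))"
    proof (rule mult_left_mono)
      have "1 \<le> exp (x\<^sup>2 / 2)" by simp
      thus "1 + 1 / ?q \<le> 5 * exp (x\<^sup>2 / 2)" using inverse_normal_density_le[OF v, of x] by linarith
    qed (use \<eta> in auto)
    finally have "ln (1 + \<eta> / ?q) \<le> ln ((1 + \<eta>) * (5 * exp (x\<^sup>2 / 2)))"
      using q \<eta> by (intro ln_mono) (auto intro!: add_pos_nonneg)
    also have "\<dots> = ln (1 + \<eta>) + ln 5 + x\<^sup>2 / 2" using \<eta> by (simp add: ln_mult)
    also have "\<dots> \<le> \<eta> + 4 + x\<^sup>2 / 2"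
      using ln_le_minus_one[of "1 + \<eta>"] ln_le_minus_one[of 5] \<eta> by simp
    finally show ?thesis .
  qed
  have "(\<integral>\<^sup>+ x. ennreal (p x * ln (1 + \<eta> / normal_density 0 v x)) \<partial>lborel)
        \<le> (\<integral>\<^sup>+ x. ennreal (\<eta> + 4) * ennreal (p x) + ennreal (1 / 2) * ennreal (x\<^sup>2 * p x) \<partial>lborel)"
  proof (rule nn_integral_mono)
    fix x
    have "p x * ln (1 + \<eta> / normal_density 0 v x) \<le> p x * ((\<eta> + 4) + x\<^sup>2 / 2)"
      by (intro mult_left_mono pt p)
    also have "\<dots> = (\<eta> + 4) * p x + 1 / 2 * (x\<^sup>2 * p x)" by (simp add: algebra_simps)
    finally have "ennreal (p x * ln (1 + \<eta> / normal_density 0 v x)) \<le> ennreal ((\<eta> + 4) * p x + 1 / 2 * (x\<^sup>2 * p x))"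
      by (rule ennreal_leI)
    also have "\<dots> = ennreal (\<eta> + 4) * ennreal (p x) + ennreal (1 / 2) * ennreal (x\<^sup>2 * p x)"
    proof -
      have "ennreal ((\<eta> + 4) * p x) = ennreal (\<eta> + 4) * ennreal (p x)"
        using \<eta> p[of x] by (intro ennreal_mult) auto
      moreover have "ennreal (1 / 2 * (x\<^sup>2 * p x)) = ennreal (1 / 2) * ennreal (x\<^sup>2 * p x)"
        using p[of x] by (intro ennreal_mult) auto
      ultimately show ?thesis
        using \<eta> p[of x] ennreal_plus[of "(\<eta> + 4) * p x" "1 / 2 * (x\<^sup>2 * p x)"] by simp
    qed
    finally show "ennreal (p x * ln (1 + \<eta> / normal_density 0 v x)) \<le> \<dots>" .
  qed
  also have "\<dots> = ennreal (\<eta> + 4) + ennreal (1 / 2) * ennreal (v\<^sup>2)"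
    by (simp add: nn_integral_add nn_integral_cmult pi p2)
  also have "\<dots> = ennreal (\<eta> + 4 + v\<^sup>2 / 2)"
    using \<eta> by (subst ennreal_mult[symmetric], simp, simp, subst ennreal_plus[symmetric]) auto
  also have "\<dots> \<le> ennreal (21 * \<eta>)" using v \<eta> by (intro ennreal_leI) auto
  finally show ?thesis .
qed

text \<open>
  The line is cut where the normal density has decreased to \<open>\<eta>\<close> times its maximum, that is at
  \<open>\<bar>x\<bar> = R\<close>. Inside, \<open>\<eta>/\<phi>\<close> is bounded, so the logarithm is at most \<open>\<eta>/\<phi>\<close> and contributes \<open>O(\<eta> R)\<close>.
  Outside, the logarithm is at most \<open>x\<^sup>2\<close>. Since \<open>p\<close> and \<open>\<phi>\<close> have the same second moment, the outer part
  of the second moment of \<open>p\<close> equals that of \<open>\<phi>\<close> up to the difference of the inner parts, which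
  is \<open>O(\<eta> R\<^sup>3)\<close>. This term gives the exponent \<open>3/2\<close> of the logarithm.
\<close>

lemma log_excess_bound_small:
  assumes [measurable]: "p \<in> borel_measurable borel"
    and p: "\<And>x. 0 \<le> p x" and pi: "(\<integral>\<^sup>+ x. ennreal (p x) \<partial>lborel) = 1"
    and p2: "(\<integral>\<^sup>+ x. ennreal (x\<^sup>2 * p x) \<partial>lborel) = ennreal (v\<^sup>2)"
    and v: "1 \<le> v" "v\<^sup>2 \<le> 2"
    and close: "\<And>x. \<bar>p x - normal_density 0 v x\<bar> \<le> \<eta>"
    and \<eta>: "0 < \<eta>" "\<eta> \<le> 1 / 4" and R: "R = sqrt (2 * v\<^sup>2 * ln (1 / \<eta>))"
  shows "(\<integral>\<^sup>+ x. ennreal (p x * ln (1 + \<eta> / normal_density 0 v x)) \<partial>lborel) \<le> ennreal (9 * \<eta> * R ^ 3)"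
proof -
  let ?q = "normal_density 0 v"
  let ?I = "indicator {x. R < \<bar>x\<bar>} :: real \<Rightarrow> ennreal"
  let ?J = "indicator {-R..R} :: real \<Rightarrow> ennreal"
  have q: "0 < ?q x" for x using v by (intro normal_density_pos) auto
  have v1: "1 \<le> v\<^sup>2" using v by simp
  have l1: "1 \<le> ln (1 / \<eta>)"
  proof -
    have "exp 1 \<le> (4::real)" using exp_le by simp
    also have "4 \<le> 1 / \<eta>" using \<eta> by (simp add: field_simps)
    finally show ?thesis using \<eta> by (subst ln_ge_iff) auto
  qed
  have R2: "R\<^sup>2 = 2 * v\<^sup>2 * ln (1 / \<eta>)" unfolding R using l1 by simp
  have "2 * v\<^sup>2 * 1 \<le> 2 * v\<^sup>2 * ln (1 / \<eta>)" using l1 by (intro mult_left_mono) auto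
  hence R2v: "2 * v\<^sup>2 \<le> R\<^sup>2" by (simp add: R2)
  hence R2ge: "2 \<le> R\<^sup>2" using v1 by simp
  have R0: "0 < R" unfolding R using l1 v1 by (intro real_sqrt_gt_zero mult_pos_pos) auto
  have qR: "?q R = \<eta> / sqrt (2 * pi * v\<^sup>2)"
  proof -
    have "R\<^sup>2 / (2 * v\<^sup>2) = ln (1 / \<eta>)" using v by (simp add: R2)
    hence "exp (- (R\<^sup>2 / (2 * v\<^sup>2))) = \<eta>" using \<eta> by (simp add: ln_div)
    thus ?thesis by (simp add: normal_density_def)
  qed
  have sq: "sqrt (2 * pi * v\<^sup>2) \<le> 4"
  proof -
    have "2 * pi * v\<^sup>2 \<le> 2 * 4 * 2" using pi_less_4 v by (intro mult_mono) auto
    thus ?thesis by (intro real_le_lsqrt) auto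
  qed
  have sq2: "2 \<le> sqrt (2 * pi * v\<^sup>2)"
  proof -
    have "2 * 3 * 1 \<le> 2 * pi * v\<^sup>2" using pi_gt3 v1 by (intro mult_mono) auto
    thus ?thesis by (intro real_le_rsqrt) auto
  qed
  have bulk: "p x * ln (1 + \<eta> / ?q x) \<le> 5 * \<eta>" if x: "\<bar>x\<bar> \<le> R" for x
  proof -
    have "x\<^sup>2 \<le> R\<^sup>2" using power_mono[OF x, of 2] by simp
    hence "?q R \<le> ?q x" unfolding normal_density_def using v
      by (intro mult_left_mono) (auto intro!: divide_right_mono)
    moreover have "\<eta> / 4 \<le> ?q R" unfolding qR
    proof (intro frac_le order_refl sq)
      show "0 < sqrt (2 * pi * v\<^sup>2)" using sq2 by linarith
    qed (use \<eta> in auto)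
    ultimately have q4: "\<eta> / 4 \<le> ?q x" by linarith
    hence e4: "\<eta> / ?q x \<le> 4" using q[of x] by (simp add: field_simps)
    have "ln (1 + \<eta> / ?q x) \<le> \<eta> / ?q x"
      using ln_le_minus_one[of "1 + \<eta> / ?q x"] q[of x] \<eta> by (simp add: add_pos_pos)
    hence "p x * ln (1 + \<eta> / ?q x) \<le> p x * (\<eta> / ?q x)" by (intro mult_left_mono p)
    also have "\<dots> \<le> (?q x + \<eta>) * (\<eta> / ?q x)"
      using close[of x] \<eta> q[of x] by (intro mult_right_mono) auto
    also have "\<dots> = \<eta> + \<eta> * (\<eta> / ?q x)" using q[of x] by (simp add: field_simps)
    also have "\<dots> \<le> \<eta> + \<eta> * 4" using e4 \<eta> by (intro add_left_mono mult_left_mono) auto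
    finally show ?thesis by simp
  qed
  have tail: "p x * ln (1 + \<eta> / ?q x) \<le> x\<^sup>2 * p x" if x: "R < \<bar>x\<bar>" for x
  proof -
    have x2: "2 \<le> x\<^sup>2" using power_mono[of R "\<bar>x\<bar>" 2] x R0 R2ge by simp
    have "1 + \<eta> / ?q x \<le> 1 + \<eta> * (4 * exp (x\<^sup>2 / 2))"
      using mult_left_mono[OF inverse_normal_density_le[OF v, of x], of \<eta>] \<eta> by simp
    also have "\<dots> \<le> (1 + 4 * \<eta>) * exp (x\<^sup>2 / 2)" by (simp add: algebra_simps)
    finally have "ln (1 + \<eta> / ?q x) \<le> ln ((1 + 4 * \<eta>) * exp (x\<^sup>2 / 2))"
      using q[of x] \<eta> by (intro ln_mono) (auto intro!: add_pos_pos)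
    also have "\<dots> = ln (1 + 4 * \<eta>) + x\<^sup>2 / 2" using \<eta> by (simp add: ln_mult)
    also have "\<dots> \<le> 4 * \<eta> + x\<^sup>2 / 2" using ln_le_minus_one[of "1 + 4 * \<eta>"] \<eta> by simp
    also have "\<dots> \<le> x\<^sup>2" using \<eta> x2 by simp
    finally have "p x * ln (1 + \<eta> / ?q x) \<le> p x * x\<^sup>2" by (intro mult_left_mono p)
    thus ?thesis by (simp add: mult.commute)
  qed
  have J: "(\<integral>\<^sup>+ x. ?J x \<partial>lborel) = ennreal (2 * R)" using R0 by simp
  have tail_p: "(\<integral>\<^sup>+ x. ennreal (x\<^sup>2 * p x) * ?I x \<partial>lborel) \<le> ennreal (3 * R * \<eta> + 2 * \<eta> * R ^ 3)"
  proof -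
    have q2: "(\<integral>\<^sup>+ x. ennreal (x\<^sup>2 * ?q x) \<partial>lborel) = ennreal (v\<^sup>2)"
    proof -
      have "has_bochner_integral lborel (\<lambda>x. ?q x * (x - 0) ^ (2 * 1)) (fact (2 * 1) / ((2 / v\<^sup>2) ^ 1 * fact 1))"
        using v by (intro normal_moment_even) auto
      hence "has_bochner_integral lborel (\<lambda>x. x\<^sup>2 * ?q x) (v\<^sup>2)" by (simp add: mult.commute)
      thus ?thesis by (subst nn_integral_eq_integral) (auto simp: has_bochner_integral_iff)
    qed
    have split: "(\<integral>\<^sup>+ x. ennreal (x\<^sup>2 * f x) \<partial>lborel)
        = (\<integral>\<^sup>+ x. ennreal (x\<^sup>2 * f x) * ?I x \<partial>lborel) + (\<integral>\<^sup>+ x. ennreal (x\<^sup>2 * f x) * ?J x \<partial>lborel)"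
      if [measurable]: "f \<in> borel_measurable borel" for f :: "real \<Rightarrow> real"
      by (subst nn_integral_add[symmetric]) (auto intro!: nn_integral_cong split: split_indicator)
    have fin: "(\<integral>\<^sup>+ x. ennreal (x\<^sup>2 * p x) * ?J x \<partial>lborel) \<noteq> top"
    proof -
      have "(\<integral>\<^sup>+ x. ennreal (x\<^sup>2 * p x) * ?J x \<partial>lborel) \<le> (\<integral>\<^sup>+ x. ennreal (x\<^sup>2 * p x) \<partial>lborel)"
        by (intro nn_integral_mono) (auto split: split_indicator)
      thus ?thesis using p2 by (auto simp: top_unique)
    qed
    have "(\<integral>\<^sup>+ x. ennreal (x\<^sup>2 * ?q x) * ?J x \<partial>lborel)
          \<le> (\<integral>\<^sup>+ x. ennreal (x\<^sup>2 * p x) * ?J x + ennreal (R\<^sup>2 * \<eta>) * ?J x \<partial>lborel)"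
    proof (rule nn_integral_mono)
      fix x
      show "ennreal (x\<^sup>2 * ?q x) * ?J x \<le> ennreal (x\<^sup>2 * p x) * ?J x + ennreal (R\<^sup>2 * \<eta>) * ?J x"
      proof (cases "x \<in> {-R..R}")
        case True
        hence "x\<^sup>2 \<le> R\<^sup>2" using power_mono[of "\<bar>x\<bar>" R 2] by auto
        have "x\<^sup>2 * ?q x \<le> x\<^sup>2 * (p x + \<eta>)" using close[of x] by (intro mult_left_mono) auto
        also have "\<dots> \<le> x\<^sup>2 * p x + R\<^sup>2 * \<eta>"
          using mult_right_mono[OF \<open>x\<^sup>2 \<le> R\<^sup>2\<close>, of \<eta>] \<eta> by (simp add: algebra_simps)
        finally have "ennreal (x\<^sup>2 * ?q x) \<le> ennreal (x\<^sup>2 * p x + R\<^sup>2 * \<eta>)" by (rule ennreal_leI)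
        thus ?thesis using True p[of x] \<eta> by (subst (asm) ennreal_plus) auto
      qed simp
    qed
    also have "\<dots> = (\<integral>\<^sup>+ x. ennreal (x\<^sup>2 * p x) * ?J x \<partial>lborel) + ennreal (R\<^sup>2 * \<eta>) * ennreal (2 * R)"
      by (subst nn_integral_add) (auto simp: nn_integral_cmult J)
    also have "ennreal (R\<^sup>2 * \<eta>) * ennreal (2 * R) = ennreal (2 * \<eta> * R ^ 3)"
      using \<eta> R0 by (subst ennreal_mult[symmetric]) (auto simp: power3_eq_cube power2_eq_square mult_ac)
    finally have qJ: "(\<integral>\<^sup>+ x. ennreal (x\<^sup>2 * ?q x) * ?J x \<partial>lborel)
       \<le> (\<integral>\<^sup>+ x. ennreal (x\<^sup>2 * p x) * ?J x \<partial>lborel) + ennreal (2 * \<eta> * R ^ 3)" .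
    have qI: "(\<integral>\<^sup>+ x. ennreal (x\<^sup>2 * ?q x) * ?I x \<partial>lborel) \<le> ennreal (3 * R * \<eta>)"
    proof (rule order_trans[OF normal_tail_second_moment])
      have "4 * v\<^sup>2 * R * ?q R = 4 * v\<^sup>2 * R * \<eta> / (sqrt (2 * pi) * v)"
        using v by (simp add: qR real_sqrt_mult)
      also have "\<dots> = 4 * v / sqrt (2 * pi) * (R * \<eta>)" using v by (simp add: power2_eq_square)
      also have "\<dots> \<le> 3 * (R * \<eta>)"
      proof (rule mult_right_mono)
        have "v \<le> 3 / 2" by (rule power2_le_imp_le) (use v in \<open>auto simp: power2_eq_square\<close>)
        moreover have "2 \<le> sqrt (2 * pi)" using pi_gt3 by (intro real_le_rsqrt) auto
        ultimately show "4 * v / sqrt (2 * pi) \<le> 3" by (simp add: divide_le_eq)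
      qed (use R0 \<eta> in auto)
      finally show "ennreal (4 * v\<^sup>2 * R * ?q R) \<le> ennreal (3 * R * \<eta>)" by (intro ennreal_leI) (simp add: mult_ac)
    qed (use v R2v R0 in auto)
    have "(\<integral>\<^sup>+ x. ennreal (x\<^sup>2 * p x) * ?I x \<partial>lborel) + (\<integral>\<^sup>+ x. ennreal (x\<^sup>2 * p x) * ?J x \<partial>lborel)
        = (\<integral>\<^sup>+ x. ennreal (x\<^sup>2 * ?q x) * ?I x \<partial>lborel) + (\<integral>\<^sup>+ x. ennreal (x\<^sup>2 * ?q x) * ?J x \<partial>lborel)"
      using split[of p] split[of ?q] p2 q2 by simp
    also have "\<dots> \<le> ennreal (3 * R * \<eta>) + ((\<integral>\<^sup>+ x. ennreal (x\<^sup>2 * p x) * ?J x \<partial>lborel) + ennreal (2 * \<eta> * R ^ 3))"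
      by (intro add_mono qI qJ)
    also have "\<dots> = ennreal (3 * R * \<eta> + 2 * \<eta> * R ^ 3) + (\<integral>\<^sup>+ x. ennreal (x\<^sup>2 * p x) * ?J x \<partial>lborel)"
      using \<eta> R0 by (subst ennreal_plus) (auto simp: ac_simps)
    finally have "(\<integral>\<^sup>+ x. ennreal (x\<^sup>2 * p x) * ?J x \<partial>lborel) + (\<integral>\<^sup>+ x. ennreal (x\<^sup>2 * p x) * ?I x \<partial>lborel)
        \<le> (\<integral>\<^sup>+ x. ennreal (x\<^sup>2 * p x) * ?J x \<partial>lborel) + ennreal (3 * R * \<eta> + 2 * \<eta> * R ^ 3)"
      by (simp only: add.commute)
    thus ?thesis using fin by (simp add: ennreal_add_left_cancel_le)
  qed
  have "(\<integral>\<^sup>+ x. ennreal (p x * ln (1 + \<eta> / ?q x)) \<partial>lborel)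
        \<le> (\<integral>\<^sup>+ x. ennreal (5 * \<eta>) * ?J x + ennreal (x\<^sup>2 * p x) * ?I x \<partial>lborel)"
    by (intro nn_integral_mono) (use bulk tail in \<open>auto split: split_indicator intro!: ennreal_leI\<close>)
  also have "\<dots> = ennreal (5 * \<eta>) * ennreal (2 * R) + (\<integral>\<^sup>+ x. ennreal (x\<^sup>2 * p x) * ?I x \<partial>lborel)"
    by (subst nn_integral_add) (auto simp: nn_integral_cmult J)
  also have "\<dots> \<le> ennreal (5 * \<eta>) * ennreal (2 * R) + ennreal (3 * R * \<eta> + 2 * \<eta> * R ^ 3)"
    by (intro add_left_mono tail_p)
  also have "\<dots> = ennreal (13 * \<eta> * R + 2 * \<eta> * R ^ 3)"
    using \<eta> R0 by (subst ennreal_mult[symmetric], simp, simp, subst ennreal_plus[symmetric]) (auto simp: algebra_simps)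
  also have "\<dots> \<le> ennreal (9 * \<eta> * R ^ 3)"
  proof (rule ennreal_leI)
    have "R * 2 \<le> R * R\<^sup>2" using R0 R2ge by (intro mult_left_mono) auto
    hence "2 * R \<le> R ^ 3" by (simp add: power3_eq_cube power2_eq_square)
    hence "\<eta> * (2 * R) \<le> \<eta> * R ^ 3" using \<eta> by (intro mult_left_mono) auto
    moreover have "0 \<le> \<eta> * R ^ 3" using \<eta> R0 by simp
    ultimately have "13 * (\<eta> * R) + 2 * (\<eta> * R ^ 3) \<le> 9 * (\<eta> * R ^ 3)" by simp
    thus "13 * \<eta> * R + 2 * \<eta> * R ^ 3 \<le> 9 * \<eta> * R ^ 3" by (simp only: mult.assoc)
  qed
  finally show ?thesis .
qed

lemma log_excess_bound:
  assumes [measurable]: "p \<in> borel_measurable borel"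
    and p: "\<And>x. 0 \<le> p x" and pi: "(\<integral>\<^sup>+ x. ennreal (p x) \<partial>lborel) = 1"
    and p2: "(\<integral>\<^sup>+ x. ennreal (x\<^sup>2 * p x) \<partial>lborel) = ennreal (v\<^sup>2)"
    and v: "1 \<le> v" "v\<^sup>2 \<le> 2"
    and close: "\<And>x. \<bar>p x - normal_density 0 v x\<bar> \<le> \<eta>" and \<eta>: "0 < \<eta>"
  defines "L \<equiv> ln (2 + 1 / \<eta>)"
  shows "(\<integral>\<^sup>+ x. ennreal (p x * ln (1 + \<eta> / normal_density 0 v x)) \<partial>lborel) \<le> ennreal (80 * \<eta> * (L * sqrt L))"
proof (cases "\<eta> \<le> 1 / 4")
  case False
  have "21 * \<eta> \<le> 80 * \<eta> * (1 / 3)" using \<eta> by simp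
  also have "\<dots> \<le> 80 * \<eta> * (L * sqrt L)"
    unfolding L_def using ln_three_halves_power_ge[OF \<eta>] \<eta> by (intro mult_left_mono) auto
  finally have "ennreal (21 * \<eta>) \<le> ennreal (80 * \<eta> * (L * sqrt L))" by (rule ennreal_leI)
  moreover have "1 / 4 < \<eta>" using False by simp
  ultimately show ?thesis
    using log_excess_bound_large[OF assms(1) p pi p2 v] by (meson order_trans)
next
  case True
  define R where "R = sqrt (2 * v\<^sup>2 * ln (1 / \<eta>))"
  have l0: "0 \<le> ln (1 / \<eta>)" using True \<eta> by (simp add: ln_div)
  have "1 / \<eta> \<le> 2 + 1 / \<eta>" by simp
  hence ll: "ln (1 / \<eta>) \<le> L" unfolding L_def using \<eta> by (intro ln_mono) auto
  have "2 * v\<^sup>2 * ln (1 / \<eta>) \<le> 4 * L" using v ll l0 by (intro mult_mono) auto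
  hence R: "R \<le> 2 * sqrt L" unfolding R_def using real_sqrt_le_mono[of _ "4 * L"] real_sqrt_mult[of 4 L] by simp
  have "R ^ 3 \<le> (2 * sqrt L) ^ 3" using R l0 by (intro power_mono) (auto simp: R_def)
  also have "\<dots> = 8 * (L * sqrt L)" using l0 ll by (simp add: power3_eq_cube)
  finally have "9 * \<eta> * R ^ 3 \<le> 9 * \<eta> * (8 * (L * sqrt L))" using \<eta> by (intro mult_left_mono) auto
  also have "\<dots> \<le> 80 * \<eta> * (L * sqrt L)"
  proof -
    have "0 \<le> L * sqrt L" using l0 ll by (intro mult_nonneg_nonneg) auto
    from mult_right_mono[OF _ this, of "72 * \<eta>" "80 * \<eta>"] \<eta>
    have "72 * \<eta> * (L * sqrt L) \<le> 80 * \<eta> * (L * sqrt L)" by linarith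
    moreover have "9 * \<eta> * (8 * (L * sqrt L)) = 72 * \<eta> * (L * sqrt L)" by simp
    ultimately show ?thesis by linarith
  qed
  finally have "ennreal (9 * \<eta> * R ^ 3) \<le> ennreal (80 * \<eta> * (L * sqrt L))" by (rule ennreal_leI)
  with log_excess_bound_small[OF assms(1) p pi p2 v close \<eta> True R_def] show ?thesis
    by (rule order_trans)
qed

text \<open>
  The negative part of the integrand only helps, and \<open>p \<le> \<phi> + \<eta>\<close>.
\<close>

lemma relative_entropy_le_of_sup_close:
  assumes [measurable]: "p \<in> borel_measurable borel"
    and p: "\<And>x. 0 \<le> p x" and pi: "(\<integral>\<^sup>+ x. ennreal (p x) \<partial>lborel) = 1"
    and p2: "(\<integral>\<^sup>+ x. ennreal (x\<^sup>2 * p x) \<partial>lborel) = ennreal (v\<^sup>2)"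
    and v: "1 \<le> v" "v\<^sup>2 \<le> 2"
    and close: "\<And>x. \<bar>p x - normal_density 0 v x\<bar> \<le> \<eta>" and \<eta>: "0 < \<eta>"
  defines "L \<equiv> ln (2 + 1 / \<eta>)"
  shows "relative_entropy p (normal_density 0 v) \<le> ereal (80 * \<eta> * (L * sqrt L))"
proof -
  let ?q = "normal_density 0 v"
  have q: "0 < ?q x" for x using v by (intro normal_density_pos) auto
  have l: "0 \<le> L" unfolding L_def using \<eta> by simp
  have "p x * ln (p x / ?q x) \<le> p x * ln (1 + \<eta> / ?q x)" for x
  proof (cases "p x = 0")
    case False
    have "p x / ?q x \<le> 1 + \<eta> / ?q x" using close[of x] q[of x] by (simp add: field_simps)
    hence "ln (p x / ?q x) \<le> ln (1 + \<eta> / ?q x)"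
      using False p[of x] q[of x] by (intro ln_mono) auto
    thus ?thesis using p by (intro mult_left_mono)
  qed simp
  hence "(\<integral>\<^sup>+ x. ennreal (p x * ln (p x / ?q x)) \<partial>lborel) \<le> (\<integral>\<^sup>+ x. ennreal (p x * ln (1 + \<eta> / ?q x)) \<partial>lborel)"
    by (intro nn_integral_mono ennreal_leI)
  also have "\<dots> \<le> ennreal (80 * \<eta> * (L * sqrt L))"
    unfolding L_def by (rule log_excess_bound[OF assms(1) p pi p2 v close \<eta>])
  finally have le: "(\<integral>\<^sup>+ x. ennreal (p x * ln (p x / ?q x)) \<partial>lborel) \<le> ennreal (80 * \<eta> * (L * sqrt L))" .
  have "0 \<le> 80 * \<eta> * (L * sqrt L)" using \<eta> l by (intro mult_nonneg_nonneg) auto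
  hence "enn2ereal (\<integral>\<^sup>+ x. ennreal (p x * ln (p x / ?q x)) \<partial>lborel) \<le> ereal (80 * \<eta> * (L * sqrt L))"
    using le by (simp only: less_eq_ennreal.rep_eq enn2ereal_ennreal)
  moreover have "a - enn2ereal b \<le> a" for a b
    by (rule ereal_diff_le_self) simp
  ultimately show ?thesis unfolding relative_entropy_def by (rule order_trans[rotated])
qed

text \<open>
  For \<open>\<eta> < 1\<close> the crude consequence \<open>d\<^sup>2 = O(\<eta>)\<close> of the hypothesis shows that \<open>ln (2 + 1/\<eta>)\<close> exceeds
  \<open>ln (2 + 1/d)\<close> by a constant factor at most; then the hypothesis itself gives the claim.
\<close>

lemma log_inversion:
  fixes d \<eta> :: real
  assumes d: "0 < d" and \<eta>: "0 < \<eta>"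
    and le: "d \<le> 160 * \<eta> * (ln (2 + 1 / \<eta>) * sqrt (ln (2 + 1 / \<eta>)))"
  shows "1 / \<eta>\<^sup>2 \<le> 311475200 * ln (2 + 1 / d) ^ 3 / d\<^sup>2"
proof -
  define L where "L = ln (2 + 1 / \<eta>)"
  define K where "K = ln (2 + 1 / d)"
  have pos: "0 < 2 + 1 / \<eta>" "0 < 2 + 1 / d" using d \<eta> by (auto intro: add_pos_pos)
  have half: "1 / 2 \<le> ln (2 + 1 / x)" if "0 < x" for x :: real
  proof -
    have "ln 2 \<le> ln (2 + 1 / x)" by (rule ln_mono) (use that in auto)
    thus ?thesis using ln_two_ge_half by linarith
  qed
  have L0: "1 / 2 \<le> L" and K0: "1 / 2 \<le> K" unfolding L_def K_def using half d \<eta> by auto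
  have "d\<^sup>2 \<le> (160 * \<eta> * (L * sqrt L))\<^sup>2" using le d unfolding L_def[symmetric] by (intro power_mono) auto
  also have "\<dots> = 25600 * \<eta>\<^sup>2 * L ^ 3"
    using L0 by (simp add: power_mult_distrib power2_eq_square power3_eq_cube)
  finally have d2: "d\<^sup>2 \<le> 25600 * \<eta>\<^sup>2 * L ^ 3" .
  have K3: "1 / 8 \<le> K ^ 3" using power_mono[OF K0, of 3] by (simp add: power_divide)
  \<comment> \<open>\<open>12167 = 23\<^sup>3\<close>, where the exponent \<open>23 = 21 + 2\<close> is such that \<open>2\<^sup>2\<^sup>1\<close> exceeds \<open>25600 * 81 = 2073600\<close>\<close>
  have "L ^ 3 \<le> 12167 * K ^ 3"
  proof (cases "1 \<le> \<eta>")
    case True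
    have "1 / \<eta> \<le> 1" using True by simp
    have "L \<le> (2 + 1 / \<eta>) - 1" unfolding L_def by (rule ln_le_minus_one[OF pos(1)])
    hence "L \<le> 2" using \<open>1 / \<eta> \<le> 1\<close> by linarith
    hence "L ^ 3 \<le> 2 ^ 3" using L0 by (intro power_mono) auto
    thus ?thesis using K3 by simp
  next
    case False
    have "(L / 3) ^ 3 \<le> exp (L / 3) ^ 3"
      using exp_ge_add_one_self[of "L / 3"] L0 by (intro power_mono) linarith+
    also have "\<dots> = exp L" by (simp flip: exp_of_nat_mult)
    also have "\<dots> = 2 + 1 / \<eta>" using pos by (simp add: L_def)
    also have "\<dots> \<le> 3 / \<eta>" using False \<eta> by (simp add: field_simps)
    finally have "L ^ 3 \<le> 81 / \<eta>" by (simp add: power_divide)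
    hence "25600 * \<eta>\<^sup>2 * L ^ 3 \<le> 25600 * \<eta>\<^sup>2 * (81 / \<eta>)" by (intro mult_left_mono) auto
    also have "\<dots> = 2073600 * \<eta>" using \<eta> by (simp add: power2_eq_square)
    finally have "d\<^sup>2 \<le> 2073600 * \<eta>" using d2 by linarith
    hence e1: "1 / \<eta> \<le> 2073600 / d\<^sup>2" using d \<eta> by (simp add: field_simps)
    have p1: "2 + 2073600 / d\<^sup>2 \<le> (2 + 1 / d) ^ 23"
    proof -
      have "2073600 / d\<^sup>2 \<le> 2097152 / d\<^sup>2" by (intro divide_right_mono) auto
      moreover have "2 ^ 21 * (4 + 1 / d\<^sup>2) = 8388608 + 2097152 / d\<^sup>2" by (simp add: distrib_left)
      ultimately have "2 + 2073600 / d\<^sup>2 \<le> 2 ^ 21 * (4 + 1 / d\<^sup>2)" by linarith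
      also have "2 ^ 21 * (4 + 1 / d\<^sup>2) \<le> (2 + 1 / d) ^ 21 * (2 + 1 / d)\<^sup>2"
      proof (intro mult_mono)
        show "2 ^ 21 \<le> (2 + 1 / d) ^ 21" using d by (intro power_mono) auto
        show "4 + 1 / d\<^sup>2 \<le> (2 + 1 / d)\<^sup>2" using d by (simp add: power2_sum power_divide)
      qed (use d in auto)
      also have "\<dots> = (2 + 1 / d) ^ 23" by (simp flip: power_add)
      finally show ?thesis .
    qed
    have "L \<le> ln ((2 + 1 / d) ^ 23)"
      unfolding L_def using e1 p1 pos by (intro ln_mono) linarith+
    also have "\<dots> = 23 * K" using pos by (simp add: K_def ln_realpow)
    finally have "L ^ 3 \<le> (23 * K) ^ 3" using L0 by (intro power_mono) auto
    thus ?thesis by (simp add: power_mult_distrib)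
  qed
  hence "25600 * \<eta>\<^sup>2 * L ^ 3 \<le> 25600 * \<eta>\<^sup>2 * (12167 * K ^ 3)" by (intro mult_left_mono) auto
  also have "\<dots> = 311475200 * K ^ 3 * \<eta>\<^sup>2" by simp
  finally have "d\<^sup>2 \<le> 311475200 * K ^ 3 * \<eta>\<^sup>2" using d2 by linarith
  thus ?thesis using d \<eta> unfolding K_def[symmetric] by (simp add: field_simps)
qed

section \<open>Quantitative form of the Sapogov--Cramer theorem\<close>

text \<open>
  The map \<open>u \<mapsto> u / (2 M - u)\<close> takes the half plane \<open>Re u < M\<close> into the unit disc and fixes \<open>0\<close>, so
  that Schwarz's lemma applies to its composition with \<open>g\<close>.
\<close>

lemma borel_caratheodory_half:
  fixes g :: "complex \<Rightarrow> complex"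
  assumes hol: "g holomorphic_on ball 0 T" and g0: "g 0 = 0" and T: "0 < T"
    and Re: "\<And>z. cmod z < T \<Longrightarrow> Re (g z) < M"
    and z: "cmod z \<le> T / 2"
  shows "cmod (g z) \<le> 2 * M"
proof -
  define h where "h w = g (of_real T * w) / (of_real (2 * M) - g (of_real T * w))" for w
  have M: "0 < M" using Re[of 0] g0 T by simp
  have lt: "cmod (g w) < cmod (of_real (2 * M) - g w)" if "cmod w < T" for w
  proof -
    have "Re (g w) < M" by (rule Re[OF that])
    hence "0 < (4 * M) * (M - Re (g w))" using M by simp
    hence "(Re (g w))\<^sup>2 + (Im (g w))\<^sup>2 < (2 * M - Re (g w))\<^sup>2 + (Im (g w))\<^sup>2"
      by (simp add: power2_eq_square algebra_simps)
    thus ?thesis unfolding cmod_def by (simp add: real_sqrt_less_mono)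
  qed
  have scale: "cmod (of_real T * w) < T" if "cmod w < 1" for w :: complex
    using that T by (simp add: norm_mult)
  have nz: "of_real (2 * M) - g (of_real T * w) \<noteq> 0" if "cmod w < 1" for w
    using lt[OF scale[OF that]] by (metis norm_ge_zero norm_zero not_less)
  have hg: "(\<lambda>w. g (of_real T * w)) holomorphic_on ball 0 1"
    by (rule holomorphic_on_compose_gen[OF _ hol, unfolded o_def])
       (auto intro!: holomorphic_intros simp: scale)
  have hh: "h holomorphic_on ball 0 1"
    unfolding h_def by (intro holomorphic_intros hg) (use nz in auto)
  have h1: "cmod (h w) < 1" if "cmod w < 1" for w
    using lt[OF scale[OF that]] nz[OF that] by (simp add: h_def norm_divide)
  define w where "w = z / of_real T"
  have w: "cmod w \<le> 1 / 2" using z T by (simp add: w_def norm_divide field_simps)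
  hence w1: "cmod w < 1" by simp
  have zw: "of_real T * w = z" using T by (simp add: w_def)
  have "cmod (h w) \<le> cmod w"
    by (rule Schwarz_Lemma(1)[OF hh _ h1 w1]) (simp add: h_def g0)
  hence "cmod (h w) \<le> 1 / 2" using w by simp
  hence "cmod (g z) \<le> 1 / 2 * cmod (of_real (2 * M) - g z)"
    using nz[OF w1] unfolding h_def zw by (simp add: norm_divide divide_simps)
  also have "\<dots> \<le> 1 / 2 * (2 * M + cmod (g z))"
    using norm_triangle_ineq4[of "of_real (2 * M)" "g z"] M by simp
  finally show ?thesis by simp
qed

text \<open>
  The previous bound on the disc of radius \<open>T/2\<close> and Cauchy's estimate on discs of radius \<open>T/4\<close>
  control the third derivative on the disc of radius \<open>T/4\<close>.
\<close>

lemma second_order_Taylor_of_Re_bound: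
  fixes g :: "complex \<Rightarrow> complex"
  assumes hol: "g holomorphic_on ball 0 T" and g0: "g 0 = 0" and T: "0 < T"
    and Re: "\<And>z. cmod z < T \<Longrightarrow> Re (g z) < M"
    and z: "cmod z \<le> T / 4"
  shows "cmod (g z - (deriv g 0 * z + (deriv ^^ 2) g 0 * z\<^sup>2 / 2)) \<le> 576 * M * cmod z ^ 3 / T ^ 3"
proof -
  have M: "0 < M" using Re[of 0] g0 T by simp
  have d3: "cmod ((deriv ^^ 3) g w) \<le> 1152 * M / T ^ 3" if w: "cmod w \<le> T / 4" for w
  proof -
    have sub: "cmod u \<le> T / 2" if "u \<in> cball w (T / 4)" for u
      using norm_triangle_sub[of u w] that w by (simp add: dist_norm norm_minus_commute)
    have sub': "cball w (T / 4) \<subseteq> ball 0 T" using sub T by fastforce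
    have "cmod ((deriv ^^ 3) g w) \<le> fact 3 * (3 * M) / (T / 4) ^ 3"
    proof (rule Cauchy_higher_deriv_bound)
      show "g holomorphic_on ball w (T / 4)"
        using holomorphic_on_subset[OF hol] sub' by (meson ball_subset_cball order_trans)
      show "continuous_on (cball w (T / 4)) g"
        using holomorphic_on_subset[OF hol sub'] holomorphic_on_imp_continuous_on by blast
      fix u assume "u \<in> ball w (T / 4)"
      hence "cmod u \<le> T / 2" by (intro sub) auto
      hence "cmod (g u) \<le> 2 * M"
        using borel_caratheodory_half[OF hol g0 T Re] by blast
      thus "g u \<in> ball 0 (3 * M)" using M by simp
    qed (use T in auto)
    also have "\<dots> = 1152 * M / T ^ 3" by (simp add: fact_numeral power_divide)
    finally show ?thesis .
  qed
  have "cmod ((deriv ^^ 0) g z - (\<Sum>i\<le>2. (deriv ^^ i) g 0 * (z - 0) ^ i / fact i))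
        \<le> (1152 * M / T ^ 3) * cmod (z - 0) ^ Suc 2 / fact 2"
  proof (rule complex_Taylor[where S = "cball 0 (T / 4)"])
    fix i and x :: complex assume x: "x \<in> cball 0 (T / 4)" and "i \<le> (2::nat)"
    have "x \<in> ball 0 T" using x T by auto
    hence "((deriv ^^ i) g has_field_derivative deriv ((deriv ^^ i) g) x) (at x)"
      by (intro holomorphic_derivI[of _ "ball 0 T"] holomorphic_higher_deriv hol) auto
    thus "((deriv ^^ i) g has_field_derivative (deriv ^^ Suc i) g x) (at x within cball 0 (T / 4))"
      by (simp add: has_field_derivative_at_within)
  next
    fix x :: complex assume "x \<in> cball 0 (T / 4)"
    thus "cmod ((deriv ^^ Suc 2) g x) \<le> 1152 * M / T ^ 3"
      using d3[of x] by (simp add: numeral_3_eq_3 numeral_2_eq_2)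
  qed (use z T in auto)
  moreover have "(\<Sum>i\<le>2. (deriv ^^ i) g 0 * z ^ i / fact i) = deriv g 0 * z + (deriv ^^ 2) g 0 * z\<^sup>2 / 2"
    by (simp add: numeral_2_eq_2 g0 eval_nat_numeral)
  moreover have "(1152 * M / T ^ 3) * cmod z ^ Suc 2 / fact 2 = 576 * M * cmod z ^ 3 / T ^ 3"
    by (simp add: eval_nat_numeral)
  ultimately show ?thesis by simp
qed

text \<open>
  For a bounded variable the expectation may be taken termwise in the exponential series.
\<close>

lemma (in prob_space) complex_mgf_bounded:
  fixes V :: "'a \<Rightarrow> real"
  assumes V[measurable]: "random_variable borel V" and bd: "\<And>\<omega>. \<bar>V \<omega>\<bar> \<le> N"
  defines "F \<equiv> (\<lambda>z. expectation (\<lambda>\<omega>. exp (z * complex_of_real (V \<omega>))))"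
  shows "F holomorphic_on UNIV"
    and "(deriv ^^ n) F 0 = of_real (expectation (\<lambda>\<omega>. V \<omega> ^ n))"
proof -
  define a where "a n = complex_of_real (expectation (\<lambda>\<omega>. V \<omega> ^ n)) / fact n" for n
  have N: "0 \<le> N" using bd[of undefined] by (rule order_trans[rotated]) simp
  have bdn: "\<bar>V \<omega> ^ n\<bar> \<le> N ^ n" for \<omega> n
    using bd[of \<omega>] by (simp add: power_abs power_mono)
  have int: "integrable M (\<lambda>\<omega>. V \<omega> ^ n)" for n
    by (rule integrable_const_bound[where B = "N ^ n"]) (use bdn in auto)
  have sums: "(\<lambda>n. a n * z ^ n) sums F z" for z
  proof -
    let ?f = "\<lambda>n \<omega>. (z * complex_of_real (V \<omega>)) ^ n / fact n"
    have eq: "?f n \<omega> = z ^ n / fact n * complex_of_real (V \<omega> ^ n)" for n \<omega>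
      by (simp add: power_mult_distrib)
    have i: "integrable M (?f n)" for n
      unfolding eq by (intro integrable_mult_right integrable_of_real int)
    have nb: "norm (?f n \<omega>) \<le> (cmod z * N) ^ n / fact n" for n \<omega>
      using bd[of \<omega>] by (simp add: norm_divide norm_power norm_mult power_mono mult_left_mono divide_right_mono)
    have sm: "summable (\<lambda>n. (cmod z * N) ^ n / fact n)"
      using summable_exp_generic[of "cmod z * N"] by (simp add: divide_inverse mult.commute)
    have "(\<lambda>n. expectation (?f n)) sums (\<integral>\<omega>. (\<Sum>n. ?f n \<omega>) \<partial>M)"
    proof (rule sums_integral[OF i])
      show "AE x in M. summable (\<lambda>n. norm (?f n x))"
        by (intro always_eventually allI summable_comparison_test'[OF sm, of 0]) (use nb in simp)
      show "summable (\<lambda>n. \<integral>\<omega>. norm (?f n \<omega>) \<partial>M)"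
      proof (rule summable_comparison_test'[OF sm, of 0])
        fix n
        have "(\<integral>\<omega>. norm (?f n \<omega>) \<partial>M) \<le> (\<integral>\<omega>. (cmod z * N) ^ n / fact n \<partial>M)"
          by (rule integral_mono) (use nb i in \<open>auto intro: integrable_norm\<close>)
        thus "norm (\<integral>\<omega>. norm (?f n \<omega>) \<partial>M) \<le> (cmod z * N) ^ n / fact n"
          by (simp add: prob_space)
      qed
    qed
    moreover have "(\<Sum>n. ?f n \<omega>) = exp (z * complex_of_real (V \<omega>))" for \<omega>
      by (simp add: exp_def scaleR_conv_of_real divide_inverse mult.commute)
    moreover have "expectation (?f n) = a n * z ^ n" for n
      unfolding eq by (subst integral_mult_right_zero, subst integral_of_real[OF int]) (simp add: a_def)
    ultimately show ?thesis by (simp add: F_def)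
  qed
  show "F holomorphic_on UNIV"
  proof -
    have "F holomorphic_on ball 0 r" for r
      by (rule power_series_holomorphic[of 0 r a]) (use sums in simp)
    hence "F holomorphic_on (\<Union>r\<in>UNIV. ball 0 r)"
      by (intro holomorphic_on_UN_open) auto
    moreover have "(\<Union>r\<in>UNIV. ball (0::complex) r) = UNIV"
      by (auto intro: gt_ex)
    ultimately show "F holomorphic_on UNIV" by simp
  qed
  have "F has_fps_expansion Abs_fps a"
    by (rule has_fps_expansionI) (use sums in simp)
  from fps_nth_fps_expansion[OF this, of n]
  show "(deriv ^^ n) F 0 = of_real (expectation (\<lambda>\<omega>. V \<omega> ^ n))"
    by (simp add: a_def)
qed

lemma norm_exp_minus_1_le: "cmod (exp w - 1) \<le> cmod w * exp (cmod w)"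
proof -
  have "cmod (exp w - (\<Sum>k\<le>0. w ^ k / fact k)) \<le> exp \<bar>Re w\<bar> * cmod w ^ Suc 0 / fact 0"
    by (rule Taylor_exp)
  also have "\<dots> \<le> cmod w * exp (cmod w)"
    using abs_Re_le_cmod[of w] by (simp add: mult.commute mult_left_mono)
  finally show ?thesis by simp
qed

text \<open>
  Jensen's inequality for the exponential function, from the tangent at the mean.
\<close>

lemma (in prob_space) exp_expectation_le:
  fixes V :: "'a \<Rightarrow> real"
  assumes "integrable M V" and e: "integrable M (\<lambda>\<omega>. exp (V \<omega>))"
  shows "exp (expectation V) \<le> expectation (\<lambda>\<omega>. exp (V \<omega>))"
proof -
  define m where "m = expectation V"
  have "exp m * (1 + (expectation V - m)) = expectation (\<lambda>\<omega>. exp m * (1 + (V \<omega> - m)))"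
    using assms by (simp add: prob_space)
  also have "\<dots> \<le> expectation (\<lambda>\<omega>. exp (V \<omega>))"
  proof (rule integral_mono)
    fix \<omega>
    have "exp m * (1 + (V \<omega> - m)) \<le> exp m * exp (V \<omega> - m)"
      by (intro mult_left_mono exp_ge_add_one_self) auto
    thus "exp m * (1 + (V \<omega> - m)) \<le> exp (V \<omega>)" by (simp flip: exp_add)
  qed (use assms in auto)
  finally show ?thesis by (simp add: m_def)
qed

lemma exp_neg_2sq_le_half:
  fixes T :: real assumes "1 \<le> T" shows "exp (- 2 * T\<^sup>2) \<le> 1 / 2"
proof -
  have "1 \<le> T\<^sup>2" using assms by simp
  hence "2 \<le> exp (2 * T\<^sup>2)" using exp_ge_add_one_self[of "2 * T\<^sup>2"] by linarith
  thus ?thesis by (simp add: exp_minus field_simps)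
qed

text \<open>
  The pair enters through the product of the two moment generating functions, which is close to the
  one of the sum of two independent standard normal variables. The second moments are bounded from
  above, and their sum is determined by the second derivative of the product at \<open>0\<close>, so each of
  them is close to \<open>1\<close>.
\<close>

lemma (in prob_space) Sapogov_char_estimate:
  fixes U V :: "'a \<Rightarrow> real"
  assumes U[measurable]: "random_variable borel U" and V[measurable]: "random_variable borel V"
    and bU: "\<And>\<omega>. \<bar>U \<omega>\<bar> \<le> N" and bV: "\<And>\<omega>. \<bar>V \<omega>\<bar> \<le> N"
    and T: "1 \<le> T"
    and U2: "expectation (\<lambda>\<omega>. (U \<omega>)\<^sup>2) \<le> 1" and V2: "expectation (\<lambda>\<omega>. (V \<omega>)\<^sup>2) \<le> 1"
    and mU: "\<bar>expectation U\<bar> \<le> 1 / T" and mV: "\<bar>expectation V\<bar> \<le> 1 / T"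
    and close: "\<And>z. cmod z \<le> T \<Longrightarrow>
       cmod (expectation (\<lambda>\<omega>. exp (z * complex_of_real (U \<omega>))) *
             expectation (\<lambda>\<omega>. exp (z * complex_of_real (V \<omega>))) - exp (z\<^sup>2)) \<le> exp (- 2 * T\<^sup>2)"
    and t: "\<bar>t\<bar> \<le> T / 20000"
  shows "cmod (expectation (\<lambda>\<omega>. exp (\<i> * t * complex_of_real (U \<omega>))) - exp (- (complex_of_real t)\<^sup>2 / 2))
           \<le> 2304 * exp 2 / T * ((\<bar>t\<bar> + t\<^sup>2 + \<bar>t\<bar> ^ 3) * exp (- 3 / 8 * t\<^sup>2))"
proof -
  have T0: "0 < T" using T by simp
  have Tsq: "1 \<le> T\<^sup>2" using T by simp
  define F where "F = (\<lambda>z. expectation (\<lambda>\<omega>. exp (z * complex_of_real (U \<omega>))))"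
  define G where "G = (\<lambda>z. expectation (\<lambda>\<omega>. exp (z * complex_of_real (V \<omega>))))"
  note F = complex_mgf_bounded[OF U bU, folded F_def]
  note G = complex_mgf_bounded[OF V bV, folded G_def]
  have iV: "integrable M V" by (rule integrable_const_bound[where B = N]) (use bV in auto)
  have eb: "\<bar>exp (x * W \<omega>)\<bar> \<le> exp (\<bar>x\<bar> * N)" if "\<And>\<omega>. \<bar>W \<omega>\<bar> \<le> N" for x and W :: "'a \<Rightarrow> real" and \<omega>
  proof -
    have "x * W \<omega> \<le> \<bar>x\<bar> * \<bar>W \<omega>\<bar>" by (metis abs_ge_self abs_mult)
    also have "\<dots> \<le> \<bar>x\<bar> * N" using that by (intro mult_left_mono) auto
    finally show ?thesis by simp
  qed
  have ieV: "integrable M (\<lambda>\<omega>. exp (x * V \<omega>))" for x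
    by (rule integrable_const_bound[where B = "exp (\<bar>x\<bar> * N)"]) (use eb[of V, OF bV] in auto)
  define m where "m = expectation U"
  define m' where "m' = expectation V"
  define s where "s = expectation (\<lambda>\<omega>. (U \<omega>)\<^sup>2)"
  define s' where "s' = expectation (\<lambda>\<omega>. (V \<omega>)\<^sup>2)"
  have F0: "F 0 = 1" and G0: "G 0 = 1" by (auto simp: F_def G_def prob_space)
  have dF: "deriv F 0 = of_real m" "(deriv ^^ 2) F 0 = of_real s"
    using F(2)[of 1] F(2)[of 2] by (auto simp: m_def s_def)
  have dG: "deriv G 0 = of_real m'" "(deriv ^^ 2) G 0 = of_real s'"
    using G(2)[of 1] G(2)[of 2] by (auto simp: m'_def s'_def)
  \<comment> \<open>Cauchy's estimate for the second derivative of \<open>F G - exp z\<^sup>2\<close> at \<open>0\<close>\<close>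
  have second: "\<bar>s + s' + 2 * (m * m') - 2\<bar> \<le> 2 / T\<^sup>2"
  proof -
    define E where "E = (\<lambda>z. F z * G z - exp (z\<^sup>2))"
    have hE: "E holomorphic_on UNIV" unfolding E_def by (intro holomorphic_intros F(1) G(1))
    have cE: "continuous_on A E" for A
      using hE holomorphic_on_imp_continuous_on continuous_on_subset by blast
    have "cmod ((deriv ^^ 2) E 0) \<le> fact 2 * 1 / T ^ 2"
    proof (rule Cauchy_higher_deriv_bound)
      fix w :: complex assume "w \<in> ball 0 T"
      hence "cmod (E w) \<le> exp (- 2 * T\<^sup>2)" using close[of w] by (simp add: E_def F_def G_def)
      also have "\<dots> \<le> 1 / 2" by (rule exp_neg_2sq_le_half[OF T])
      finally show "E w \<in> ball 0 1" by simp
    qed (use T0 cE holomorphic_on_subset[OF hE] in auto)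
    moreover have "(deriv ^^ 2) E 0 = of_real (s + s' + 2 * (m * m') - 2)"
    proof -
      have hFG: "(\<lambda>z. F z * G z) holomorphic_on UNIV" by (intro holomorphic_intros F(1) G(1))
      have FG2: "(deriv ^^ 2) (\<lambda>z. F z * G z) 0 = of_real (s + s' + 2 * (m * m'))"
        using higher_deriv_mult[OF F(1) G(1) open_UNIV UNIV_I, of 2 0]
        using dF dG by (simp add: numeral_2_eq_2 F0 G0 algebra_simps)
      have d1: "deriv (\<lambda>z. exp (z\<^sup>2)) = (\<lambda>z::complex. 2 * z * exp (z\<^sup>2))"
        by (rule ext, rule DERIV_imp_deriv) (auto intro!: derivative_eq_intros)
      have d2: "deriv (\<lambda>z::complex. 2 * z * exp (z\<^sup>2)) 0 = 2"
        by (rule DERIV_imp_deriv) (auto intro!: derivative_eq_intros)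
      have funpow_2: "(deriv ^^ 2) f = deriv (deriv f)" for f :: "complex \<Rightarrow> complex"
        by (simp add: numeral_2_eq_2)
      have e2: "(deriv ^^ 2) (\<lambda>z::complex. exp (z\<^sup>2)) 0 = 2"
        unfolding funpow_2 d1 d2 ..
      have "(deriv ^^ 2) E 0 = (deriv ^^ 2) (\<lambda>z. F z * G z) 0 - (deriv ^^ 2) (\<lambda>z. exp (z\<^sup>2)) 0"
        unfolding E_def by (rule higher_deriv_diff[OF hFG _ open_UNIV UNIV_I]) (intro holomorphic_intros)
      thus ?thesis by (simp add: FG2 e2)
    qed
    ultimately show ?thesis by (simp only: norm_of_real) (simp add: fact_numeral)
  qed
  have sq1: "m\<^sup>2 \<le> 1 / T\<^sup>2"
    using power_mono[OF mU, of 2] by (simp add: m_def power_divide)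
  have mm: "m * m' \<le> 1 / T\<^sup>2"
  proof -
    have "m * m' \<le> \<bar>m\<bar> * \<bar>m'\<bar>" by (metis abs_ge_self abs_mult)
    also have "\<dots> \<le> (1 / T) * (1 / T)" using mU mV T0 by (intro mult_mono) (auto simp: m_def m'_def)
    finally show ?thesis by (simp add: power2_eq_square)
  qed
  define v where "v = s - m\<^sup>2"
  have v: "v \<le> 1" "1 - 5 / T\<^sup>2 \<le> v"
  proof -
    show "v \<le> 1" using U2 zero_le_power2[of m] unfolding v_def s_def by linarith
    have "s' \<le> 1" using V2 by (simp add: s'_def)
    hence "1 - 4 / T\<^sup>2 \<le> s" using second mm by (simp add: divide_inverse abs_le_iff)
    thus "1 - 5 / T\<^sup>2 \<le> v" using sq1 by (simp add: v_def divide_inverse)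
  qed
  \<comment> \<open>a zero of \<open>F\<close> would make the error at least \<open>exp (- T\<^sup>2)\<close>\<close>
  have nz: "F z \<noteq> 0" if z: "cmod z \<le> T" for z
  proof
    assume "F z = 0"
    hence "cmod (exp (z\<^sup>2)) \<le> exp (- 2 * T\<^sup>2)" using close[OF z] by (simp add: F_def norm_minus_commute)
    moreover have "- T\<^sup>2 \<le> Re (z\<^sup>2)"
    proof -
      have "\<bar>Re (z\<^sup>2)\<bar> \<le> (cmod z)\<^sup>2" using abs_Re_le_cmod[of "z\<^sup>2"] by (simp add: norm_power)
      also have "\<dots> \<le> T\<^sup>2" using z by (simp add: power_mono)
      finally show ?thesis by simp
    qed
    hence "exp (- T\<^sup>2) \<le> cmod (exp (z\<^sup>2))" by simp
    ultimately have "exp (- T\<^sup>2) \<le> exp (- 2 * T\<^sup>2)" by linarith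
    thus False using Tsq by simp
  qed
  \<comment> \<open>\<open>F (Re z) G (Re z)\<close> is at most of order \<open>exp T\<^sup>2\<close>, and the second factor is not small by Jensen's inequality\<close>
  have growth: "cmod (F z) \<le> exp (3 * T\<^sup>2)" if z: "cmod z \<le> T" for z
  proof -
    define x where "x = Re z"
    have x: "\<bar>x\<bar> \<le> T" using abs_Re_le_cmod[of z] z by (simp add: x_def)
    define f where "f = expectation (\<lambda>\<omega>. exp (x * U \<omega>))"
    define h where "h = expectation (\<lambda>\<omega>. exp (x * V \<omega>))"
    have "cmod (F z) \<le> (\<integral>\<omega>. cmod (exp (z * complex_of_real (U \<omega>))) \<partial>M)"
      unfolding F_def by (rule integral_norm_bound)
    also have "\<dots> = f" by (simp add: f_def x_def)
    finally have 1: "cmod (F z) \<le> f" .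
    have of: "F (of_real x) = of_real f"
      unfolding F_def f_def by (simp flip: of_real_mult of_real_exp integral_of_real add: integral_complex_of_real)
    have og: "G (of_real x) = of_real h"
      unfolding G_def h_def by (simp flip: of_real_mult of_real_exp integral_of_real add: integral_complex_of_real)
    have "cmod (of_real f * of_real h - of_real (exp (x\<^sup>2))) \<le> exp (- 2 * T\<^sup>2)"
      using close[of "of_real x"] x of og
      by (simp add: F_def G_def flip: of_real_mult of_real_exp of_real_power)
    hence "\<bar>f * h - exp (x\<^sup>2)\<bar> \<le> exp (- 2 * T\<^sup>2)"
      by (simp only: norm_of_real flip: of_real_mult of_real_diff)
    moreover have "exp (- 2 * T\<^sup>2) \<le> 1" by simp
    moreover have "1 \<le> exp (T\<^sup>2)" by simp
    moreover have "exp (x\<^sup>2) \<le> exp (T\<^sup>2)" using power_mono[OF x, of 2] by simp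
    ultimately have fh: "f * h \<le> 2 * exp (T\<^sup>2)" by linarith
    have "exp (- 1) \<le> exp (x * m')"
    proof -
      have "\<bar>x * m'\<bar> \<le> T * (1 / T)" unfolding abs_mult using x mV by (intro mult_mono) (auto simp: m'_def)
      thus ?thesis using T0 by simp
    qed
    also have "exp (x * m') = exp (expectation (\<lambda>\<omega>. x * V \<omega>))" using iV by (simp add: m'_def)
    also have "\<dots> \<le> h" unfolding h_def by (rule exp_expectation_le) (use iV ieV in auto)
    finally have h: "exp (- 1) \<le> h" .
    have f0: "0 \<le> f" unfolding f_def by simp
    have "f * exp (- 1) \<le> 2 * exp (T\<^sup>2)" using mult_left_mono[OF h f0] fh by linarith
    hence "f \<le> 2 * exp (T\<^sup>2) * exp 1" by (simp add: exp_minus field_simps)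
    also have "\<dots> \<le> exp 1 * exp (T\<^sup>2) * exp 1"
      using exp_ge_add_one_self[of 1] by (intro mult_right_mono) auto
    also have "\<dots> = exp (2 + T\<^sup>2)" by (simp flip: exp_add)
    also have "\<dots> \<le> exp (3 * T\<^sup>2)" using Tsq by simp
    finally show ?thesis using 1 by simp
  qed
  \<comment> \<open>a logarithm of \<open>F\<close>, normalized to vanish at \<open>0\<close>\<close>
  have "F holomorphic_on ball 0 T" using F(1) by (rule holomorphic_on_subset) simp
  then obtain g0 where g0: "g0 holomorphic_on ball 0 T" "\<And>z. z \<in> ball 0 T \<Longrightarrow> F z = exp (g0 z)"
    using contractible_imp_holomorphic_log[of F "ball 0 T"] nz
    by (metis convex_ball convex_imp_contractible dist_0_norm less_imp_le mem_ball)
  define g where "g z = g0 z - g0 0" for z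
  have hg: "g holomorphic_on ball 0 T" unfolding g_def by (intro holomorphic_intros g0)
  have Fg: "F z = exp (g z)" if "cmod z < T" for z
    using g0(2)[of z] g0(2)[of 0] that T0 F0 by (simp add: g_def exp_diff)
  have gg0: "g 0 = 0" by (simp add: g_def)
  have ReM: "Re (g z) < 4 * T\<^sup>2" if "cmod z < T" for z
  proof -
    have "exp (Re (g z)) \<le> exp (3 * T\<^sup>2)" using growth[of z] Fg[of z] that by simp
    hence "Re (g z) \<le> 3 * T\<^sup>2" by simp
    thus ?thesis using Tsq by linarith
  qed
  have gder: "(g has_field_derivative deriv g z) (at z)" if "cmod z < T" for z
    using hg that by (intro holomorphic_derivI[of _ "ball 0 T"]) auto
  have hdg: "deriv g holomorphic_on ball 0 T" by (intro holomorphic_deriv hg) auto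
  have gder2: "(deriv g has_field_derivative deriv (deriv g) z) (at z)" if "cmod z < T" for z
    using hdg that by (intro holomorphic_derivI[of _ "ball 0 T"]) auto
  have dFz: "deriv F z = deriv g z * exp (g z)" if z: "cmod z < T" for z
  proof -
    have "((\<lambda>z. exp (g z)) has_field_derivative deriv g z * exp (g z)) (at z)"
      using gder[OF z] by (auto intro!: derivative_eq_intros)
    hence "(F has_field_derivative deriv g z * exp (g z)) (at z)"
      by (rule has_field_derivative_transform_within_open[of _ _ _ "ball 0 T"]) (use z Fg in auto)
    thus ?thesis by (rule DERIV_imp_deriv)
  qed
  have g1: "deriv g 0 = of_real m" using dFz[of 0] T0 dF gg0 by simp
  have g2: "(deriv ^^ 2) g 0 = of_real v"
  proof -
    have "((\<lambda>z. deriv g z * exp (g z)) has_field_derivative deriv (deriv g) 0 + (deriv g 0)\<^sup>2) (at 0)"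
      using gder[of 0] gder2[of 0] T0 by (auto intro!: derivative_eq_intros simp: gg0 power2_eq_square)
    hence "(deriv F has_field_derivative deriv (deriv g) 0 + (deriv g 0)\<^sup>2) (at 0)"
      by (rule has_field_derivative_transform_within_open[of _ _ _ "ball 0 T"]) (use T0 dFz in auto)
    hence "deriv (deriv F) 0 = deriv (deriv g) 0 + (deriv g 0)\<^sup>2" by (rule DERIV_imp_deriv)
    thus ?thesis using dF(2) by (simp add: numeral_2_eq_2 g1 v_def algebra_simps)
  qed
  have t1: "cmod (\<i> * t) \<le> T / 4" using t T0 by (simp add: norm_mult)
  have t2: "cmod (\<i> * t) < T" using t1 T0 by simp
  have taylor: "cmod (g (\<i> * t) - (of_real m * (\<i> * t) + of_real v * (\<i> * t)\<^sup>2 / 2)) \<le> 2304 / T * \<bar>t\<bar> ^ 3"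
  proof -
    have "cmod (g (\<i> * t) - (of_real m * (\<i> * t) + of_real v * (\<i> * t)\<^sup>2 / 2))
          \<le> 576 * (4 * T\<^sup>2) * cmod (\<i> * t) ^ 3 / T ^ 3"
      using second_order_Taylor_of_Re_bound[OF hg gg0 T0 ReM t1] by (simp only: g1 g2)
    also have "\<dots> = 2304 / T * \<bar>t\<bar> ^ 3"
      using T0 by (simp add: norm_mult power2_eq_square power3_eq_cube)
    finally show ?thesis .
  qed
  \<comment> \<open>\<open>w\<close> is the deviation of the logarithm from that of the standard normal law; it is small, and it is
     also at most a small multiple of \<open>t\<^sup>2\<close>, which leaves a Gaussian factor in the final estimate\<close>
  define w where "w = g (\<i> * t) + (complex_of_real t)\<^sup>2 / 2"
  have wsplit: "cmod w \<le> \<bar>t\<bar> / T + 5 / T\<^sup>2 * t\<^sup>2 + 2304 / T * \<bar>t\<bar> ^ 3"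
  proof -
    have "w = (g (\<i> * t) - (of_real m * (\<i> * t) + of_real v * (\<i> * t)\<^sup>2 / 2)) + of_real m * (\<i> * t)
              + of_real ((1 - v) / 2 * t\<^sup>2)"
      by (simp add: w_def power_mult_distrib field_simps)
    also have "cmod \<dots> \<le> cmod (g (\<i> * t) - (of_real m * (\<i> * t) + of_real v * (\<i> * t)\<^sup>2 / 2))
        + cmod (of_real m * (\<i> * t)) + cmod (of_real ((1 - v) / 2 * t\<^sup>2))"
      by (meson norm_triangle_le order_refl add_mono norm_triangle_ineq order_trans)
    also have "cmod (of_real m * (\<i> * t)) \<le> \<bar>t\<bar> / T"
      using mult_right_mono[OF mU, of "\<bar>t\<bar>"] by (simp add: norm_mult m_def)
    also have "cmod (of_real ((1 - v) / 2 * t\<^sup>2)) \<le> 5 / T\<^sup>2 * t\<^sup>2"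
      unfolding norm_of_real abs_mult using v by (intro mult_mono) auto
    finally show ?thesis using taylor by simp
  qed
  have w1: "cmod w \<le> 2304 / T * (\<bar>t\<bar> + t\<^sup>2 + \<bar>t\<bar> ^ 3)"
  proof -
    have "\<bar>t\<bar> / T \<le> 2304 / T * \<bar>t\<bar>" using T0 by (simp add: field_simps)
    moreover have "5 / T\<^sup>2 * t\<^sup>2 \<le> 2304 / T * t\<^sup>2"
    proof (rule mult_right_mono)
      have "5 / T\<^sup>2 = (5 / T) / T" by (simp add: power2_eq_square)
      also have "\<dots> \<le> 5 / T" using T T0 by (simp add: field_simps)
      finally show "5 / T\<^sup>2 \<le> 2304 / T" using T0 by (simp add: field_simps)
    qed auto
    ultimately show ?thesis using wsplit unfolding distrib_left by linarith
  qed
  have w2: "cmod w \<le> 2 + t\<^sup>2 / 8"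
  proof -
    have tT: "\<bar>t\<bar> / T \<le> 1 / 20000" using t T0 by (simp add: field_simps)
    have "5 / T\<^sup>2 * t\<^sup>2 = 5 * (\<bar>t\<bar> / T)\<^sup>2" by (simp add: power_divide)
    also have "\<dots> \<le> 5 * (1 / 20000)\<^sup>2" using tT T0 by (intro mult_left_mono power_mono) auto
    also have "\<dots> \<le> 1" by (simp add: power2_eq_square)
    finally have a: "5 / T\<^sup>2 * t\<^sup>2 \<le> 1" .
    have "2304 / T * \<bar>t\<bar> ^ 3 = 2304 * (\<bar>t\<bar> / T) * t\<^sup>2" by (simp add: power3_eq_cube power2_eq_square)
    also have "\<dots> \<le> 2304 * (1 / 20000) * t\<^sup>2" using tT by (intro mult_right_mono mult_left_mono) auto
    also have "\<dots> \<le> t\<^sup>2 / 8" using zero_le_power2[of t] by linarith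
    finally have b: "2304 / T * \<bar>t\<bar> ^ 3 \<le> t\<^sup>2 / 8" .
    show ?thesis using wsplit a b tT by linarith
  qed
  have "F (\<i> * t) - exp (- (complex_of_real t)\<^sup>2 / 2) = exp (- (complex_of_real t)\<^sup>2 / 2) * (exp w - 1)"
    using Fg[OF t2] by (simp add: w_def algebra_simps flip: exp_add)
  also have "cmod \<dots> \<le> exp (- t\<^sup>2 / 2) * (cmod w * exp (cmod w))"
  proof -
    have "exp (- (complex_of_real t)\<^sup>2 / 2) = of_real (exp (- t\<^sup>2 / 2))" by (simp add: exp_of_real[symmetric])
    thus ?thesis using norm_exp_minus_1_le[of w] by (simp add: norm_mult mult_left_mono)
  qed
  also have "\<dots> \<le> exp (- t\<^sup>2 / 2) * (2304 / T * (\<bar>t\<bar> + t\<^sup>2 + \<bar>t\<bar> ^ 3) * exp (2 + t\<^sup>2 / 8))"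
    using w1 w2 T0 by (intro mult_left_mono mult_mono) auto
  also have "\<dots> = 2304 * exp 2 / T * ((\<bar>t\<bar> + t\<^sup>2 + \<bar>t\<bar> ^ 3) * (exp (- t\<^sup>2 / 2) * exp (t\<^sup>2 / 8)))"
    by (simp add: exp_add)
  also have "exp (- t\<^sup>2 / 2) * exp (t\<^sup>2 / 8) = exp (- 3 / 8 * t\<^sup>2)" by (simp flip: exp_add)
  finally show ?thesis by (simp add: F_def)
qed

section \<open>Gaussian smoothing of a probability law\<close>

text \<open>
  The density of the convolution of \<open>\<mu>\<close> with the centered normal law of standard deviation \<open>\<sigma>\<close>.
\<close>

definition gauss_smoothing :: "real measure \<Rightarrow> real \<Rightarrow> real \<Rightarrow> real" where
  "gauss_smoothing \<mu> \<sigma> x = (\<integral>y. normal_density 0 \<sigma> (x - y) \<partial>\<mu>)"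

lemma normal_density_le_inverse:
  assumes "0 < \<sigma>" shows "normal_density m \<sigma> x \<le> 1 / \<sigma>"
proof -
  have "1 * \<sigma> \<le> sqrt (2 * pi) * \<sigma>"
    using pi_gt3 assms by (intro mult_right_mono) (auto intro!: real_le_rsqrt)
  hence "1 / sqrt (2 * pi * \<sigma>\<^sup>2) \<le> 1 / \<sigma>" using assms by (simp add: real_sqrt_mult frac_le)
  moreover have "exp (- (x - m)\<^sup>2 / (2 * \<sigma>\<^sup>2)) \<le> 1" by simp
  ultimately have "1 / sqrt (2 * pi * \<sigma>\<^sup>2) * exp (- (x - m)\<^sup>2 / (2 * \<sigma>\<^sup>2)) \<le> 1 / \<sigma> * 1"
    using assms by (intro mult_mono) auto
  thus ?thesis by (simp add: normal_density_def)
qed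

lemma char_normal_density:
  assumes "0 < \<sigma>"
  shows "(\<integral>x. normal_density 0 \<sigma> x *\<^sub>R iexp (t * x) \<partial>lborel) = complex_of_real (exp (- (\<sigma>\<^sup>2 * t\<^sup>2) / 2))"
proof -
  have "(\<integral>x. normal_density 0 \<sigma> x *\<^sub>R iexp (t * x) \<partial>lborel)
        = \<bar>\<sigma>\<bar> *\<^sub>R (\<integral>x. normal_density 0 \<sigma> (0 + \<sigma> * x) *\<^sub>R iexp (t * (0 + \<sigma> * x)) \<partial>lborel)"
    using assms by (intro lborel_integral_real_affine) auto
  also have "\<dots> = (\<integral>x. \<sigma> *\<^sub>R (normal_density 0 \<sigma> (\<sigma> * x) *\<^sub>R iexp (t * (\<sigma> * x))) \<partial>lborel)"
    using assms by (simp del: scaleR_scaleR)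
  also have "\<dots> = (\<integral>x. std_normal_density x *\<^sub>R iexp ((t * \<sigma>) * x) \<partial>lborel)"
    by (intro Bochner_Integration.integral_cong)
       (use assms in \<open>auto simp: normal_density_def power_mult_distrib real_sqrt_mult mult_ac\<close>)
  also have "\<dots> = char std_normal_distribution (t * \<sigma>)"
    unfolding char_def by (subst integral_density) auto
  finally show ?thesis by (simp add: char_std_normal_distribution power_mult_distrib mult.commute)
qed

text \<open>
  The derivative of a normal density is dominated by translates of the density itself. This is what
  makes the Lipschitz bound for smoothed laws proportional to their supremum.
\<close>

lemma abs_mult_gauss_le_shift: "\<bar>s\<bar> * exp (- s\<^sup>2 / 2) \<le> exp (- (s - 1)\<^sup>2 / 2) + exp (- (s + 1)\<^sup>2 / (2::real))"
proof -
  define r where "r = \<bar>s\<bar>"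
  have r: "0 \<le> r" "r\<^sup>2 = s\<^sup>2" by (auto simp: r_def)
  have "0 \<le> (1 - r)\<^sup>2" by simp
  hence "2 * r \<le> 1 + r + r\<^sup>2 / 2" by (simp add: power2_eq_square algebra_simps)
  also have "\<dots> \<le> exp r" using r by (intro exp_lower_Taylor_quadratic) auto
  finally have e: "2 * r \<le> exp r" .
  have "1 / 2 \<le> exp (- (1/2::real))" using exp_half_le_2 by (simp add: exp_minus field_simps)
  hence "2 * r * (1 / 2) \<le> exp r * exp (- (1 / 2))" using e r by (intro mult_mono) auto
  hence "r * exp (- r\<^sup>2 / 2) \<le> exp r * exp (- (1 / 2)) * exp (- r\<^sup>2 / 2)" by (intro mult_right_mono) auto
  also have "\<dots> = exp (- (r - 1)\<^sup>2 / 2)"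
    by (simp add: power2_eq_square algebra_simps flip: exp_add)
  also have "\<dots> \<le> exp (- (s - 1)\<^sup>2 / 2) + exp (- (s + 1)\<^sup>2 / 2)"
  proof (cases "0 \<le> s")
    case False
    hence "(r - 1)\<^sup>2 = (s + 1)\<^sup>2" by (simp add: r_def power2_eq_square algebra_simps)
    thus ?thesis by simp
  qed (simp add: r_def)
  finally show ?thesis by (simp add: r_def)
qed

text \<open>
  The left-hand side is monotone in \<open>\<bar>w\<bar>\<close>, and if the interval contains \<open>0\<close> it varies by less than a factor \<open>2\<close>
  there.
\<close>

lemma gauss_le_endpoints:
  fixes w a b :: real
  assumes "a \<le> w" "w \<le> b" "b - a \<le> 1"
  shows "exp (- w\<^sup>2 / 2) \<le> 2 * (exp (- a\<^sup>2 / 2) + exp (- b\<^sup>2 / 2))"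
proof -
  have half: "exp (- x\<^sup>2 / 2) \<le> 2 * (exp (- a\<^sup>2 / 2) + exp (- b\<^sup>2 / 2))" if "x\<^sup>2 \<ge> a\<^sup>2 \<or> x\<^sup>2 \<ge> b\<^sup>2" for x
  proof -
    have "exp (- x\<^sup>2 / 2) \<le> exp (- a\<^sup>2 / 2) + exp (- b\<^sup>2 / 2)"
      using that
    proof
      assume "x\<^sup>2 \<ge> a\<^sup>2"
      hence "exp (- x\<^sup>2 / 2) \<le> exp (- a\<^sup>2 / 2)" by simp
      thus ?thesis using exp_ge_zero[of "- b\<^sup>2 / 2"] by linarith
    next
      assume "x\<^sup>2 \<ge> b\<^sup>2"
      hence "exp (- x\<^sup>2 / 2) \<le> exp (- b\<^sup>2 / 2)" by simp
      thus ?thesis using exp_ge_zero[of "- a\<^sup>2 / 2"] by linarith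
    qed
    also have "\<dots> \<le> 2 * (exp (- a\<^sup>2 / 2) + exp (- b\<^sup>2 / 2))" by simp
    finally show ?thesis .
  qed
  consider "0 \<le> a" | "b \<le> 0" | "a < 0" "0 < b" by linarith
  thus ?thesis
  proof cases
    case 1 thus ?thesis using assms by (intro half) (auto intro: power_mono)
  next
    case 2
    have "(- b)\<^sup>2 \<le> (- w)\<^sup>2" using 2 assms by (intro power_mono) auto
    thus ?thesis by (intro half) auto
  next
    case 3
    hence "\<bar>a\<bar> \<le> 1" using assms by simp
    hence "a\<^sup>2 \<le> 1" by (simp add: abs_square_le_1)
    hence ea: "exp (- (1 / 2)) \<le> exp (- a\<^sup>2 / 2)" by simp
    have "1 / 2 \<le> exp (- (1/2::real))" using exp_half_le_2 by (simp add: exp_minus field_simps)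
    hence "1 / 2 \<le> exp (- a\<^sup>2 / 2)" using ea by (rule order_trans)
    hence "1 / 2 + 0 \<le> exp (- a\<^sup>2 / 2) + exp (- b\<^sup>2 / 2)" by (intro add_mono) auto
    hence "1 \<le> 2 * (exp (- a\<^sup>2 / 2) + exp (- b\<^sup>2 / 2))" by (simp only: add_0_right mult.commute[of 2] pos_divide_le_eq[OF zero_less_numeral])
    moreover have "exp (- w\<^sup>2 / 2) \<le> 1" by simp
    ultimately show ?thesis by (rule order_trans[rotated])
  qed
qed

text \<open>
  The mean value theorem produces an unknown intermediate point; the two preceding estimates replace
  it by the end points, which do not depend on the variable of integration.
\<close>

lemma normal_density_diff_le:
  fixes u h \<sigma> :: real
  assumes \<sigma>: "0 < \<sigma>" and h: "0 \<le> h" "h \<le> \<sigma>"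
  shows "\<bar>normal_density 0 \<sigma> (u + h) - normal_density 0 \<sigma> u\<bar>
    \<le> 2 * h / \<sigma> * (normal_density 0 \<sigma> (u - \<sigma>) + normal_density 0 \<sigma> (u + h - \<sigma>)
        + normal_density 0 \<sigma> (u + \<sigma>) + normal_density 0 \<sigma> (u + h + \<sigma>))"
proof (cases "h = 0")
  case False
  hence h0: "0 < h" using h by simp
  define c where "c = 1 / sqrt (2 * pi * \<sigma>\<^sup>2)"
  have c: "0 < c" using \<sigma> by (simp add: c_def)
  have nd: "normal_density 0 \<sigma> x = c * exp (- (x / \<sigma>)\<^sup>2 / 2)" for x
    by (simp add: normal_density_def c_def power_divide)
  define e where "e = (\<lambda>s::real. exp (- s\<^sup>2 / 2))"
  define a b where "a = u / \<sigma>" and "b = (u + h) / \<sigma>"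
  have ab: "a < b" "b - a = h / \<sigma>" "b - a \<le> 1" using h0 h \<sigma> by (auto simp: a_def b_def field_simps)
  have "\<exists>z>a. z < b \<and> e b - e a = (b - a) * (- z * e z)"
    unfolding e_def by (rule MVT2[OF ab(1)]) (auto intro!: derivative_eq_intros)
  then obtain z where z: "a < z" "z < b" and eq: "e b - e a = (b - a) * (- z * e z)" by blast
  have "\<bar>e b - e a\<bar> = (b - a) * (\<bar>z\<bar> * e z)" unfolding eq using ab(1) by (simp add: abs_mult e_def)
  also have "\<dots> \<le> (b - a) * (e (z - 1) + e (z + 1))"
    using ab abs_mult_gauss_le_shift[of z] by (intro mult_left_mono) (auto simp: e_def)
  also have "\<dots> \<le> (b - a) * (2 * (e (a - 1) + e (b - 1)) + 2 * (e (a + 1) + e (b + 1)))"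
    using z ab unfolding e_def by (intro mult_left_mono add_mono gauss_le_endpoints) auto
  finally have "\<bar>e b - e a\<bar> \<le> (b - a) * (2 * (e (a - 1) + e (b - 1)) + 2 * (e (a + 1) + e (b + 1)))" .
  hence "c * \<bar>e b - e a\<bar> \<le> c * ((b - a) * (2 * (e (a - 1) + e (b - 1)) + 2 * (e (a + 1) + e (b + 1))))"
    using c by (intro mult_left_mono) auto
  moreover have "c * \<bar>e b - e a\<bar> = \<bar>normal_density 0 \<sigma> (u + h) - normal_density 0 \<sigma> u\<bar>"
    using c by (simp add: nd e_def a_def b_def abs_mult flip: right_diff_distrib)
  moreover have "normal_density 0 \<sigma> (u - \<sigma>) = c * e (a - 1)" "normal_density 0 \<sigma> (u + h - \<sigma>) = c * e (b - 1)"
    "normal_density 0 \<sigma> (u + \<sigma>) = c * e (a + 1)" "normal_density 0 \<sigma> (u + h + \<sigma>) = c * e (b + 1)"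
    using \<sigma> by (simp_all add: nd e_def a_def b_def diff_divide_distrib add_divide_distrib)
  ultimately show ?thesis by (simp add: ab(2) algebra_simps)
qed simp

context real_distribution
begin

lemma integrable_normal_density_shift [simp]:
  assumes "0 < \<sigma>" shows "integrable M (\<lambda>y. normal_density 0 \<sigma> (x - y))"
  by (rule integrable_const_bound[where B = "1 / \<sigma>"])
     (use normal_density_le_inverse[OF assms] in auto)

lemma measurable_gauss_smoothing [measurable]: "gauss_smoothing M \<sigma> \<in> borel_measurable borel"
  unfolding gauss_smoothing_def[abs_def] by measurable

lemma gauss_smoothing_nonneg: "0 \<le> gauss_smoothing M \<sigma> x"
  unfolding gauss_smoothing_def by (intro integral_nonneg_AE) auto

lemma gauss_smoothing_le:
  assumes "0 < \<sigma>" shows "gauss_smoothing M \<sigma> x \<le> 1 / \<sigma>"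
proof -
  have "gauss_smoothing M \<sigma> x \<le> (\<integral>y. 1 / \<sigma> \<partial>M)"
    unfolding gauss_smoothing_def
    by (intro integral_mono) (use assms normal_density_le_inverse[OF assms] in auto)
  thus ?thesis using prob_space by simp
qed

text \<open>
  The kernels at the two scales satisfy this inequality, since the narrow one decays faster and their maxima
  have ratio \<open>\<tau>/\<sigma>\<close>.
\<close>

lemma gauss_smoothing_le_scale:
  assumes "0 < \<sigma>" "\<sigma> \<le> \<tau>"
  shows "gauss_smoothing M \<sigma> x \<le> \<tau> / \<sigma> * gauss_smoothing M \<tau> x"
proof -
  have "normal_density 0 \<sigma> u \<le> \<tau> / \<sigma> * normal_density 0 \<tau> u" for u
  proof -
    have "u\<^sup>2 / (2 * \<tau>\<^sup>2) \<le> u\<^sup>2 / (2 * \<sigma>\<^sup>2)" using assms by (intro divide_left_mono) (auto intro!: power_mono)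
    hence "1 / sqrt (2 * pi * \<sigma>\<^sup>2) * exp (- u\<^sup>2 / (2 * \<sigma>\<^sup>2)) \<le> 1 / sqrt (2 * pi * \<sigma>\<^sup>2) * exp (- u\<^sup>2 / (2 * \<tau>\<^sup>2))"
      by (intro mult_left_mono) auto
    also have "\<dots> = \<tau> / \<sigma> * normal_density 0 \<tau> u"
      using assms by (simp add: normal_density_def real_sqrt_mult)
    finally show ?thesis by (simp add: normal_density_def)
  qed
  hence "gauss_smoothing M \<sigma> x \<le> (\<integral>y. \<tau> / \<sigma> * normal_density 0 \<tau> (x - y) \<partial>M)"
    unfolding gauss_smoothing_def
    by (intro integral_mono integrable_mult_right integrable_normal_density_shift) (use assms in auto)
  thus ?thesis by (simp add: gauss_smoothing_def)
qed

text \<open>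
  The Lipschitz constant involves the actual supremum \<open>B\<close> of the density instead of the trivial bound
  \<open>1/\<sigma>\<close>. With \<open>1/\<sigma>\<close> the error term would be of order \<open>1 / (\<sigma>\<^sup>2 T)\<close>.
\<close>

lemma gauss_smoothing_Lipschitz:
  assumes \<sigma>: "0 < \<sigma>" and B: "\<And>x. gauss_smoothing M \<sigma> x \<le> B"
  shows "\<bar>gauss_smoothing M \<sigma> x - gauss_smoothing M \<sigma> y\<bar> \<le> 8 * B / \<sigma> * \<bar>x - y\<bar>"
proof -
  let ?p = "gauss_smoothing M \<sigma>"
  have B0: "0 \<le> B" using B[of 0] gauss_smoothing_nonneg[of \<sigma> 0] by linarith
  have main: "\<bar>?p (x + h) - ?p x\<bar> \<le> 8 * B / \<sigma> * h" if h: "0 \<le> h" for x h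
  proof (cases "h \<le> \<sigma>")
    case True
    let ?n = "normal_density 0 \<sigma>"
    have "\<bar>?p (x + h) - ?p x\<bar> = \<bar>\<integral>y. ?n (x + h - y) - ?n (x - y) \<partial>M\<bar>"
      unfolding gauss_smoothing_def using \<sigma> by (subst Bochner_Integration.integral_diff) auto
    also have "\<dots> \<le> (\<integral>y. \<bar>?n (x + h - y) - ?n (x - y)\<bar> \<partial>M)" by (rule integral_abs_bound)
    also have "\<dots> \<le> (\<integral>y. 2 * h / \<sigma> * (?n ((x - \<sigma>) - y) + ?n ((x + h - \<sigma>) - y) + ?n ((x + \<sigma>) - y) + ?n ((x + h + \<sigma>) - y)) \<partial>M)"
    proof (rule integral_mono)
      fix y
      show "\<bar>?n (x + h - y) - ?n (x - y)\<bar> \<le> 2 * h / \<sigma> * (?n ((x - \<sigma>) - y) + ?n ((x + h - \<sigma>) - y) + ?n ((x + \<sigma>) - y) + ?n ((x + h + \<sigma>) - y))"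
        using normal_density_diff_le[OF \<sigma> h True, of "x - y"] by (simp add: algebra_simps)
    qed (use \<sigma> in auto)
    also have "\<dots> = 2 * h / \<sigma> * (?p (x - \<sigma>) + ?p (x + h - \<sigma>) + ?p (x + \<sigma>) + ?p (x + h + \<sigma>))"
      unfolding gauss_smoothing_def using \<sigma> by simp
    also have "\<dots> \<le> 2 * h / \<sigma> * (B + B + B + B)"
      using h \<sigma> by (intro mult_left_mono add_mono B) auto
    finally show ?thesis by (simp add: field_simps)
  next
    case False
    have "\<bar>?p (x + h) - ?p x\<bar> \<le> B"
      using B[of "x + h"] B[of x] gauss_smoothing_nonneg[of \<sigma> x] gauss_smoothing_nonneg[of \<sigma> "x + h"] by linarith
    also have "B * \<sigma> \<le> B * h" using False B0 by (intro mult_left_mono) auto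
    hence "B \<le> B / \<sigma> * h" using \<sigma> by (simp add: field_simps)
    also have "\<dots> \<le> 8 * (B / \<sigma> * h)"
    proof -
      have "0 \<le> B / \<sigma> * h" using B0 h \<sigma> by (intro mult_nonneg_nonneg divide_nonneg_pos) auto
      thus ?thesis by linarith
    qed
    finally show ?thesis by simp
  qed
  show ?thesis
    using main[of "x - y" y] main[of "y - x" x] by (cases "y \<le> x") (auto simp: abs_minus_commute)
qed

end

section \<open>A band-limited kernel\<close>

text \<open>
  A weight with support in \<open>[-1, 1]\<close> that vanishes to second order at the end points. Its Fourier
  transform then decays like \<open>\<bar>u\<bar>\<^sup>-\<^sup>3\<close>, which is what is needed for a finite first absolute moment.
\<close>

definition bump :: "real \<Rightarrow> real" where
  "bump t = indicator {-1..1} t * (1 - t\<^sup>2)\<^sup>2"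

definition bump_hat :: "real \<Rightarrow> complex" where
  "bump_hat u = (\<integral>t. bump t *\<^sub>R iexp (u * t) \<partial>lborel)"

lemma bump_measurable [measurable]: "bump \<in> borel_measurable borel"
  unfolding bump_def[abs_def] by measurable

lemma bump_bounds: "0 \<le> bump t" "bump t \<le> indicator {-1..1} t"
proof -
  have "(1 - t\<^sup>2)\<^sup>2 \<le> 1" if "\<bar>t\<bar> \<le> 1"
  proof -
    have "t\<^sup>2 \<le> 1" using that by (simp add: abs_square_le_1)
    thus ?thesis by (intro power_le_one) auto
  qed
  thus "bump t \<le> indicator {-1..1} t" by (auto simp: bump_def split: split_indicator)
qed (simp add: bump_def)

lemma bump_le_1: "bump t \<le> 1"
  by (rule order_trans[OF bump_bounds(2)]) (simp add: indicator_def)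

lemma bump_eq: "\<bar>t\<bar> < 1 \<Longrightarrow> (1 - t\<^sup>2)\<^sup>2 = bump t"
  by (auto simp: bump_def indicator_def)

lemma integrable_bump: "integrable lborel bump"
proof (rule Bochner_Integration.integrable_bound)
  show "integrable lborel (indicator {-1..1} :: real \<Rightarrow> real)" by simp
  show "AE x in lborel. norm (bump x) \<le> norm (indicator {-1..1} x :: real)"
    using bump_bounds by (intro always_eventually) simp
qed simp

lemma integrable_bump_iexp: "integrable lborel (\<lambda>t. bump t *\<^sub>R iexp (u * t))"
  by (rule Bochner_Integration.integrable_bound[OF integrable_bump]) auto

lemma bump_hat_measurable [measurable]: "bump_hat \<in> borel_measurable borel"
  unfolding bump_hat_def[abs_def] by measurable

lemma norm_bump_hat_le_2: "cmod (bump_hat u) \<le> 2"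
proof -
  have "cmod (bump_hat u) \<le> (\<integral>t. cmod (bump t *\<^sub>R iexp (u * t)) \<partial>lborel)"
    unfolding bump_hat_def by (rule integral_norm_bound)
  also have "\<dots> \<le> (\<integral>t. indicator {-1..1::real} t \<partial>lborel)"
    by (rule Bochner_Integration.integral_mono) (use bump_bounds integrable_norm[OF integrable_bump_iexp] in auto)
  finally show ?thesis by simp
qed

text \<open>
  Repeated integration by parts, in the form of an explicit antiderivative. The boundary terms that contain
  the weight and its first derivative vanish.
\<close>

lemma norm_bump_hat_le_cube:
  assumes u: "1 \<le> \<bar>u\<bar>"
  shows "cmod (bump_hat u) \<le> 112 / \<bar>u\<bar> ^ 3"
proof -
  define c where "c = \<i> * complex_of_real u"
  have c0: "c \<noteq> 0" and nc: "cmod c = \<bar>u\<bar>" using u by (auto simp: c_def norm_mult)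
  define P where "P = (\<lambda>t. (1 - t\<^sup>2)\<^sup>2 / c - (- 4 * t * (1 - t\<^sup>2)) / c ^ 2 + (12 * t\<^sup>2 - 4) / c ^ 3 - 24 * t / c ^ 4 + 24 / c ^ 5)"
  define F where "F = (\<lambda>t. exp (c * t) * P t)"
  have dF: "(F has_field_derivative (1 - t\<^sup>2)\<^sup>2 * exp (c * t)) (at t)" for t :: complex
  proof -
    have dP: "(P has_field_derivative ((- 4 * t * (1 - t\<^sup>2)) / c - (12 * t\<^sup>2 - 4) / c ^ 2 + 24 * t / c ^ 3 - 24 / c ^ 4)) (at t)"
      unfolding P_def using c0
      by (auto intro!: derivative_eq_intros simp: field_simps power2_eq_square)
    have "c * P t + ((- 4 * t * (1 - t\<^sup>2)) / c - (12 * t\<^sup>2 - 4) / c ^ 2 + 24 * t / c ^ 3 - 24 / c ^ 4) = (1 - t\<^sup>2)\<^sup>2"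
      unfolding P_def using c0 by (simp add: field_simps power_numeral_reduce)
    hence eq: "exp (c * t) * (c * P t + ((- 4 * t * (1 - t\<^sup>2)) / c - (12 * t\<^sup>2 - 4) / c ^ 2 + 24 * t / c ^ 3 - 24 / c ^ 4))
       = (1 - t\<^sup>2)\<^sup>2 * exp (c * t)" by simp
    show ?thesis unfolding F_def
      by (rule derivative_eq_intros dP refl)+ (use eq in \<open>simp add: algebra_simps\<close>)
  qed
  have "bump_hat u = (\<integral>t. indicator {-1..1} t *\<^sub>R ((1 - (complex_of_real t)\<^sup>2)\<^sup>2 * exp (c * of_real t)) \<partial>lborel)"
    unfolding bump_hat_def bump_def
    by (intro Bochner_Integration.integral_cong) (auto simp: scaleR_conv_of_real c_def mult_ac)
  also have "\<dots> = F (of_real 1) - F (of_real (-1))"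
  proof (rule integral_FTC_Icc)
    fix x :: real
    show "((\<lambda>x. F (complex_of_real x)) has_vector_derivative (1 - (complex_of_real x)\<^sup>2)\<^sup>2 * exp (c * of_real x)) (at x within {-1..1})"
      using has_vector_derivative_real_field[OF dF[of "of_real x"]]
      by (rule has_vector_derivative_at_within)
  qed (auto intro!: continuous_intros)
  also have "cmod \<dots> \<le> cmod (F (of_real 1)) + cmod (F (of_real (-1)))" by (rule norm_triangle_ineq4)
  also have "\<dots> \<le> 56 / \<bar>u\<bar> ^ 3 + 56 / \<bar>u\<bar> ^ 3"
  proof -
    have e: "cmod (exp (c * of_real t)) = 1" for t by (simp add: c_def)
    have le: "24 / \<bar>u\<bar> ^ 4 \<le> 24 / \<bar>u\<bar> ^ 3" "24 / \<bar>u\<bar> ^ 5 \<le> 24 / \<bar>u\<bar> ^ 3"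
    proof -
      have "24 / r ^ 4 \<le> 24 / r ^ 3 \<and> 24 / r ^ 5 \<le> 24 / r ^ 3" if "1 \<le> r" for r :: real
        using that by (auto intro!: divide_left_mono power_increasing)
      from this[OF u] show "24 / \<bar>u\<bar> ^ 4 \<le> 24 / \<bar>u\<bar> ^ 3" "24 / \<bar>u\<bar> ^ 5 \<le> 24 / \<bar>u\<bar> ^ 3" by blast+
    qed
    have b: "cmod (8 / c ^ 3 + s * 24 / c ^ 4 + 24 / c ^ 5) \<le> 56 / \<bar>u\<bar> ^ 3" if "cmod s = 1" for s
    proof -
      have "cmod (8 / c ^ 3 + s * 24 / c ^ 4 + 24 / c ^ 5) \<le> cmod (8 / c ^ 3) + cmod (s * 24 / c ^ 4) + cmod (24 / c ^ 5)"
        by (meson norm_triangle_le order_refl add_mono norm_triangle_ineq order_trans)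
      also have "\<dots> = 8 / \<bar>u\<bar> ^ 3 + 24 / \<bar>u\<bar> ^ 4 + 24 / \<bar>u\<bar> ^ 5"
        using that by (simp add: norm_divide norm_power norm_mult nc)
      also have "\<dots> \<le> 8 / \<bar>u\<bar> ^ 3 + 24 / \<bar>u\<bar> ^ 3 + 24 / \<bar>u\<bar> ^ 3" using le by linarith
      also have "\<dots> = 56 / \<bar>u\<bar> ^ 3" by (simp add: add_divide_distrib[symmetric])
      finally show ?thesis .
    qed
    have "cmod (F (of_real 1)) \<le> 56 / \<bar>u\<bar> ^ 3"
      using b[of "-1"] e[of 1] by (simp add: F_def P_def norm_mult)
    moreover have "cmod (F (of_real (-1))) \<le> 56 / \<bar>u\<bar> ^ 3"
      using b[of 1] e[of "-1"] by (simp add: F_def P_def norm_mult)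
    ultimately show ?thesis by simp
  qed
  finally show ?thesis by simp
qed

lemma bump_hat_decay: "(1 + \<bar>u\<bar>) * cmod (bump_hat u) \<le> 448 * inverse (1 + u\<^sup>2)"
proof (cases "\<bar>u\<bar> \<le> 1")
  case True
  have "u\<^sup>2 \<le> 1" using True by (simp add: abs_square_le_1)
  hence "448 * (1 / 2) \<le> 448 * inverse (1 + u\<^sup>2)"
    by (intro mult_left_mono) (auto simp: field_simps add_pos_nonneg)
  moreover have "(1 + \<bar>u\<bar>) * cmod (bump_hat u) \<le> 2 * 2"
    using True norm_bump_hat_le_2 by (intro mult_mono) auto
  ultimately show ?thesis by linarith
next
  case False
  hence u: "1 \<le> \<bar>u\<bar>" by simp
  have u2: "1 \<le> u\<^sup>2" using one_le_power[OF u, of 2] by simp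
  have "(1 + \<bar>u\<bar>) * cmod (bump_hat u) \<le> (2 * \<bar>u\<bar>) * (112 / \<bar>u\<bar> ^ 3)"
    using u norm_bump_hat_le_cube[OF u] by (intro mult_mono) auto
  also have "\<dots> = 224 / u\<^sup>2" using u by (simp add: power3_eq_cube power2_eq_square)
  also have "\<dots> = 448 * inverse (2 * u\<^sup>2)" using u by (simp add: field_simps)
  also have "\<dots> \<le> 448 * inverse (1 + u\<^sup>2)"
    using u2 by (intro mult_left_mono le_imp_inverse_le) (auto simp: add_pos_nonneg)
  finally show ?thesis .
qed

lemma integrable_bump_hat_moment: "integrable lborel (\<lambda>u. (1 + \<bar>u\<bar>) * cmod (bump_hat u))"
proof (rule Bochner_Integration.integrable_bound)
  show "integrable lborel (\<lambda>u::real. 448 * inverse (1 + u\<^sup>2))"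
    using integrable_inverse_1_plus_square by (intro integrable_mult_right) (simp add: set_integrable_def)
  show "AE u in lborel. norm ((1 + \<bar>u\<bar>) * cmod (bump_hat u)) \<le> norm (448 * inverse (1 + u\<^sup>2))"
    using bump_hat_decay by (intro always_eventually allI) (simp add: abs_mult)
qed simp

lemma integrable_bump_hat: "integrable lborel bump_hat"
proof (rule Bochner_Integration.integrable_bound[OF integrable_bump_hat_moment])
  show "AE u in lborel. norm (bump_hat u) \<le> norm ((1 + \<bar>u\<bar>) * cmod (bump_hat u))"
    by (intro always_eventually allI) (simp add: abs_mult algebra_simps)
qed simp

text \<open>
  Fubini's theorem. Integrals against the kernel depend on the Fourier transform of \<open>f\<close> on
  \<open>[-1, 1]\<close> only.
\<close>

lemma bump_hat_pairing:
  fixes f :: "real \<Rightarrow> real"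
  assumes f: "integrable lborel f"
  shows "(\<integral>u. f u *\<^sub>R bump_hat u \<partial>lborel) = (\<integral>t. bump t *\<^sub>R (\<integral>u. f u *\<^sub>R iexp (t * u) \<partial>lborel) \<partial>lborel)"
proof -
  have [measurable]: "f \<in> borel_measurable borel" using f by simp
  have "(\<integral>u. f u *\<^sub>R bump_hat u \<partial>lborel) = (\<integral>u. (\<integral>t. (f u * bump t) *\<^sub>R iexp (t * u) \<partial>lborel) \<partial>lborel)"
  proof (intro Bochner_Integration.integral_cong refl)
    fix u
    have "f u *\<^sub>R bump_hat u = (\<integral>t. f u *\<^sub>R (bump t *\<^sub>R iexp (u * t)) \<partial>lborel)"
      unfolding bump_hat_def by (rule integral_scaleR_right[symmetric])
    thus "f u *\<^sub>R bump_hat u = (\<integral>t. (f u * bump t) *\<^sub>R iexp (t * u) \<partial>lborel)"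
      by (simp only: scaleR_scaleR mult.commute[of u])
  qed
  also have "\<dots> = (\<integral>t. (\<integral>u. (f u * bump t) *\<^sub>R iexp (t * u) \<partial>lborel) \<partial>lborel)"
  proof (rule lborel_pair.Fubini_integral, rule lborel_pair.Fubini_integrable)
    have eq: "(\<integral>u. norm ((f u * bump t) *\<^sub>R iexp (t * u)) \<partial>lborel) = (\<integral>u. \<bar>f u\<bar> \<partial>lborel) * bump t" for t
      using bump_bounds[of t] by (simp add: abs_mult)
    show "integrable lborel (\<lambda>t. \<integral>u. norm (case (t, u) of (t, u) \<Rightarrow> (f u * bump t) *\<^sub>R iexp (t * u)) \<partial>lborel)"
      by (simp only: prod.case eq) (intro integrable_mult_right integrable_bump)
    show "AE t in lborel. integrable lborel (\<lambda>u. case (t, u) of (t, u) \<Rightarrow> (f u * bump t) *\<^sub>R iexp (t * u))"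
    proof (intro always_eventually allI)
      fix t
      have "integrable lborel (\<lambda>u. f u * bump t)" using f by simp
      thus "integrable lborel (\<lambda>u. case (t, u) of (t, u) \<Rightarrow> (f u * bump t) *\<^sub>R iexp (t * u))"
        by (rule Bochner_Integration.integrable_bound) (auto simp: abs_mult)
    qed
  qed measurable
  also have "\<dots> = (\<integral>t. bump t *\<^sub>R (\<integral>u. f u *\<^sub>R iexp (t * u) \<partial>lborel) \<partial>lborel)"
  proof (intro Bochner_Integration.integral_cong refl)
    fix t
    have "(\<integral>u. bump t *\<^sub>R (f u *\<^sub>R iexp (t * u)) \<partial>lborel) = bump t *\<^sub>R (\<integral>u. f u *\<^sub>R iexp (t * u) \<partial>lborel)"
      by (rule integral_scaleR_right)
    thus "(\<integral>u. (f u * bump t) *\<^sub>R iexp (t * u) \<partial>lborel) = bump t *\<^sub>R (\<integral>u. f u *\<^sub>R iexp (t * u) \<partial>lborel)"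
      by (simp only: scaleR_scaleR mult.commute[of "bump t"])
  qed
  finally show ?thesis .
qed

text \<open>
  The value of the weight at \<open>0\<close>, by Fourier inversion: the integral is approximated by inserting
  Gaussian factors that tend to \<open>1\<close>. On the Fourier side they become normal densities that
  concentrate at \<open>0\<close>.
\<close>

lemma integral_bump_hat: "(\<integral>u. bump_hat u \<partial>lborel) = of_real (2 * pi)"
proof -
  let ?e = "\<lambda>n::nat. 1 / real (Suc n)"
  let ?g = "\<lambda>n u. sqrt (2 * pi) * std_normal_density (?e n * u)"
  have e0: "?e \<longlonglongrightarrow> 0" using LIMSEQ_inverse_real_of_nat by (simp add: inverse_eq_divide)
  have gexp: "?g n u = exp (- (?e n * u)\<^sup>2 / 2)" for n u by (simp add: std_normal_density_def)
  have "(\<lambda>n. \<integral>u. ?g n u *\<^sub>R bump_hat u \<partial>lborel) \<longlonglongrightarrow> (\<integral>u. bump_hat u \<partial>lborel)"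
  proof (rule integral_dominated_convergence[where w = "\<lambda>u. cmod (bump_hat u)"])
    show "AE u in lborel. (\<lambda>n. ?g n u *\<^sub>R bump_hat u) \<longlonglongrightarrow> bump_hat u"
    proof (intro always_eventually allI)
      fix u
      have "(\<lambda>n. exp (- (?e n * u)\<^sup>2 / 2) *\<^sub>R bump_hat u) \<longlonglongrightarrow> exp (- (0 * u)\<^sup>2 / 2) *\<^sub>R bump_hat u"
        by (intro tendsto_intros e0) auto
      thus "(\<lambda>n. ?g n u *\<^sub>R bump_hat u) \<longlonglongrightarrow> bump_hat u" by (simp only: gexp) simp
    qed
    show "AE u in lborel. norm (?g n u *\<^sub>R bump_hat u) \<le> cmod (bump_hat u)" for n
    proof (intro always_eventually allI)
      fix u
      have "exp (- (?e n * u)\<^sup>2 / 2) * cmod (bump_hat u) \<le> 1 * cmod (bump_hat u)"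
        by (intro mult_right_mono) auto
      thus "norm (?g n u *\<^sub>R bump_hat u) \<le> cmod (bump_hat u)" by (simp only: gexp norm_scaleR) simp
    qed
  qed (use integrable_norm[OF integrable_bump_hat] in auto)
  moreover have "(\<integral>u. ?g n u *\<^sub>R bump_hat u \<partial>lborel) = of_real (2 * pi * (\<integral>s. bump (?e n * s) * std_normal_density s \<partial>lborel))" for n
  proof -
    define e where "e = ?e n"
    have e: "0 < e" by (simp add: e_def)
    have nd: "?g n u = sqrt (2 * pi) / e * normal_density 0 (1 / e) u" for u
      using e unfolding e_def[symmetric]
      by (simp add: normal_density_def real_sqrt_mult real_sqrt_divide power_mult_distrib power_divide field_simps)
    have int: "integrable lborel (?g n)" unfolding nd using e by (intro integrable_mult_right) auto
    have "(\<integral>u. ?g n u *\<^sub>R iexp (t * u) \<partial>lborel) = of_real (sqrt (2 * pi) / e * exp (- (t / e)\<^sup>2 / 2))" for t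
    proof -
      have "(\<integral>u. ?g n u *\<^sub>R iexp (t * u) \<partial>lborel)
          = (\<integral>u. (sqrt (2 * pi) / e) *\<^sub>R (normal_density 0 (1 / e) u *\<^sub>R iexp (t * u)) \<partial>lborel)"
        unfolding nd by simp
      also have "\<dots> = (sqrt (2 * pi) / e) *\<^sub>R complex_of_real (exp (- ((1 / e)\<^sup>2 * t\<^sup>2) / 2))"
        using e by (subst integral_scaleR_right, subst char_normal_density) auto
      finally show ?thesis by (simp add: scaleR_conv_of_real power_divide)
    qed
    hence "(\<integral>u. ?g n u *\<^sub>R bump_hat u \<partial>lborel)
       = (\<integral>t. of_real (bump t * (sqrt (2 * pi) / e * exp (- (t / e)\<^sup>2 / 2))) \<partial>lborel)"
      by (subst bump_hat_pairing[OF int]) (simp add: scaleR_conv_of_real)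
    also have "\<dots> = of_real (\<integral>t. bump t * (sqrt (2 * pi) / e * exp (- (t / e)\<^sup>2 / 2)) \<partial>lborel)"
      by (rule integral_complex_of_real)
    also have "(\<integral>t. bump t * (sqrt (2 * pi) / e * exp (- (t / e)\<^sup>2 / 2)) \<partial>lborel)
        = \<bar>e\<bar> *\<^sub>R (\<integral>s. bump (0 + e * s) * (sqrt (2 * pi) / e * exp (- ((0 + e * s) / e)\<^sup>2 / 2)) \<partial>lborel)"
      using e by (intro lborel_integral_real_affine) auto
    also have "\<dots> = (\<integral>s. 2 * pi * (bump (e * s) * std_normal_density s) \<partial>lborel)"
    proof -
      have sq: "sqrt (2 * pi) = 2 * pi / sqrt (2 * pi)" by (simp add: real_div_sqrt)
      have "e * (bump (e * s) * (sqrt (2 * pi) / e * exp (- ((e * s) / e)\<^sup>2 / 2))) = 2 * pi * (bump (e * s) * std_normal_density s)" for s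
      proof -
        have "e * (bump (e * s) * (sqrt (2 * pi) / e * exp (- ((e * s) / e)\<^sup>2 / 2))) = sqrt (2 * pi) * (bump (e * s) * exp (- s\<^sup>2 / 2))"
          using e by simp
        also have "\<dots> = (2 * pi / sqrt (2 * pi)) * (bump (e * s) * exp (- s\<^sup>2 / 2))" by (simp only: sq[symmetric])
        also have "\<dots> = 2 * pi * (bump (e * s) * std_normal_density s)" by (simp add: std_normal_density_def)
        finally show ?thesis .
      qed
      thus ?thesis using e by (simp only: abs_of_pos real_scaleR_def add_0_left integral_mult_right_zero[symmetric])
    qed
    finally show ?thesis by (simp add: e_def)
  qed
  moreover have "(\<lambda>n. \<integral>s. bump (?e n * s) * std_normal_density s \<partial>lborel) \<longlonglongrightarrow> (\<integral>s. std_normal_density s \<partial>lborel)"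
  proof (rule integral_dominated_convergence[where w = std_normal_density])
    show "AE s in lborel. (\<lambda>n. bump (?e n * s) * std_normal_density s) \<longlonglongrightarrow> std_normal_density s"
    proof (intro always_eventually allI)
      fix s :: real
      have es: "(\<lambda>n. ?e n * s) \<longlonglongrightarrow> 0 * s" by (intro tendsto_intros e0)
      hence "\<forall>\<^sub>F n in sequentially. \<bar>?e n * s\<bar> < 1"
        using tendstoD[OF es, of 1] by (simp add: dist_real_def)
      hence "\<forall>\<^sub>F n in sequentially. (1 - (?e n * s)\<^sup>2)\<^sup>2 = bump (?e n * s)"
        by eventually_elim (rule bump_eq)
      moreover have "(\<lambda>n. (1 - (?e n * s)\<^sup>2)\<^sup>2) \<longlonglongrightarrow> (1 - (0 * s)\<^sup>2)\<^sup>2" by (intro tendsto_intros e0)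
      ultimately have "(\<lambda>n. bump (?e n * s)) \<longlonglongrightarrow> (1 - (0 * s)\<^sup>2)\<^sup>2"
        by (rule Lim_transform_eventually[rotated])
      hence "(\<lambda>n. bump (?e n * s) * std_normal_density s) \<longlonglongrightarrow> (1 - (0 * s)\<^sup>2)\<^sup>2 * std_normal_density s"
        by (intro tendsto_intros)
      thus "(\<lambda>n. bump (?e n * s) * std_normal_density s) \<longlonglongrightarrow> std_normal_density s" by simp
    qed
    show "AE s in lborel. norm (bump (?e n * s) * std_normal_density s) \<le> std_normal_density s" for n
      using bump_bounds(1) bump_le_1 by (intro always_eventually allI) (auto simp: abs_mult intro: mult_left_le_one_le)
  qed auto
  hence "(\<lambda>n. complex_of_real (2 * pi * (\<integral>s. bump (?e n * s) * std_normal_density s \<partial>lborel))) \<longlonglongrightarrow> of_real (2 * pi * 1)"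
    by (intro tendsto_intros) simp
  ultimately show ?thesis by (intro LIMSEQ_unique) auto
qed

section \<open>Uniform distance of smoothed laws\<close>

context real_distribution
begin

text \<open>
  Fubini's theorem for the double integral over the law and the real line.
\<close>

lemma fourier_gauss_smoothing:
  assumes \<sigma>: "0 < \<sigma>"
  shows integrable_gauss_smoothing: "integrable lborel (gauss_smoothing M \<sigma>)"
    and integral_gauss_smoothing_iexp:
      "(\<integral>u. gauss_smoothing M \<sigma> u *\<^sub>R iexp (t * u) \<partial>lborel) = char M t * of_real (exp (- (\<sigma>\<^sup>2 * t\<^sup>2) / 2))"
proof -
  interpret P: pair_sigma_finite M lborel ..
  let ?n = "normal_density 0 \<sigma>"
  have shift: "?n (u - y) = normal_density y \<sigma> u" for u y by (simp add: normal_density_def)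
  have n1: "(\<integral>u. ?n (u - y) \<partial>lborel) = 1" and ni: "integrable lborel (\<lambda>u. ?n (u - y))" for y
    unfolding shift using \<sigma> by auto
  have I1: "integrable (M \<Otimes>\<^sub>M lborel) (\<lambda>(y, u). ?n (u - y))"
  proof (rule P.Fubini_integrable)
    show "integrable M (\<lambda>y. \<integral>u. norm (case (y, u) of (y, u) \<Rightarrow> ?n (u - y)) \<partial>lborel)"
      by (simp add: n1)
    show "AE y in M. integrable lborel (\<lambda>u. case (y, u) of (y, u) \<Rightarrow> ?n (u - y))"
      by (simp add: ni)
  qed measurable
  show "integrable lborel (gauss_smoothing M \<sigma>)"
    using P.integrable_snd[OF I1] by (simp add: gauss_smoothing_def[abs_def])
  have I2: "integrable (M \<Otimes>\<^sub>M lborel) (\<lambda>(y, u). ?n (u - y) *\<^sub>R iexp (t * u))"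
    by (rule Bochner_Integration.integrable_bound[OF I1]) (measurable, auto)
  have "(\<integral>u. gauss_smoothing M \<sigma> u *\<^sub>R iexp (t * u) \<partial>lborel) = (\<integral>u. (\<integral>y. ?n (u - y) *\<^sub>R iexp (t * u) \<partial>M) \<partial>lborel)"
    unfolding gauss_smoothing_def using \<sigma> by (intro Bochner_Integration.integral_cong refl integral_scaleR_left[symmetric]) simp
  also have "\<dots> = (\<integral>y. (\<integral>u. ?n (u - y) *\<^sub>R iexp (t * u) \<partial>lborel) \<partial>M)"
    by (rule P.Fubini_integral[OF I2])
  also have "\<dots> = (\<integral>y. iexp (t * y) * of_real (exp (- (\<sigma>\<^sup>2 * t\<^sup>2) / 2)) \<partial>M)"
  proof (intro Bochner_Integration.integral_cong refl)
    fix y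
    have "(\<integral>u. ?n (u - y) *\<^sub>R iexp (t * u) \<partial>lborel) = \<bar>1\<bar> *\<^sub>R (\<integral>u. ?n ((y + 1 * u) - y) *\<^sub>R iexp (t * (y + 1 * u)) \<partial>lborel)"
      by (rule lborel_integral_real_affine) simp
    also have "\<dots> = (\<integral>u. iexp (t * y) * (?n u *\<^sub>R iexp (t * u)) \<partial>lborel)"
      by (simp add: algebra_simps exp_add)
    also have "\<dots> = iexp (t * y) * (\<integral>u. ?n u *\<^sub>R iexp (t * u) \<partial>lborel)"
      by (rule integral_mult_right_zero)
    finally show "(\<integral>u. ?n (u - y) *\<^sub>R iexp (t * u) \<partial>lborel) = iexp (t * y) * of_real (exp (- (\<sigma>\<^sup>2 * t\<^sup>2) / 2))"
      by (simp only: char_normal_density[OF \<sigma>])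
  qed
  also have "\<dots> = char M t * of_real (exp (- (\<sigma>\<^sup>2 * t\<^sup>2) / 2))"
    unfolding char_def by (rule integral_mult_left_zero)
  finally show "(\<integral>u. gauss_smoothing M \<sigma> u *\<^sub>R iexp (t * u) \<partial>lborel) = char M t * of_real (exp (- (\<sigma>\<^sup>2 * t\<^sup>2) / 2))" .
qed

end

text \<open>
  The kernel rescaled to frequencies in \<open>[-T, T]\<close> sees the two laws through their characteristic functions
  on that interval only.
\<close>

lemma bump_hat_smoothing_diff_le:
  fixes \<mu> \<nu> :: "real measure"
  assumes mu: "real_distribution \<mu>" and nu: "real_distribution \<nu>" and \<sigma>: "0 < \<sigma>" and T: "0 < T"
  shows "cmod (\<integral>u. (gauss_smoothing \<mu> \<sigma> (x - u / T) - gauss_smoothing \<nu> \<sigma> (x - u / T)) *\<^sub>R bump_hat u \<partial>lborel)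
    \<le> (\<integral>s. indicator {-T..T} s * cmod (char \<mu> s - char \<nu> s) \<partial>lborel)"
proof -
  interpret mu: real_distribution \<mu> by fact
  interpret nu: real_distribution \<nu> by fact
  define d where "d y = gauss_smoothing \<mu> \<sigma> y - gauss_smoothing \<nu> \<sigma> y" for y
  define D where "D s = cmod (char \<mu> s - char \<nu> s)" for s
  have [measurable]: "D \<in> borel_measurable borel" unfolding D_def[abs_def] by measurable
  have D2: "D s \<le> 2" "0 \<le> D s" for s
    using norm_triangle_ineq4[of "char \<mu> s" "char \<nu> s"] mu.cmod_char_le_1[of s] nu.cmod_char_le_1[of s]
    by (auto simp: D_def)
  have di: "integrable lborel d"
    unfolding d_def using mu.integrable_gauss_smoothing[OF \<sigma>] nu.integrable_gauss_smoothing[OF \<sigma>] by simp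
  have [measurable]: "d \<in> borel_measurable borel" using di by simp
  have di2: "integrable lborel (\<lambda>u. d (x - u / T))"
    using lborel_integrable_real_affine[OF di, of "- 1 / T" x] T by simp
  have dexp: "integrable lborel (\<lambda>y. gauss_smoothing \<rho> \<sigma> y *\<^sub>R iexp (s * y))" if "real_distribution \<rho>" for \<rho> s
    by (rule Bochner_Integration.integrable_bound[OF real_distribution.integrable_gauss_smoothing[OF that \<sigma>]])
       (use real_distribution.measurable_gauss_smoothing[OF that] in auto)
  have dhat: "(\<integral>y. d y *\<^sub>R iexp (s * y) \<partial>lborel) = (char \<mu> s - char \<nu> s) * of_real (exp (- (\<sigma>\<^sup>2 * s\<^sup>2) / 2))" for s
    unfolding d_def scaleR_diff_left
    by (subst Bochner_Integration.integral_diff[OF dexp[OF mu] dexp[OF nu]])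
       (simp only: mu.integral_gauss_smoothing_iexp[OF \<sigma>] nu.integral_gauss_smoothing_iexp[OF \<sigma>] left_diff_distrib)
  have inner: "cmod (\<integral>u. d (x - u / T) *\<^sub>R iexp (t * u) \<partial>lborel) \<le> T * D (- (T * t))" for t
  proof -
    have "(\<integral>u. d (x - u / T) *\<^sub>R iexp (t * u) \<partial>lborel)
       = \<bar>- T\<bar> *\<^sub>R (\<integral>y. d (x - (T * x + (- T) * y) / T) *\<^sub>R iexp (t * (T * x + (- T) * y)) \<partial>lborel)"
      by (rule lborel_integral_real_affine) (use T in simp)
    also have "(\<lambda>y. d (x - (T * x + (- T) * y) / T) *\<^sub>R iexp (t * (T * x + (- T) * y)))
        = (\<lambda>y. iexp (t * T * x) * (d y *\<^sub>R iexp (- (T * t) * y)))"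
    proof
      fix y
      have "x - (T * x + (- T) * y) / T = y" using T by (simp add: field_simps)
      moreover have "iexp (t * (T * x + (- T) * y)) = iexp (t * T * x) * iexp (- (T * t) * y)"
        by (simp add: algebra_simps flip: exp_add)
      ultimately show "d (x - (T * x + (- T) * y) / T) *\<^sub>R iexp (t * (T * x + (- T) * y)) = iexp (t * T * x) * (d y *\<^sub>R iexp (- (T * t) * y))"
        by (simp only: mult_scaleR_right)
    qed
    also have "(\<integral>y. iexp (t * T * x) * (d y *\<^sub>R iexp (- (T * t) * y)) \<partial>lborel) = iexp (t * T * x) * (\<integral>y. d y *\<^sub>R iexp (- (T * t) * y) \<partial>lborel)"
      by (rule integral_mult_right_zero)
    finally have "(\<integral>u. d (x - u / T) *\<^sub>R iexp (t * u) \<partial>lborel)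
      = \<bar>- T\<bar> *\<^sub>R (iexp (t * T * x) * ((char \<mu> (- (T * t)) - char \<nu> (- (T * t))) * of_real (exp (- (\<sigma>\<^sup>2 * (- (T * t))\<^sup>2) / 2))))"
      by (simp only: dhat)
    hence "cmod (\<integral>u. d (x - u / T) *\<^sub>R iexp (t * u) \<partial>lborel) = T * (D (- (T * t)) * exp (- (\<sigma>\<^sup>2 * (- (T * t))\<^sup>2) / 2))"
      using T by (simp only: norm_scaleR norm_mult norm_exp_i_times norm_of_real D_def) simp
    also have "\<dots> \<le> T * (D (- (T * t)) * 1)" using T D2 by (intro mult_left_mono) auto
    finally show ?thesis by simp
  qed
  have "cmod (\<integral>u. d (x - u / T) *\<^sub>R bump_hat u \<partial>lborel)
      = cmod (\<integral>t. bump t *\<^sub>R (\<integral>u. d (x - u / T) *\<^sub>R iexp (t * u) \<partial>lborel) \<partial>lborel)"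
    by (simp only: bump_hat_pairing[OF di2])
  also have "\<dots> \<le> (\<integral>t. T * (indicator {-T..T} (0 + (- T) * t) * D (0 + (- T) * t)) \<partial>lborel)"
  proof (rule Bochner_Integration.integral_norm_bound_integral)
    have ind: "indicator {-T..T} (0 + (- T) * t) = (indicator {-1..1} t :: real)" for t
    proof -
      have "T * (- 1) \<le> T * t \<longleftrightarrow> - 1 \<le> t" "T * t \<le> T * 1 \<longleftrightarrow> t \<le> 1"
        using T by (simp_all only: mult_le_cancel_left_pos)
      thus ?thesis by (auto simp: indicator_def)
    qed
    have maj: "integrable lborel (\<lambda>t::real. (2 * T) * indicator {-1..1} t :: real)"
      by (intro integrable_mult_right) simp
    show R: "integrable lborel (\<lambda>t. T * (indicator {-T..T} (0 + (- T) * t) * D (0 + (- T) * t)))"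
    proof (rule Bochner_Integration.integrable_bound[OF maj])
      show "AE t in lborel. norm (T * (indicator {-T..T} (0 + (- T) * t) * D (0 + (- T) * t))) \<le> norm ((2 * T) * indicator {-1..1} t :: real)"
      proof (intro always_eventually allI)
        fix t
        have "T * D (0 + (- T) * t) \<le> T * 2" using T D2 by (intro mult_left_mono) auto
        thus "norm (T * (indicator {-T..T} (0 + (- T) * t) * D (0 + (- T) * t))) \<le> norm ((2 * T) * indicator {-1..1} t :: real)"
          unfolding ind using T D2(2) by (simp add: indicator_def abs_mult)
      qed
    qed measurable
    show B: "cmod (bump t *\<^sub>R (\<integral>u. d (x - u / T) *\<^sub>R iexp (t * u) \<partial>lborel)) \<le> T * (indicator {-T..T} (0 + (- T) * t) * D (0 + (- T) * t))" for t
    proof -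
      have "bump t * cmod (\<integral>u. d (x - u / T) *\<^sub>R iexp (t * u) \<partial>lborel) \<le> indicator {-1..1} t * (T * D (- (T * t)))"
        using inner bump_bounds by (intro mult_mono) auto
      thus ?thesis using bump_bounds(1)[of t] unfolding ind by (simp add: mult_ac)
    qed
    show "integrable lborel (\<lambda>t. bump t *\<^sub>R (\<integral>u. d (x - u / T) *\<^sub>R iexp (t * u) \<partial>lborel))"
    proof (rule Bochner_Integration.integrable_bound[OF R])
      show "AE t in lborel. norm (bump t *\<^sub>R (\<integral>u. d (x - u / T) *\<^sub>R iexp (t * u) \<partial>lborel))
          \<le> norm (T * (indicator {-T..T} (0 + (- T) * t) * D (0 + (- T) * t)))"
        by (intro always_eventually allI) (simp only: real_norm_def order_trans[OF B abs_ge_self])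
    qed measurable
  qed
  also have "\<dots> = \<bar>- T\<bar> *\<^sub>R (\<integral>t. indicator {-T..T} (0 + (- T) * t) * D (0 + (- T) * t) \<partial>lborel)"
    using T by (simp only: integral_mult_right_zero) simp
  also have "\<dots> = (\<integral>s. indicator {-T..T} s * D s \<partial>lborel)"
    by (rule lborel_integral_real_affine[symmetric]) (use T in simp)
  finally show ?thesis by (simp add: d_def D_def)
qed

definition bump_hat_moment :: real where
  "bump_hat_moment = (\<integral>u. \<bar>u\<bar> * cmod (bump_hat u) \<partial>lborel)"

lemma integrable_abs_bump_hat: "integrable lborel (\<lambda>u. \<bar>u\<bar> * cmod (bump_hat u))"
  by (rule Bochner_Integration.integrable_bound[OF integrable_bump_hat_moment])
     (auto simp: abs_mult algebra_simps)

lemma bump_hat_moment_nonneg: "0 \<le> bump_hat_moment"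
  unfolding bump_hat_moment_def by simp

text \<open>
  Averaging at scale \<open>1/T\<close> moves a Lipschitz function by its Lipschitz constant times the first
  moment of the kernel, divided by \<open>T\<close>.
\<close>

lemma Lipschitz_bump_hat_average:
  fixes d :: "real \<Rightarrow> real"
  assumes [measurable]: "d \<in> borel_measurable borel" and bd: "\<And>y. \<bar>d y\<bar> \<le> K"
    and lip: "\<And>x y. \<bar>d x - d y\<bar> \<le> \<Lambda> * \<bar>x - y\<bar>" and T: "0 < T"
  shows "2 * pi * \<bar>d x\<bar> \<le> cmod (\<integral>u. d (x - u / T) *\<^sub>R bump_hat u \<partial>lborel) + \<Lambda> * bump_hat_moment / T"
proof -
  have i1: "integrable lborel (\<lambda>u. d x *\<^sub>R bump_hat u)" by (intro integrable_scaleR_right integrable_bump_hat)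
  have i2: "integrable lborel (\<lambda>u. d (x - u / T) *\<^sub>R bump_hat u)"
  proof (rule Bochner_Integration.integrable_bound)
    show "integrable lborel (\<lambda>u. K * cmod (bump_hat u))" using integrable_bump_hat by simp
    show "AE u in lborel. norm (d (x - u / T) *\<^sub>R bump_hat u) \<le> norm (K * cmod (bump_hat u))"
      using bd by (intro always_eventually allI) (auto simp: abs_mult intro!: mult_right_mono order_trans[OF bd])
  qed simp
  have "2 * pi * \<bar>d x\<bar> = cmod (\<integral>u. d x *\<^sub>R bump_hat u \<partial>lborel)"
    by (simp add: integral_bump_hat norm_mult)
  also have "(\<integral>u. d x *\<^sub>R bump_hat u \<partial>lborel) = (\<integral>u. d (x - u / T) *\<^sub>R bump_hat u \<partial>lborel) + (\<integral>u. (d x - d (x - u / T)) *\<^sub>R bump_hat u \<partial>lborel)"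
    unfolding scaleR_diff_left using i1 i2 by simp
  also have "cmod \<dots> \<le> cmod (\<integral>u. d (x - u / T) *\<^sub>R bump_hat u \<partial>lborel) + cmod (\<integral>u. (d x - d (x - u / T)) *\<^sub>R bump_hat u \<partial>lborel)"
    by (rule norm_triangle_ineq)
  also have "cmod (\<integral>u. (d x - d (x - u / T)) *\<^sub>R bump_hat u \<partial>lborel) \<le> (\<integral>u. \<Lambda> / T * (\<bar>u\<bar> * cmod (bump_hat u)) \<partial>lborel)"
  proof (rule Bochner_Integration.integral_norm_bound_integral)
    show "integrable lborel (\<lambda>u. (d x - d (x - u / T)) *\<^sub>R bump_hat u)"
      unfolding scaleR_diff_left using i1 i2 by simp
    show "integrable lborel (\<lambda>u. \<Lambda> / T * (\<bar>u\<bar> * cmod (bump_hat u)))"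
      by (intro integrable_mult_right integrable_abs_bump_hat)
    fix u
    have "\<bar>d x - d (x - u / T)\<bar> \<le> \<Lambda> * \<bar>x - (x - u / T)\<bar>" by (rule lip)
    hence "\<bar>d x - d (x - u / T)\<bar> \<le> \<Lambda> / T * \<bar>u\<bar>" using T by simp
    hence "\<bar>d x - d (x - u / T)\<bar> * cmod (bump_hat u) \<le> \<Lambda> / T * \<bar>u\<bar> * cmod (bump_hat u)"
      by (intro mult_right_mono) auto
    thus "norm ((d x - d (x - u / T)) *\<^sub>R bump_hat u) \<le> \<Lambda> / T * (\<bar>u\<bar> * cmod (bump_hat u))"
      by (simp add: mult_ac)
  qed
  also have "\<dots> = \<Lambda> * bump_hat_moment / T" by (simp add: bump_hat_moment_def)
  finally show ?thesis by simp
qed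

lemma gauss_smoothing_std_normal:
  assumes "0 < \<sigma>"
  shows "gauss_smoothing std_normal_distribution \<sigma> x = normal_density 0 (sqrt (1 + \<sigma>\<^sup>2)) x"
proof -
  have "(\<integral>\<^sup>+y. ennreal (normal_density 0 \<sigma> (x - y) * std_normal_density y) \<partial>lborel) = ennreal (normal_density 0 (sqrt (\<sigma>\<^sup>2 + 1\<^sup>2)) x)"
    using fun_cong[OF conv_normal_density_zero_mean[of \<sigma> 1], of x] assms by simp
  hence "(\<integral>y. normal_density 0 \<sigma> (x - y) * std_normal_density y \<partial>lborel) = normal_density 0 (sqrt (\<sigma>\<^sup>2 + 1\<^sup>2)) x"
    by (subst integral_eq_nn_integral) auto
  thus ?thesis unfolding gauss_smoothing_def
    by (subst integral_density) (auto simp: mult.commute add.commute)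
qed

text \<open>
  Large enough for the error of averaging to be absorbed when \<open>\<sigma> T\<close> exceeds it; the summand \<open>1\<close>
  makes it an upper bound for the normal densities in question.
\<close>

definition smoothing_constant :: real where
  "smoothing_constant = 8 * bump_hat_moment + 1"

lemma smoothing_constant_ge_1: "1 \<le> smoothing_constant"
  using bump_hat_moment_nonneg by (simp add: smoothing_constant_def)

text \<open>
  Let \<open>\<Delta>\<close> be the supremum to be estimated. The density is at most \<open>1 + \<Delta>\<close>, so its Lipschitz
  constant is \<open>O((1 + \<Delta>) / \<sigma>)\<close> and averaging costs \<open>O((1 + \<Delta>) / (\<sigma> T))\<close>. If \<open>\<sigma> T\<close> is large, the
  term with \<open>\<Delta>\<close> can be moved to the left-hand side.
\<close>

lemma gauss_smoothing_sup_bound_large: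
  assumes mu: "real_distribution \<mu>" and T: "0 < T" and \<sigma>: "0 < \<sigma>" "\<sigma> \<le> 1"
    and large: "smoothing_constant \<le> \<sigma> * T"
    and I: "(\<integral>s. indicator {-T..T} s * cmod (char \<mu> s - char std_normal_distribution s) \<partial>lborel) \<le> C / T"
    and C: "0 \<le> C"
  shows "\<bar>gauss_smoothing \<mu> \<sigma> x - gauss_smoothing std_normal_distribution \<sigma> x\<bar> \<le> (C + 2 * smoothing_constant) / (\<sigma> * T)"
proof -
  let ?\<nu> = std_normal_distribution
  let ?A = smoothing_constant
  interpret mu: real_distribution \<mu> by fact
  interpret nu: real_distribution ?\<nu> by (rule real_dist_normal_dist)
  define d where "d y = gauss_smoothing \<mu> \<sigma> y - gauss_smoothing ?\<nu> \<sigma> y" for y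
  have [measurable]: "d \<in> borel_measurable borel" unfolding d_def[abs_def] by measurable
  have bd: "\<bar>d y\<bar> \<le> 1 / \<sigma>" for y
    using mu.gauss_smoothing_le[OF \<sigma>(1), of y] nu.gauss_smoothing_le[OF \<sigma>(1), of y]
      mu.gauss_smoothing_nonneg[of \<sigma> y] nu.gauss_smoothing_nonneg[of \<sigma> y] unfolding d_def by linarith
  define \<Delta> where "\<Delta> = (SUP y. \<bar>d y\<bar>)"
  have bdd: "bdd_above (range (\<lambda>y. \<bar>d y\<bar>))" using bd by (intro bdd_aboveI2[where M = "1 / \<sigma>"]) auto
  have D: "\<bar>d y\<bar> \<le> \<Delta>" for y unfolding \<Delta>_def by (rule cSUP_upper[OF UNIV_I bdd])
  have D0: "0 \<le> \<Delta>" using D[of 0] by linarith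
  have q1: "gauss_smoothing ?\<nu> \<sigma> y \<le> 1" for y
  proof -
    have s: "1 \<le> sqrt (1 + \<sigma>\<^sup>2)" by simp
    hence "normal_density 0 (sqrt (1 + \<sigma>\<^sup>2)) y \<le> 1 / sqrt (1 + \<sigma>\<^sup>2)" by (intro normal_density_le_inverse) linarith
    also have "\<dots> \<le> 1 / 1" by (rule frac_le[OF zero_le_one order_refl zero_less_one s])
    finally show ?thesis using \<sigma> by (simp add: gauss_smoothing_std_normal)
  qed
  have p1: "gauss_smoothing \<mu> \<sigma> y \<le> 1 + \<Delta>" for y using D[of y] q1[of y] unfolding d_def by linarith
  have lip: "\<bar>d x - d y\<bar> \<le> 8 * (2 + \<Delta>) / \<sigma> * \<bar>x - y\<bar>" for x y
  proof -
    have "\<bar>d x - d y\<bar> \<le> 8 * (1 + \<Delta>) / \<sigma> * \<bar>x - y\<bar> + 8 * 1 / \<sigma> * \<bar>x - y\<bar>"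
      using mu.gauss_smoothing_Lipschitz[OF \<sigma>(1) p1, of x y] nu.gauss_smoothing_Lipschitz[OF \<sigma>(1) q1, of x y]
      unfolding d_def by linarith
    also have "\<dots> = 8 * (2 + \<Delta>) / \<sigma> * \<bar>x - y\<bar>" using \<sigma> by (simp add: field_simps)
    finally show ?thesis .
  qed
  have b: "\<bar>d y\<bar> \<le> (C + ?A * (2 + \<Delta>)) / (\<sigma> * T) / (2 * pi)" for y
  proof -
    have "2 * pi * \<bar>d y\<bar> \<le> cmod (\<integral>u. d (y - u / T) *\<^sub>R bump_hat u \<partial>lborel) + 8 * (2 + \<Delta>) / \<sigma> * bump_hat_moment / T"
      by (rule Lipschitz_bump_hat_average[OF _ bd lip T]) measurable
    also have "cmod (\<integral>u. d (y - u / T) *\<^sub>R bump_hat u \<partial>lborel) \<le> C / T"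
      using bump_hat_smoothing_diff_le[OF mu real_dist_normal_dist \<sigma>(1) T, of y] I by (simp add: d_def)
    also have "C / T \<le> C / (\<sigma> * T)" using C \<sigma> T by (intro divide_left_mono) (auto simp: mult_le_cancel_right1)
    also have "8 * (2 + \<Delta>) / \<sigma> * bump_hat_moment / T = (8 * bump_hat_moment) * (2 + \<Delta>) / (\<sigma> * T)" by simp
    also have "\<dots> \<le> ?A * (2 + \<Delta>) / (\<sigma> * T)"
      using D0 \<sigma> T by (intro divide_right_mono mult_right_mono) (auto simp: smoothing_constant_def)
    finally have "2 * pi * \<bar>d y\<bar> \<le> (C + ?A * (2 + \<Delta>)) / (\<sigma> * T)" by (simp add: add_divide_distrib)
    hence "\<bar>d y\<bar> * (2 * pi) \<le> (C + ?A * (2 + \<Delta>)) / (\<sigma> * T)" by (subst mult.commute)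
    moreover have "0 < 2 * pi" by simp
    ultimately show ?thesis by (simp only: pos_le_divide_eq)
  qed
  have "\<Delta> \<le> (C + ?A * (2 + \<Delta>)) / (\<sigma> * T) / (2 * pi)"
    unfolding \<Delta>_def by (rule cSUP_least) (use b in \<open>auto simp: \<Delta>_def\<close>)
  moreover have "0 < 2 * pi" by simp
  ultimately have "\<Delta> * (2 * pi) \<le> (C + ?A * (2 + \<Delta>)) / (\<sigma> * T)" by (simp only: pos_le_divide_eq)
  hence "2 * pi * \<Delta> \<le> (C + ?A * (2 + \<Delta>)) / (\<sigma> * T)" by (subst mult.commute)
  also have "\<dots> = (C + 2 * ?A) / (\<sigma> * T) + ?A / (\<sigma> * T) * \<Delta>" by (simp add: add_divide_distrib algebra_simps)
  also have "?A / (\<sigma> * T) * \<Delta> \<le> 1 * \<Delta>"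
    using large D0 \<sigma> T by (intro mult_right_mono) (auto simp: divide_le_eq)
  finally have "2 * pi * \<Delta> - \<Delta> \<le> (C + 2 * ?A) / (\<sigma> * T)" by simp
  moreover have "2 * \<Delta> \<le> 2 * pi * \<Delta>" using pi_gt3 D0 by (intro mult_right_mono) auto
  ultimately have "\<Delta> \<le> (C + 2 * ?A) / (\<sigma> * T)" by linarith
  thus ?thesis using D[of x] unfolding d_def by linarith
qed

text \<open>
  If \<open>\<sigma> T\<close> is small, the previous bound is used at the larger scale \<open>\<tau>\<close> for which \<open>\<tau> T\<close> equals the
  constant. It bounds the density at scale \<open>\<tau>\<close> by a constant and hence the density at scale \<open>\<sigma>\<close> by
  a multiple of \<open>\<tau>/\<sigma>\<close>, which is of order \<open>1 / (\<sigma> T)\<close>. If \<open>\<tau> > 1\<close>, the trivial bound \<open>1/\<sigma>\<close> is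
  good enough.
\<close>

lemma gauss_smoothing_sup_bound:
  assumes mu: "real_distribution \<mu>" and T: "0 < T" and \<sigma>: "0 < \<sigma>" "\<sigma> \<le> 1"
    and I: "(\<integral>s. indicator {-T..T} s * cmod (char \<mu> s - char std_normal_distribution s) \<partial>lborel) \<le> C / T"
    and C: "0 \<le> C"
  shows "\<bar>gauss_smoothing \<mu> \<sigma> x - normal_density 0 (sqrt (1 + \<sigma>\<^sup>2)) x\<bar> \<le> (C + 3 * smoothing_constant) / (\<sigma> * T)"
proof -
  let ?A = smoothing_constant
  have A: "1 \<le> ?A" by (rule smoothing_constant_ge_1)
  interpret mu: real_distribution \<mu> by fact
  have q1: "normal_density 0 (sqrt (1 + \<tau>\<^sup>2)) x \<le> 1" for \<tau>
  proof -
    have s: "1 \<le> sqrt (1 + \<tau>\<^sup>2)" by simp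
    hence "normal_density 0 (sqrt (1 + \<tau>\<^sup>2)) x \<le> 1 / sqrt (1 + \<tau>\<^sup>2)" by (intro normal_density_le_inverse) linarith
    also have "\<dots> \<le> 1 / 1" by (rule frac_le[OF zero_le_one order_refl zero_less_one s])
    finally show ?thesis by simp
  qed
  show ?thesis
  proof (cases "?A \<le> \<sigma> * T")
    case True
    have "(C + 2 * ?A) / (\<sigma> * T) \<le> (C + 3 * ?A) / (\<sigma> * T)" using A \<sigma> T by (intro divide_right_mono) auto
    thus ?thesis using gauss_smoothing_sup_bound_large[OF mu T \<sigma> True I C, of x]
      by (simp add: gauss_smoothing_std_normal \<sigma>)
  next
    case False
    have sT: "0 < \<sigma> * T" using \<sigma> T by simp
    have "gauss_smoothing \<mu> \<sigma> x \<le> (C + 3 * ?A) / (\<sigma> * T)"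
    proof (cases "?A \<le> T")
      case True
      define \<tau> where "\<tau> = ?A / T"
      have \<tau>: "0 < \<tau>" "\<tau> \<le> 1" "\<sigma> \<le> \<tau>" "\<tau> * T = ?A"
        using True False A T by (auto simp: \<tau>_def field_simps)
      have "\<bar>gauss_smoothing \<mu> \<tau> x - gauss_smoothing std_normal_distribution \<tau> x\<bar> \<le> (C + 2 * ?A) / ?A"
        using gauss_smoothing_sup_bound_large[OF mu T \<tau>(1,2) _ I C, of x] by (simp add: \<tau>(4))
      hence "gauss_smoothing \<mu> \<tau> x \<le> 1 + (C + 2 * ?A) / ?A"
        using q1[of \<tau>] unfolding gauss_smoothing_std_normal[OF \<tau>(1)] by linarith
      also have "\<dots> = (C + 3 * ?A) / ?A" using A by (simp add: field_simps)
      finally have "\<tau> / \<sigma> * gauss_smoothing \<mu> \<tau> x \<le> \<tau> / \<sigma> * ((C + 3 * ?A) / ?A)"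
        using \<tau> \<sigma> by (intro mult_left_mono) auto
      also have "\<dots> = (C + 3 * ?A) / (\<sigma> * T)" using A T \<sigma> by (simp add: \<tau>_def field_simps)
      finally show ?thesis using mu.gauss_smoothing_le_scale[OF \<sigma>(1) \<tau>(3), of x] by linarith
    next
      case False
      have "gauss_smoothing \<mu> \<sigma> x \<le> 1 / \<sigma>" by (rule mu.gauss_smoothing_le[OF \<sigma>(1)])
      also have "\<dots> = T / (\<sigma> * T)" using T by simp
      also have "\<dots> \<le> (C + 3 * ?A) / (\<sigma> * T)" using False A C sT by (intro divide_right_mono) auto
      finally show ?thesis .
    qed
    moreover have "1 \<le> (C + 3 * ?A) / (\<sigma> * T)" using False A C sT by (simp add: field_simps)
    ultimately show ?thesis
      using q1[of \<sigma>] mu.gauss_smoothing_nonneg[of \<sigma> x] normal_density_nonneg[of 0 "sqrt (1 + \<sigma>\<^sup>2)" x] by linarith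
  qed
qed

section \<open>Entropic distance in terms of densities\<close>

text \<open>
  A Radon-Nikodym derivative is unique almost everywhere, so any density may be used.
\<close>

lemma entropic_distance_eq_relative_entropy:
  assumes D: "distributed M lborel X (\<lambda>x. ennreal (p x))" and p: "\<And>x. 0 \<le> p x"
    and p_meas[measurable]: "p \<in> borel_measurable borel"
    and a: "prob_space.expectation M X = a" and v: "prob_space.variance M X = v\<^sup>2" "0 \<le> v"
  shows "entropic_distance M X = relative_entropy p (normal_density a v)"
proof -
  have "density lborel (\<lambda>x. ennreal (p x)) = distr M borel X"
    using distributed_distr_eq_density[OF D] by (simp cong: distr_cong)
  hence "AE x in lborel. ennreal (p x) = RN_deriv lborel (distr M borel X) x"
    by (intro sigma_finite_measure.RN_deriv_unique[OF sigma_finite_lborel]) auto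
  hence ae: "AE x in lborel. rv_density M X x = p x"
    unfolding rv_density_def by eventually_elim (metis enn2real_ennreal p)
  have sv: "sqrt (\<integral>\<omega>. (X \<omega> - a)\<^sup>2 \<partial>M) = v" using v a by simp
  let ?f = "\<lambda>r x. r x * ln (r x / normal_density a v x)"
  have "(\<integral>\<^sup>+ x. ennreal (?f (rv_density M X) x) \<partial>lborel) = (\<integral>\<^sup>+ x. ennreal (?f p x) \<partial>lborel)"
    by (rule nn_integral_cong_AE) (use ae in eventually_elim, simp)
  moreover have "(\<integral>\<^sup>+ x. ennreal (- ?f (rv_density M X) x) \<partial>lborel) = (\<integral>\<^sup>+ x. ennreal (- ?f p x) \<partial>lborel)"
    by (rule nn_integral_cong_AE) (use ae in eventually_elim, simp)
  ultimately show ?thesis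
    unfolding entropic_distance_def relative_entropy_def Let_def a sv by simp
qed

lemma relative_entropy_translate:
  assumes [measurable]: "p \<in> borel_measurable borel" "q \<in> borel_measurable borel"
  shows "relative_entropy (\<lambda>x. p (x - c)) (\<lambda>x. q (x - c)) = relative_entropy p q"
proof -
  have "(\<integral>\<^sup>+ x. g (x - c) \<partial>lborel) = (\<integral>\<^sup>+ x. g x \<partial>lborel)" if [measurable]: "g \<in> borel_measurable borel" for g :: "real \<Rightarrow> ennreal"
    by (subst nn_integral_real_affine[where c = 1 and t = c]) auto
  from this[of "\<lambda>x. ennreal (p x * ln (p x / q x))"] this[of "\<lambda>x. ennreal (- (p x * ln (p x / q x)))"]
  show ?thesis unfolding relative_entropy_def by simp
qed

lemma (in prob_space) entropic_distance_translate:
  assumes D: "distributed M lborel X (\<lambda>x. ennreal (p x))" and p: "\<And>x. 0 \<le> p x"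
    and [measurable]: "p \<in> borel_measurable borel" and X: "integrable M X"
  shows "entropic_distance M (\<lambda>\<omega>. X \<omega> + c) = entropic_distance M X"
proof -
  have [measurable]: "random_variable borel X" using X by simp
  have D': "distributed M lborel (\<lambda>\<omega>. X \<omega> + c) (\<lambda>x. ennreal (p (x - c)))"
    unfolding distributed_def
  proof (intro conjI)
    show "distr M lborel (\<lambda>\<omega>. X \<omega> + c) = density lborel (\<lambda>x. ennreal (p (x - c)))"
    proof (rule measure_eqI)
      fix A assume "A \<in> sets (distr M lborel (\<lambda>\<omega>. X \<omega> + c))"
      hence [measurable]: "A \<in> sets borel" by simp
      have [measurable]: "(\<lambda>x. x + c) -` A \<in> sets borel"
        using measurable_sets[of "\<lambda>x. x + c" borel borel A] by simp
      have "emeasure (distr M lborel (\<lambda>\<omega>. X \<omega> + c)) A = emeasure (distr M lborel X) ((\<lambda>x. x + c) -` A)"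
        by (auto simp: emeasure_distr intro!: arg_cong2[where f = emeasure])
      also have "\<dots> = (\<integral>\<^sup>+ x. ennreal (p x) * indicator A (x + c) \<partial>lborel)"
        unfolding distributed_distr_eq_density[OF D]
        by (subst emeasure_density) (auto simp: indicator_def intro!: nn_integral_cong)
      also have "\<dots> = (\<integral>\<^sup>+ x. ennreal (p (x - c)) * indicator A x \<partial>lborel)"
        by (subst (2) nn_integral_real_affine[where c = 1 and t = c]) (auto simp: add.commute)
      finally show "emeasure (distr M lborel (\<lambda>\<omega>. X \<omega> + c)) A = emeasure (density lborel (\<lambda>x. ennreal (p (x - c)))) A"
        by (simp add: emeasure_density)
    qed simp
  qed auto
  have e: "expectation (\<lambda>\<omega>. X \<omega> + c) = expectation X + c" using X by (simp add: prob_space)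
  have v: "variance (\<lambda>\<omega>. X \<omega> + c) = variance X" unfolding e by simp
  have v0: "0 \<le> variance X" by simp
  have "entropic_distance M (\<lambda>\<omega>. X \<omega> + c) = relative_entropy (\<lambda>x. p (x - c)) (normal_density (expectation X + c) (sqrt (variance X)))"
    by (rule entropic_distance_eq_relative_entropy[OF D']) (use p v0 v e in auto)
  also have "normal_density (expectation X + c) (sqrt (variance X)) = (\<lambda>x. normal_density (expectation X) (sqrt (variance X)) (x - c))"
    by (simp add: normal_density_def fun_eq_iff algebra_simps)
  also have "relative_entropy (\<lambda>x. p (x - c)) \<dots> = relative_entropy p (normal_density (expectation X) (sqrt (variance X)))"
    by (rule relative_entropy_translate) auto
  also have "\<dots> = entropic_distance M X"
    by (rule entropic_distance_eq_relative_entropy[OF D, symmetric]) (use p v0 in auto)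
  finally show ?thesis .
qed

text \<open>
  In contrast to the convolution of two densities, the law of \<open>X\<close> may be singular.
\<close>

lemma (in prob_space) distributed_add_normal:
  assumes ind: "indep_var borel X borel V" and V: "distributed M lborel V (normal_density 0 \<tau>)" and \<tau>: "0 < \<tau>"
  shows "distributed M lborel (\<lambda>\<omega>. X \<omega> + V \<omega>) (\<lambda>x. ennreal (gauss_smoothing (distr M borel X) \<tau> x))"
proof -
  have [measurable]: "random_variable borel X" using ind by (rule indep_var_rv1)
  have [measurable]: "random_variable borel V" using ind by (rule indep_var_rv2)
  define \<mu> where "\<mu> = distr M borel X"
  interpret mu: real_distribution \<mu> unfolding \<mu>_def by (rule real_distribution_distr) simp
  interpret P: pair_sigma_finite \<mu> lborel ..
  let ?n = "normal_density 0 \<tau>"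
  have dV: "distr M borel V = density lborel ?n"
    using distributed_distr_eq_density[OF V] by (simp cong: distr_cong)
  have "distr M borel (\<lambda>\<omega>. X \<omega> + V \<omega>) = convolution \<mu> (density lborel ?n)"
    unfolding \<mu>_def dV[symmetric] by (rule sum_indep_random_variable[OF ind]) auto
  also have "\<dots> = density lborel (\<lambda>x. ennreal (gauss_smoothing \<mu> \<tau> x))"
  proof (rule measure_eqI)
    fix A assume "A \<in> sets (convolution \<mu> (density lborel ?n))"
    hence [measurable]: "A \<in> sets borel" by simp
    have fin: "finite_measure (density lborel ?n)"
      using prob_space_normal_density[OF \<tau>] by (rule prob_space.finite_measure)
    have "emeasure (convolution \<mu> (density lborel ?n)) A = (\<integral>\<^sup>+x. \<integral>\<^sup>+y. indicator A (x + y) \<partial>density lborel ?n \<partial>\<mu>)"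
      by (rule convolution_emeasure') (auto simp: fin mu.finite_measure_axioms)
    also have "\<dots> = (\<integral>\<^sup>+x. \<integral>\<^sup>+u. ennreal (?n (u - x)) * indicator A u \<partial>lborel \<partial>\<mu>)"
    proof (rule nn_integral_cong)
      fix x
      have "(\<integral>\<^sup>+y. indicator A (x + y) \<partial>density lborel ?n) = (\<integral>\<^sup>+y. ennreal (?n y) * indicator A (x + y) \<partial>lborel)"
        by (subst nn_integral_density) auto
      also have "\<dots> = (\<integral>\<^sup>+u. ennreal (?n (u - x)) * indicator A u \<partial>lborel)"
        by (subst (2) nn_integral_real_affine[where c = 1 and t = x]) auto
      finally show "(\<integral>\<^sup>+y. indicator A (x + y) \<partial>density lborel ?n) = (\<integral>\<^sup>+u. ennreal (?n (u - x)) * indicator A u \<partial>lborel)" .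
    qed
    also have "\<dots> = (\<integral>\<^sup>+u. \<integral>\<^sup>+x. ennreal (?n (u - x)) * indicator A u \<partial>\<mu> \<partial>lborel)"
      by (rule P.Fubini'[symmetric]) measurable
    also have "\<dots> = (\<integral>\<^sup>+u. ennreal (gauss_smoothing \<mu> \<tau> u) * indicator A u \<partial>lborel)"
      using mu.integrable_normal_density_shift[OF \<tau>]
      by (intro nn_integral_cong)
         (simp add: nn_integral_multc nn_integral_eq_integral gauss_smoothing_def)
    also have "\<dots> = emeasure (density lborel (\<lambda>x. ennreal (gauss_smoothing \<mu> \<tau> x))) A"
      by (simp add: emeasure_density)
    finally show "emeasure (convolution \<mu> (density lborel ?n)) A = emeasure (density lborel (\<lambda>x. ennreal (gauss_smoothing \<mu> \<tau> x))) A" .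
  qed simp
  finally show ?thesis unfolding distributed_def \<mu>_def[symmetric] by (simp cong: distr_cong)
qed

section \<open>Exponential moments of normal laws\<close>

text \<open>
  Completing the square.
\<close>

lemma normal_density_tilt:
  assumes "0 < s"
  shows "normal_density 0 s x * exp (a * x) = exp (a\<^sup>2 * s\<^sup>2 / 2) * normal_density (a * s\<^sup>2) s x"
proof -
  have "- x\<^sup>2 / (2 * s\<^sup>2) + a * x = a\<^sup>2 * s\<^sup>2 / 2 + - (x - a * s\<^sup>2)\<^sup>2 / (2 * s\<^sup>2)"
    using assms by (simp add: field_simps power2_eq_square)
  hence "exp (- x\<^sup>2 / (2 * s\<^sup>2)) * exp (a * x) = exp (a\<^sup>2 * s\<^sup>2 / 2) * exp (- (x - a * s\<^sup>2)\<^sup>2 / (2 * s\<^sup>2))"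
    by (simp only: exp_add[symmetric])
  thus ?thesis by (simp add: normal_density_def)
qed

text \<open>
  The real part of \<open>z\<close> tilts the density, and the imaginary part is then treated as in the
  characteristic function.
\<close>

lemma complex_mgf_normal_density:
  assumes s: "0 < s"
  shows "integrable lborel (\<lambda>x. normal_density 0 s x *\<^sub>R exp (z * complex_of_real x))"
    and "(\<integral>x. normal_density 0 s x *\<^sub>R exp (z * complex_of_real x) \<partial>lborel) = exp (z\<^sup>2 * of_real (s\<^sup>2) / 2)"
proof -
  define a b where "a = Re z" and "b = Im z"
  have z: "z = of_real a + \<i> * of_real b" by (simp add: a_def b_def complex_eq)
  have eq: "normal_density 0 s x *\<^sub>R exp (z * complex_of_real x)
    = exp (a\<^sup>2 * s\<^sup>2 / 2) *\<^sub>R (normal_density (a * s\<^sup>2) s x *\<^sub>R iexp (b * x))" for x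
  proof -
    have "exp (z * complex_of_real x) = exp (a * x) *\<^sub>R iexp (b * x)"
      by (simp add: z scaleR_conv_of_real algebra_simps exp_add flip: exp_of_real)
    hence "normal_density 0 s x *\<^sub>R exp (z * complex_of_real x) = (normal_density 0 s x * exp (a * x)) *\<^sub>R iexp (b * x)"
      by simp
    thus ?thesis by (simp only: normal_density_tilt[OF s] scaleR_scaleR)
  qed
  show "integrable lborel (\<lambda>x. normal_density 0 s x *\<^sub>R exp (z * complex_of_real x))"
    unfolding eq
  proof (rule integrable_scaleR_right, rule Bochner_Integration.integrable_bound)
    show "integrable lborel (normal_density (a * s\<^sup>2) s)" using s by simp
  qed auto
  have "(\<integral>x. normal_density (a * s\<^sup>2) s x *\<^sub>R iexp (b * x) \<partial>lborel)
     = \<bar>1\<bar> *\<^sub>R (\<integral>x. normal_density (a * s\<^sup>2) s (a * s\<^sup>2 + 1 * x) *\<^sub>R iexp (b * (a * s\<^sup>2 + 1 * x)) \<partial>lborel)"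
    by (rule lborel_integral_real_affine) simp
  also have "\<dots> = (\<integral>x. iexp (b * (a * s\<^sup>2)) * (normal_density 0 s x *\<^sub>R iexp (b * x)) \<partial>lborel)"
    by (simp add: normal_density_def distrib_left exp_add mult_ac)
  also have "\<dots> = iexp (b * (a * s\<^sup>2)) * of_real (exp (- (s\<^sup>2 * b\<^sup>2) / 2))"
    by (subst integral_mult_right_zero) (simp only: char_normal_density[OF s])
  finally have "(\<integral>x. normal_density 0 s x *\<^sub>R exp (z * complex_of_real x) \<partial>lborel)
    = exp (a\<^sup>2 * s\<^sup>2 / 2) *\<^sub>R (iexp (b * (a * s\<^sup>2)) * of_real (exp (- (s\<^sup>2 * b\<^sup>2) / 2)))"
    unfolding eq by (simp only: integral_scaleR_right)
  also have "\<dots> = exp (of_real (a\<^sup>2 * s\<^sup>2 / 2) + \<i> * of_real (b * (a * s\<^sup>2)) + of_real (- (s\<^sup>2 * b\<^sup>2) / 2))"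
    by (simp only: scaleR_conv_of_real exp_add exp_of_real mult.assoc)
  also have "of_real (a\<^sup>2 * s\<^sup>2 / 2) + \<i> * of_real (b * (a * s\<^sup>2)) + of_real (- (s\<^sup>2 * b\<^sup>2) / 2) = z\<^sup>2 * of_real (s\<^sup>2) / 2"
    by (simp add: z power2_sum power_mult_distrib field_simps)
  finally show "(\<integral>x. normal_density 0 s x *\<^sub>R exp (z * complex_of_real x) \<partial>lborel) = exp (z\<^sup>2 * of_real (s\<^sup>2) / 2)" .
qed

text \<open>
  The exponential of \<open>\<bar>x\<bar>\<close> is at most the sum of those of \<open>x\<close> and \<open>- x\<close>.
\<close>

lemma exp_abs_moment_normal_density:
  assumes s: "0 < s"
  shows "integrable lborel (\<lambda>x. normal_density 0 s x * exp (l * \<bar>x\<bar>))"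
    and "(\<integral>x. normal_density 0 s x * exp (l * \<bar>x\<bar>) \<partial>lborel) \<le> 2 * exp (l\<^sup>2 * s\<^sup>2 / 2)"
proof -
  let ?g = "\<lambda>x. exp (l\<^sup>2 * s\<^sup>2 / 2) * normal_density (l * s\<^sup>2) s x + exp (l\<^sup>2 * s\<^sup>2 / 2) * normal_density (- l * s\<^sup>2) s x"
  have le: "normal_density 0 s x * exp (l * \<bar>x\<bar>) \<le> ?g x" for x
  proof -
    have "exp (l * \<bar>x\<bar>) \<le> exp (l * x) + exp (- l * x)" by (cases "0 \<le> x") auto
    hence "normal_density 0 s x * exp (l * \<bar>x\<bar>) \<le> normal_density 0 s x * (exp (l * x) + exp (- l * x))"
      by (intro mult_left_mono) auto
    thus ?thesis by (simp only: distrib_left normal_density_tilt[OF s]) simp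
  qed
  have gi: "integrable lborel ?g" using s by simp
  show i: "integrable lborel (\<lambda>x. normal_density 0 s x * exp (l * \<bar>x\<bar>))"
    by (rule Bochner_Integration.integrable_bound[OF gi]) (use le in \<open>auto simp: abs_mult intro!: order_trans[OF le]\<close>)
  have "(\<integral>x. normal_density 0 s x * exp (l * \<bar>x\<bar>) \<partial>lborel) \<le> (\<integral>x. ?g x \<partial>lborel)"
    by (rule Bochner_Integration.integral_mono[OF i gi le])
  also have "\<dots> = 2 * exp (l\<^sup>2 * s\<^sup>2 / 2)" using s by simp
  finally show "(\<integral>x. normal_density 0 s x * exp (l * \<bar>x\<bar>) \<partial>lborel) \<le> 2 * exp (l\<^sup>2 * s\<^sup>2 / 2)" .
qed

text \<open>
  Chernoff's bound with parameter \<open>w/4\<close>, the optimal one for variance \<open>4\<close>.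
\<close>

lemma normal_density_tail:
  assumes s: "0 < s" "s\<^sup>2 \<le> 4" and w: "0 \<le> w"
  shows "(\<integral>x. normal_density 0 s x * indicator {x. w < \<bar>x\<bar>} x \<partial>lborel) \<le> 2 * exp (- w\<^sup>2 / 8)"
proof -
  let ?l = "w / 4"
  have "(\<integral>x. normal_density 0 s x * indicator {x. w < \<bar>x\<bar>} x \<partial>lborel)
      \<le> (\<integral>x. exp (- ?l * w) * (normal_density 0 s x * exp (?l * \<bar>x\<bar>)) \<partial>lborel)"
  proof (rule Bochner_Integration.integral_mono)
    show "integrable lborel (\<lambda>x. normal_density 0 s x * indicator {x. w < \<bar>x\<bar>} x)"
      using s by (intro integrable_real_mult_indicator) auto
    show "integrable lborel (\<lambda>x. exp (- ?l * w) * (normal_density 0 s x * exp (?l * \<bar>x\<bar>)))"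
      by (intro integrable_mult_right exp_abs_moment_normal_density s)
    fix x
    show "normal_density 0 s x * indicator {x. w < \<bar>x\<bar>} x \<le> exp (- ?l * w) * (normal_density 0 s x * exp (?l * \<bar>x\<bar>))"
    proof (cases "w < \<bar>x\<bar>")
      case True
      hence "?l * w \<le> ?l * \<bar>x\<bar>" using w by (intro mult_left_mono) auto
      hence "1 \<le> exp (- ?l * w) * exp (?l * \<bar>x\<bar>)" by (simp flip: exp_add)
      from mult_left_mono[OF this, of "normal_density 0 s x"] True show ?thesis by (simp add: mult_ac)
    qed simp
  qed
  also have "\<dots> = exp (- ?l * w) * (\<integral>x. normal_density 0 s x * exp (?l * \<bar>x\<bar>) \<partial>lborel)"
    by (rule integral_mult_right_zero)
  also have "\<dots> \<le> exp (- ?l * w) * (2 * exp (?l\<^sup>2 * s\<^sup>2 / 2))"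
    by (intro mult_left_mono exp_abs_moment_normal_density s) auto
  also have "\<dots> \<le> exp (- ?l * w) * (2 * exp (?l\<^sup>2 * 4 / 2))"
  proof -
    have "?l\<^sup>2 * s\<^sup>2 / 2 \<le> ?l\<^sup>2 * 4 / 2" using s by (intro divide_right_mono mult_left_mono) auto
    thus ?thesis by simp
  qed
  also have "\<dots> = 2 * exp (- ?l * w + ?l\<^sup>2 * 4 / 2)" by (simp only: exp_add)
  also have "- ?l * w + ?l\<^sup>2 * 4 / 2 = - w\<^sup>2 / 8" by (simp add: power2_eq_square)
  finally show ?thesis .
qed

lemma (in prob_space) expectation_distributed:
  fixes h :: "real \<Rightarrow> 'b :: {banach, second_countable_topology}"
  assumes D: "distributed M lborel V (\<lambda>x. ennreal (p x))" and p: "\<And>x. 0 \<le> p x"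
    and [measurable]: "p \<in> borel_measurable borel" "h \<in> borel_measurable borel"
  shows "expectation (\<lambda>\<omega>. h (V \<omega>)) = (\<integral>x. p x *\<^sub>R h x \<partial>lborel)"
    and "integrable M (\<lambda>\<omega>. h (V \<omega>)) \<longleftrightarrow> integrable lborel (\<lambda>x. p x *\<^sub>R h x)"
proof -
  have [measurable]: "random_variable borel V" using distributed_measurable[OF D] by simp
  have "expectation (\<lambda>\<omega>. h (V \<omega>)) = (\<integral>x. h x \<partial>distr M lborel V)"
    by (rule integral_distr[symmetric]) simp_all
  thus "expectation (\<lambda>\<omega>. h (V \<omega>)) = (\<integral>x. p x *\<^sub>R h x \<partial>lborel)"
    unfolding distributed_distr_eq_density[OF D] by (subst (asm) integral_density) (use p in auto)
  have "integrable M (\<lambda>\<omega>. h (V \<omega>)) \<longleftrightarrow> integrable (distr M lborel V) h"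
    by (rule integrable_distr_eq[symmetric]) simp_all
  thus "integrable M (\<lambda>\<omega>. h (V \<omega>)) \<longleftrightarrow> integrable lborel (\<lambda>x. p x *\<^sub>R h x)"
    unfolding distributed_distr_eq_density[OF D] by (subst (asm) integrable_density) (use p in auto)
qed

text \<open>
  The form in which smallness of the entropic distance is used: through bounded test functions.
\<close>

lemma (in prob_space) expectation_close_of_relative_entropy:
  fixes h :: "real \<Rightarrow> complex"
  assumes D: "distributed M lborel V (\<lambda>x. ennreal (p x))" and p: "\<And>x. 0 \<le> p x"
    and pm[measurable]: "p \<in> borel_measurable borel"
    and s: "0 < s" and ent: "relative_entropy p (normal_density 0 s) \<le> ereal (b\<^sup>2)" and b: "0 < b"
    and hm[measurable]: "h \<in> borel_measurable borel" and h: "\<And>x. cmod (h x) \<le> B"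
  shows "cmod (expectation (\<lambda>\<omega>. h (V \<omega>)) - (\<integral>x. normal_density 0 s x *\<^sub>R h x \<partial>lborel)) \<le> 2 * b * B"
proof -
  let ?q = "normal_density 0 s"
  have [measurable]: "random_variable borel V" using distributed_measurable[OF D] by simp
  have B0: "0 \<le> B" using h[of 0] by (meson norm_ge_zero order_trans)
  have pi: "(\<integral>\<^sup>+ x. ennreal (p x) \<partial>lborel) = 1"
  proof -
    interpret V: prob_space "distr M lborel V" by (rule prob_space_distr) simp
    show ?thesis using V.emeasure_space_1 unfolding distributed_distr_eq_density[OF D]
      by (simp add: emeasure_density)
  qed
  have qi: "(\<integral>\<^sup>+ x. ennreal (?q x) \<partial>lborel) = 1"
    using s by (subst nn_integral_eq_integral) auto
  have pint: "integrable lborel p" by (rule integrableI_nonneg) (use p pi in auto)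
  have dint: "integrable lborel (\<lambda>x. \<bar>p x - ?q x\<bar>)" using pint s by simp
  have L1: "(\<integral>x. \<bar>p x - ?q x\<bar> \<partial>lborel) \<le> 2 * b"
  proof -
    have "ennreal (\<integral>x. \<bar>p x - ?q x\<bar> \<partial>lborel) = (\<integral>\<^sup>+ x. ennreal \<bar>p x - ?q x\<bar> \<partial>lborel)"
      using dint by (subst nn_integral_eq_integral) auto
    also have "\<dots> \<le> ennreal (2 * b)"
      by (rule L1_distance_le_relative_entropy[OF pm _ p _ pi qi b ent]) (use s normal_density_pos in auto)
    finally show ?thesis using b by (simp add: ennreal_le_iff)
  qed
  have ih: "integrable lborel (\<lambda>x. r x *\<^sub>R h x)" if "integrable lborel r" for r :: "real \<Rightarrow> real"
  proof (rule Bochner_Integration.integrable_bound)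
    show "integrable lborel (\<lambda>x. B * r x)" using that by simp
    show "AE x in lborel. norm (r x *\<^sub>R h x) \<le> norm (B * r x)"
      using h B0 by (intro always_eventually allI) (auto simp: abs_mult mult.commute[of B] intro!: mult_left_mono)
  qed (use that in measurable)
  have "expectation (\<lambda>\<omega>. h (V \<omega>)) - (\<integral>x. ?q x *\<^sub>R h x \<partial>lborel) = (\<integral>x. (p x - ?q x) *\<^sub>R h x \<partial>lborel)"
    unfolding scaleR_diff_left expectation_distributed(1)[OF D p pm hm]
    using ih[OF pint] ih[of ?q] s by simp
  also have "cmod \<dots> \<le> (\<integral>x. B * \<bar>p x - ?q x\<bar> \<partial>lborel)"
  proof (rule Bochner_Integration.integral_norm_bound_integral)
    show "integrable lborel (\<lambda>x. (p x - ?q x) *\<^sub>R h x)" using ih[of "\<lambda>x. p x - ?q x"] pint s by simp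
    show "norm ((p x - ?q x) *\<^sub>R h x) \<le> B * \<bar>p x - ?q x\<bar>" for x
      using mult_left_mono[OF h[of x], of "\<bar>p x - ?q x\<bar>"] by (simp add: mult.commute)
  qed (use dint in simp)
  also have "\<dots> \<le> B * (2 * b)" using L1 B0 by (simp add: mult_left_mono)
  finally show ?thesis by (simp add: mult_ac)
qed

section \<open>Truncation of independent summands\<close>

lemma (in prob_space) indep_var_of_indep_vars:
  fixes V :: "nat \<Rightarrow> 'a \<Rightarrow> real"
  assumes ind: "indep_vars (\<lambda>_. borel) V I" and AB: "A \<inter> B = {}" "A \<subseteq> I" "B \<subseteq> I"
    and f: "f \<in> borel_measurable (PiM A (\<lambda>_. borel))" and g: "g \<in> borel_measurable (PiM B (\<lambda>_. borel))"
  shows "indep_var borel (\<lambda>\<omega>. f (restrict (\<lambda>i. V i \<omega>) A)) borel (\<lambda>\<omega>. g (restrict (\<lambda>i. V i \<omega>) B))"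
  using indep_var_compose[OF indep_var_restrict[OF ind AB] f g] by (simp add: comp_def)

definition trunc :: "real \<Rightarrow> real \<Rightarrow> real" where
  "trunc N x = (if \<bar>x\<bar> \<le> N then x else 0)"

lemma measurable_trunc [measurable]: "trunc N \<in> borel_measurable borel"
  unfolding trunc_def[abs_def] by measurable

lemma abs_trunc_le: "0 \<le> N \<Longrightarrow> \<bar>trunc N x\<bar> \<le> N" and trunc_sq_le: "(trunc N x)\<^sup>2 \<le> x\<^sup>2"
  by (auto simp: trunc_def)

definition tail_indicator :: "real \<Rightarrow> real \<Rightarrow> real" where
  "tail_indicator N = indicator {x. N < \<bar>x\<bar>}"

lemma measurable_tail_indicator [measurable]: "tail_indicator N \<in> borel_measurable borel"
  unfolding tail_indicator_def by measurable

lemma tail_indicator_bounds: "0 \<le> tail_indicator N x" "tail_indicator N x \<le> 1"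
  by (auto simp: tail_indicator_def indicator_def)

lemma trunc_ne: "trunc N x \<noteq> x \<Longrightarrow> tail_indicator N x = 1"
  by (auto simp: tail_indicator_def trunc_def split: if_splits)

text \<open>
  The two Gaussian perturbations are merged into one variable \<open>U\<close>, as only their sum enters into
  the regularized sum. The assumptions are symmetric in \<open>X\<close> and \<open>Y\<close>, so that each conclusion about \<open>X\<close> can be
  applied to \<open>Y\<close> as well.
\<close>

locale sum_with_gaussian = prob_space M for M :: "'a measure" +
  fixes X Y U :: "'a \<Rightarrow> real" and \<sigma> :: real
  assumes indep: "indep_vars (\<lambda>_. borel) (\<lambda>i::nat. [X, Y, U] ! i) {..<3}"
    and \<sigma>: "0 < \<sigma>" "\<sigma> \<le> 1"
    and U: "distributed M lborel U (normal_density 0 (sqrt 2 * \<sigma>))"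
    and X2: "integrable M (\<lambda>\<omega>. (X \<omega>)\<^sup>2)" "expectation X = 0" "expectation (\<lambda>\<omega>. (X \<omega>)\<^sup>2) = 1"
    and Y2: "integrable M (\<lambda>\<omega>. (Y \<omega>)\<^sup>2)" "expectation Y = 0" "expectation (\<lambda>\<omega>. (Y \<omega>)\<^sup>2) = 1"
begin

text \<open>
  The standard deviations of \<open>U\<close> and \<open>W\<close>.
\<close>

definition "s = sqrt 2 * \<sigma>"
definition "r = sqrt (2 + 2 * \<sigma>\<^sup>2)"
definition "W \<omega> = X \<omega> + Y \<omega> + U \<omega>"

lemma s: "0 < s" "s\<^sup>2 = 2 * \<sigma>\<^sup>2" "s\<^sup>2 \<le> 2"
  using \<sigma> by (auto simp: s_def power_mult_distrib power_le_one)

lemma r: "0 < r" "r\<^sup>2 = 2 + 2 * \<sigma>\<^sup>2" "r\<^sup>2 \<le> 4"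
  using \<sigma> by (auto simp: r_def power_le_one add_pos_nonneg)

lemma rv [measurable]: "random_variable borel X" "random_variable borel Y" "random_variable borel U"
proof -
  have "random_variable borel ([X, Y, U] ! i)" if "i < 3" for i using indep that by (auto simp: indep_vars_def)
  from this[of 0] this[of 1] this[of 2]
  show "random_variable borel X" "random_variable borel Y" "random_variable borel U"
    by (simp_all add: eval_nat_numeral)
qed

lemma measurable_W [measurable]: "random_variable borel W"
  unfolding W_def[abs_def] by measurable

lemma indep_pair:
  assumes f: "f \<in> borel_measurable (borel \<Otimes>\<^sub>M borel)"
  shows "indep_var borel X borel (\<lambda>\<omega>. f (Y \<omega>, U \<omega>))"
    and "indep_var borel Y borel (\<lambda>\<omega>. f (X \<omega>, U \<omega>))"
    and "indep_var borel (\<lambda>\<omega>. f (X \<omega>, Y \<omega>)) borel U"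
proof -
  have m2: "(\<lambda>v. f (v i, v j)) \<in> borel_measurable (PiM {i, j} (\<lambda>_. borel))" for i j :: nat
    by (rule measurable_compose[OF _ f]) (intro measurable_Pair measurable_component_singleton; simp)
  have m1: "(\<lambda>v. v i) \<in> borel_measurable (PiM {i} (\<lambda>_. borel))" for i :: nat
    by (rule measurable_component_singleton) simp
  show "indep_var borel X borel (\<lambda>\<omega>. f (Y \<omega>, U \<omega>))"
    using indep_var_of_indep_vars[OF indep _ _ _ m1[of 0] m2[of 1 2]] by (simp add: eval_nat_numeral)
  show "indep_var borel Y borel (\<lambda>\<omega>. f (X \<omega>, U \<omega>))"
    using indep_var_of_indep_vars[OF indep _ _ _ m1[of 1] m2[of 0 2]] by (simp add: eval_nat_numeral)
  show "indep_var borel (\<lambda>\<omega>. f (X \<omega>, Y \<omega>)) borel U"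
    using indep_var_of_indep_vars[OF indep _ _ _ m2[of 0 1] m1[of 2]] by (simp add: eval_nat_numeral)
qed

lemma expectation_prod3:
  fixes f g h :: "real \<Rightarrow> complex"
  assumes [measurable]: "f \<in> borel_measurable borel" "g \<in> borel_measurable borel" "h \<in> borel_measurable borel"
    and i: "integrable M (\<lambda>\<omega>. f (X \<omega>))" "integrable M (\<lambda>\<omega>. g (Y \<omega>))" "integrable M (\<lambda>\<omega>. h (U \<omega>))"
  shows "integrable M (\<lambda>\<omega>. f (X \<omega>) * g (Y \<omega>) * h (U \<omega>))"
    and "expectation (\<lambda>\<omega>. f (X \<omega>) * g (Y \<omega>) * h (U \<omega>)) = expectation (\<lambda>\<omega>. f (X \<omega>)) * expectation (\<lambda>\<omega>. g (Y \<omega>)) * expectation (\<lambda>\<omega>. h (U \<omega>))"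
proof -
  have F: "[f, g, h] ! i \<in> borel_measurable borel" if "i < 3" for i
    using that by (auto simp: less_Suc_eq eval_nat_numeral)
  have ind: "indep_vars (\<lambda>_. borel) (\<lambda>i \<omega>. ([f, g, h] ! i) (([X, Y, U] ! i) \<omega>)) {..<3}"
    by (rule indep_vars_compose2[OF indep]) (use F in auto)
  have int: "integrable M (\<lambda>\<omega>. ([f, g, h] ! k) (([X, Y, U] ! k) \<omega>))" if "k \<in> {..<3}" for k
    using that i by (auto simp: less_Suc_eq eval_nat_numeral)
  have set3: "{..<3} = {0, 1, 2::nat}" by auto
  show "integrable M (\<lambda>\<omega>. f (X \<omega>) * g (Y \<omega>) * h (U \<omega>))"
    using indep_vars_integrable[OF _ ind int] by (simp add: set3 mult.assoc)
  show "expectation (\<lambda>\<omega>. f (X \<omega>) * g (Y \<omega>) * h (U \<omega>)) = expectation (\<lambda>\<omega>. f (X \<omega>)) * expectation (\<lambda>\<omega>. g (Y \<omega>)) * expectation (\<lambda>\<omega>. h (U \<omega>))"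
    using indep_vars_lebesgue_integral[OF _ ind int] by (simp add: set3 mult.assoc)
qed

lemma U2: "integrable M (\<lambda>\<omega>. (U \<omega>)\<^sup>2)" "integrable M U" "expectation U = 0" "expectation (\<lambda>\<omega>. (U \<omega>)\<^sup>2) = 2 * \<sigma>\<^sup>2"
proof -
  have U': "distributed M lborel U (\<lambda>x. ennreal (normal_density 0 s x))" using U by (simp add: s_def)
  have "integrable lborel (\<lambda>x. normal_density 0 s x *\<^sub>R x\<^sup>2)"
    using integrable_normal_moment[OF s(1), of 0 2] by simp
  thus i: "integrable M (\<lambda>\<omega>. (U \<omega>)\<^sup>2)"
    by (subst expectation_distributed(2)[OF U']) auto
  thus "integrable M U" by (rule square_integrable_imp_integrable[OF rv(3)])
  show "expectation U = 0" by (rule normal_distributed_expectation[OF s(1) U'])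
  thus "expectation (\<lambda>\<omega>. (U \<omega>)\<^sup>2) = 2 * \<sigma>\<^sup>2"
    using normal_distributed_variance[OF s(1) U'] by (simp add: s(2))
qed

end

lemma (in prob_space) sum_second_moment:
  fixes A B :: "'a \<Rightarrow> real"
  assumes ind: "indep_var borel A borel B"
    and A: "integrable M (\<lambda>\<omega>. (A \<omega>)\<^sup>2)" "expectation A = 0" and B: "integrable M (\<lambda>\<omega>. (B \<omega>)\<^sup>2)" "expectation B = 0"
  shows "integrable M (\<lambda>\<omega>. (A \<omega> + B \<omega>)\<^sup>2)" "expectation (\<lambda>\<omega>. A \<omega> + B \<omega>) = 0"
    "expectation (\<lambda>\<omega>. (A \<omega> + B \<omega>)\<^sup>2) = expectation (\<lambda>\<omega>. (A \<omega>)\<^sup>2) + expectation (\<lambda>\<omega>. (B \<omega>)\<^sup>2)"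
proof -
  have i: "integrable M A" "integrable M B"
    using square_integrable_imp_integrable[OF indep_var_rv1[OF ind] A(1)]
      square_integrable_imp_integrable[OF indep_var_rv2[OF ind] B(1)] by auto
  have AB: "integrable M (\<lambda>\<omega>. A \<omega> * B \<omega>)" "expectation (\<lambda>\<omega>. A \<omega> * B \<omega>) = 0"
    using indep_var_integrable[OF ind i] indep_var_lebesgue_integral[OF ind i] A B by auto
  have eq: "(A \<omega> + B \<omega>)\<^sup>2 = (A \<omega>)\<^sup>2 + (B \<omega>)\<^sup>2 + 2 * (A \<omega> * B \<omega>)" for \<omega> by (simp add: power2_sum)
  show "integrable M (\<lambda>\<omega>. (A \<omega> + B \<omega>)\<^sup>2)" unfolding eq using A B AB by simp
  show "expectation (\<lambda>\<omega>. A \<omega> + B \<omega>) = 0" using A B i by simp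
  show "expectation (\<lambda>\<omega>. (A \<omega> + B \<omega>)\<^sup>2) = expectation (\<lambda>\<omega>. (A \<omega>)\<^sup>2) + expectation (\<lambda>\<omega>. (B \<omega>)\<^sup>2)"
    unfolding eq using A B AB by simp
qed

context sum_with_gaussian
begin

lemma W_moments: "integrable M (\<lambda>\<omega>. (W \<omega>)\<^sup>2)" "expectation W = 0" "expectation (\<lambda>\<omega>. (W \<omega>)\<^sup>2) = r\<^sup>2"
  and YU_moments: "integrable M (\<lambda>\<omega>. (Y \<omega> + U \<omega>)\<^sup>2)" "expectation (\<lambda>\<omega>. (Y \<omega> + U \<omega>)\<^sup>2) = 1 + 2 * \<sigma>\<^sup>2"
  and XU_moments: "integrable M (\<lambda>\<omega>. (X \<omega> + U \<omega>)\<^sup>2)" "expectation (\<lambda>\<omega>. (X \<omega> + U \<omega>)\<^sup>2) = 1 + 2 * \<sigma>\<^sup>2"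
proof -
  have YU: "indep_var borel Y borel U"
    using indep_pair(2)[of snd] by simp
  have XU: "indep_var borel X borel U"
    using indep_pair(1)[of snd] by simp
  have XYU: "indep_var borel X borel (\<lambda>\<omega>. Y \<omega> + U \<omega>)"
    using indep_pair(1)[of "\<lambda>p. fst p + snd p"] by simp
  note yu = sum_second_moment[OF YU Y2(1,2) U2(1,3)]
  note xu = sum_second_moment[OF XU X2(1,2) U2(1,3)]
  show "integrable M (\<lambda>\<omega>. (Y \<omega> + U \<omega>)\<^sup>2)" "expectation (\<lambda>\<omega>. (Y \<omega> + U \<omega>)\<^sup>2) = 1 + 2 * \<sigma>\<^sup>2"
    using yu by (simp_all add: Y2 U2)
  show "integrable M (\<lambda>\<omega>. (X \<omega> + U \<omega>)\<^sup>2)" "expectation (\<lambda>\<omega>. (X \<omega> + U \<omega>)\<^sup>2) = 1 + 2 * \<sigma>\<^sup>2"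
    using xu by (simp_all add: X2 U2)
  have "(\<lambda>\<omega>. X \<omega> + (Y \<omega> + U \<omega>)) = W" by (simp add: W_def fun_eq_iff)
  with sum_second_moment[OF XYU X2(1,2) yu(1,2)]
  show "integrable M (\<lambda>\<omega>. (W \<omega>)\<^sup>2)" "expectation W = 0" "expectation (\<lambda>\<omega>. (W \<omega>)\<^sup>2) = r\<^sup>2"
    by (simp_all add: W_def add.assoc yu(3) X2 Y2 U2 r(2))
qed

definition "pW = gauss_smoothing (distr M borel (\<lambda>\<omega>. X \<omega> + Y \<omega>)) s"

lemma pW: "distributed M lborel W (\<lambda>x. ennreal (pW x))" "0 \<le> pW x" "pW \<in> borel_measurable borel"
proof -
  interpret XY: real_distribution "distr M borel (\<lambda>\<omega>. X \<omega> + Y \<omega>)"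
    by (rule real_distribution_distr) simp
  have "indep_var borel (\<lambda>\<omega>. X \<omega> + Y \<omega>) borel U"
    using indep_pair(3)[of "\<lambda>p. fst p + snd p"] by simp
  from distributed_add_normal[OF this U[folded s_def] s(1)]
  show "distributed M lborel W (\<lambda>x. ennreal (pW x))" by (simp add: W_def[abs_def] pW_def)
  show "0 \<le> pW x" unfolding pW_def by (rule XY.gauss_smoothing_nonneg)
  show "pW \<in> borel_measurable borel" unfolding pW_def by (rule XY.measurable_gauss_smoothing)
qed

lemma entropic_distance_W: "entropic_distance M W = relative_entropy pW (normal_density 0 r)"
  by (rule entropic_distance_eq_relative_entropy[OF pW]) (use W_moments r(1) in auto)

lemma U': "distributed M lborel U (\<lambda>x. ennreal (normal_density 0 s x))"
  using U by (simp add: s_def)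

lemma mgf_U: "integrable M (\<lambda>\<omega>. exp (z * complex_of_real (U \<omega>)))"
  "expectation (\<lambda>\<omega>. exp (z * complex_of_real (U \<omega>))) = exp (z\<^sup>2 * of_real (\<sigma>\<^sup>2))"
proof -
  note e = expectation_distributed[OF U' normal_density_nonneg, of "\<lambda>x. exp (z * complex_of_real x)"]
  show "integrable M (\<lambda>\<omega>. exp (z * complex_of_real (U \<omega>)))"
    using e(2) complex_mgf_normal_density(1)[OF s(1), of z] by simp
  show "expectation (\<lambda>\<omega>. exp (z * complex_of_real (U \<omega>))) = exp (z\<^sup>2 * of_real (\<sigma>\<^sup>2))"
    using e(1) complex_mgf_normal_density(2)[OF s(1), of z] by (simp add: s(2))
qed

context
  fixes T :: real
  assumes T: "1 \<le> T" and close: "entropic_distance M W \<le> ereal (exp (- 4000 * T\<^sup>2))"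
begin

text \<open>
  \<open>b\<close> is the accuracy for bounded test functions, \<open>N\<close> the level of truncation and \<open>R\<close> the cut-off of the
  exponentials. The constants have to satisfy two conditions: \<open>R\<close> exceeds \<open>4 N\<close> by enough to make the
  exponential moments beyond the cut-off negligible, and \<open>b exp (T R)\<close> is still exponentially small.
\<close>

definition "b = exp (- 2000 * T\<^sup>2)"
definition "N = 200 * T"
definition "R = 820 * T"

lemma T2: "1 \<le> T\<^sup>2" using T by simp

lemma W_close:
  assumes h: "h \<in> borel_measurable borel" "\<And>x. cmod (h x) \<le> B"
  shows "cmod (expectation (\<lambda>\<omega>. h (W \<omega>)) - (\<integral>x. normal_density 0 r x *\<^sub>R h x \<partial>lborel)) \<le> 2 * b * B"
proof (rule expectation_close_of_relative_entropy[OF pW r(1) _ _ h])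
  have "b\<^sup>2 = exp (- 4000 * T\<^sup>2)" unfolding b_def by (simp add: power2_eq_square flip: exp_add)
  thus "relative_entropy pW (normal_density 0 r) \<le> ereal (b\<^sup>2)" using close by (simp add: entropic_distance_W)
qed (simp add: b_def)

lemma exp_le_b: "2 * exp (- (197 * T)\<^sup>2 / 8) \<le> 2 * b"
  unfolding b_def using T2 by (simp add: power_mult_distrib)

lemma W_tail: "expectation (\<lambda>\<omega>. tail_indicator (197 * T) (W \<omega>)) \<le> 4 * b"
proof -
  let ?h = "\<lambda>x. complex_of_real (tail_indicator (197 * T) x)"
  have "cmod (expectation (\<lambda>\<omega>. ?h (W \<omega>)) - (\<integral>x. normal_density 0 r x *\<^sub>R ?h x \<partial>lborel)) \<le> 2 * b * 1"
    by (rule W_close) (use tail_indicator_bounds in auto)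
  also have "expectation (\<lambda>\<omega>. ?h (W \<omega>)) - (\<integral>x. normal_density 0 r x *\<^sub>R ?h x \<partial>lborel)
     = of_real (expectation (\<lambda>\<omega>. tail_indicator (197 * T) (W \<omega>)) - (\<integral>x. normal_density 0 r x * tail_indicator (197 * T) x \<partial>lborel))"
    by (simp add: scaleR_conv_of_real flip: of_real_mult)
  finally have "\<bar>expectation (\<lambda>\<omega>. tail_indicator (197 * T) (W \<omega>)) - (\<integral>x. normal_density 0 r x * tail_indicator (197 * T) x \<partial>lborel)\<bar> \<le> 2 * b"
    by (simp only: norm_of_real mult_1_right)
  moreover have "(\<integral>x. normal_density 0 r x * tail_indicator (197 * T) x \<partial>lborel) \<le> 2 * exp (- (197 * T)\<^sup>2 / 8)"
    unfolding tail_indicator_def using T by (intro normal_density_tail r) auto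
  ultimately show ?thesis using exp_le_b by linarith
qed

text \<open>
  If \<open>A\<close> is large while the independent remainder \<open>Q\<close> is at most \<open>3\<close> in modulus, which has probability
  at least \<open>2/3\<close>, then \<open>W\<close> is large. So the tail of \<open>A\<close> is controlled by that of \<open>W\<close>.
\<close>

lemma tail_of_summand:
  assumes ind: "indep_var borel A borel Q" and W: "\<And>\<omega>. W \<omega> = A \<omega> + Q \<omega>"
    and Q: "integrable M (\<lambda>\<omega>. (Q \<omega>)\<^sup>2)" "expectation (\<lambda>\<omega>. (Q \<omega>)\<^sup>2) = 1 + 2 * \<sigma>\<^sup>2"
  shows "expectation (\<lambda>\<omega>. tail_indicator N (A \<omega>)) \<le> 6 * b"
proof -
  have [measurable]: "random_variable borel A" "random_variable borel Q"
    using indep_var_rv1[OF ind] indep_var_rv2[OF ind] .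
  let ?g = "\<lambda>q. 1 - tail_indicator 3 q"
  have bi: "integrable M (\<lambda>\<omega>. f (V \<omega>))" if [measurable]: "random_variable borel V" "f \<in> borel_measurable borel"
    and "\<And>x. 0 \<le> f x" "\<And>x. f x \<le> 1" for f :: "real \<Rightarrow> real" and V :: "'a \<Rightarrow> real"
    by (rule integrable_const_bound[where B = 1]) (use that in auto)
  have iA: "integrable M (\<lambda>\<omega>. tail_indicator N (A \<omega>))" and iQ: "integrable M (\<lambda>\<omega>. ?g (Q \<omega>))"
    and iW: "integrable M (\<lambda>\<omega>. tail_indicator (197 * T) (W \<omega>))"
    by (intro bi; use tail_indicator_bounds in simp)+
  have ind': "indep_var borel (\<lambda>\<omega>. tail_indicator N (A \<omega>)) borel (\<lambda>\<omega>. ?g (Q \<omega>))"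
    using indep_var_compose[OF ind, of "tail_indicator N" borel ?g borel] by (simp add: comp_def)
  have "2 / 3 \<le> expectation (\<lambda>\<omega>. ?g (Q \<omega>))"
  proof -
    have "2 / 3 \<le> 1 - (1 + 2 * \<sigma>\<^sup>2) / 9" using \<sigma> by (simp add: power_le_one)
    also have "\<dots> = expectation (\<lambda>\<omega>. 1 - (Q \<omega>)\<^sup>2 / 9)" using Q by (simp add: prob_space)
    also have "\<dots> \<le> expectation (\<lambda>\<omega>. ?g (Q \<omega>))"
    proof (rule Bochner_Integration.integral_mono)
      fix \<omega>
      show "1 - (Q \<omega>)\<^sup>2 / 9 \<le> ?g (Q \<omega>)"
      proof (cases "3 < \<bar>Q \<omega>\<bar>")
        case True
        hence "3\<^sup>2 \<le> \<bar>Q \<omega>\<bar>\<^sup>2" by (intro power_mono) auto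
        thus ?thesis using True by (simp add: tail_indicator_def)
      qed (simp add: tail_indicator_def)
    qed (use Q iQ in auto)
    finally show ?thesis .
  qed
  hence "expectation (\<lambda>\<omega>. tail_indicator N (A \<omega>)) * (2 / 3) \<le> expectation (\<lambda>\<omega>. tail_indicator N (A \<omega>)) * expectation (\<lambda>\<omega>. ?g (Q \<omega>))"
    using tail_indicator_bounds by (intro mult_left_mono integral_nonneg_AE) auto
  also have "\<dots> = expectation (\<lambda>\<omega>. tail_indicator N (A \<omega>) * ?g (Q \<omega>))"
    by (rule indep_var_lebesgue_integral[OF ind' iA iQ, symmetric])
  also have "\<dots> \<le> expectation (\<lambda>\<omega>. tail_indicator (197 * T) (W \<omega>))"
  proof (rule Bochner_Integration.integral_mono[OF indep_var_integrable[OF ind' iA iQ] iW])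
    fix \<omega>
    show "tail_indicator N (A \<omega>) * ?g (Q \<omega>) \<le> tail_indicator (197 * T) (W \<omega>)"
      using T by (auto simp: tail_indicator_def indicator_def N_def W)
  qed
  also note W_tail
  finally show ?thesis by simp
qed

lemma tail_X: "expectation (\<lambda>\<omega>. tail_indicator N (X \<omega>)) \<le> 6 * b"
  by (rule tail_of_summand[OF _ _ YU_moments])
     (use indep_pair(1)[of "\<lambda>p. fst p + snd p"] in \<open>simp_all add: W_def\<close>)

lemma tail_Y: "expectation (\<lambda>\<omega>. tail_indicator N (Y \<omega>)) \<le> 6 * b"
  by (rule tail_of_summand[OF _ _ XU_moments])
     (use indep_pair(2)[of "\<lambda>p. fst p + snd p"] in \<open>simp_all add: W_def\<close>)

definition "Xt \<omega> = trunc N (X \<omega>)"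
definition "Yt \<omega> = trunc N (Y \<omega>)"
definition "Wt \<omega> = Xt \<omega> + Yt \<omega> + U \<omega>"

lemma measurable_trunc_rv [measurable]: "random_variable borel Xt" "random_variable borel Yt" "random_variable borel Wt"
  unfolding Xt_def[abs_def] Yt_def[abs_def] Wt_def[abs_def] by measurable

lemma N0: "0 \<le> N" using T by (simp add: N_def)

lemma abs_truncated_le: "\<bar>Xt \<omega>\<bar> \<le> N" "\<bar>Yt \<omega>\<bar> \<le> N"
  unfolding Xt_def Yt_def using N0 by (auto intro: abs_trunc_le)

lemma cmod_exp_le: "cmod z \<le> T \<Longrightarrow> cmod (exp (z * complex_of_real x)) \<le> exp (T * \<bar>x\<bar>)"
proof -
  assume "cmod z \<le> T"
  have "Re z * x \<le> \<bar>Re z\<bar> * \<bar>x\<bar>" by (metis abs_ge_self abs_mult)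
  also have "\<dots> \<le> T * \<bar>x\<bar>" using abs_Re_le_cmod[of z] \<open>cmod z \<le> T\<close> by (intro mult_right_mono) auto
  finally show ?thesis by simp
qed

lemma tail_exp_le: "tail_indicator R x * exp (T * \<bar>x\<bar>) \<le> exp (- T * R) * exp (2 * T * \<bar>x\<bar>)"
proof (cases "R < \<bar>x\<bar>")
  case True
  hence "T * R \<le> T * \<bar>x\<bar>" using T by (intro mult_left_mono) auto
  hence "T * \<bar>x\<bar> \<le> - T * R + 2 * T * \<bar>x\<bar>" by simp
  hence "exp (T * \<bar>x\<bar>) \<le> exp (- T * R) * exp (2 * T * \<bar>x\<bar>)" by (simp only: exp_add[symmetric] exp_le_cancel_iff)
  thus ?thesis using True by (simp add: tail_indicator_def)
qed (simp add: tail_indicator_def)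

text \<open>
  The exponential, cut off where its modulus is no longer controlled, in order to have a bounded test
  function.
\<close>

definition "hR z x = (1 - tail_indicator R x) *\<^sub>R exp (z * complex_of_real x)"

lemma measurable_hR [measurable]: "hR z \<in> borel_measurable borel"
  unfolding hR_def[abs_def] by measurable

lemma hR_le: assumes z: "cmod z \<le> T" shows "cmod (hR z x) \<le> exp (T * R)"
proof (cases "\<bar>x\<bar> \<le> R")
  case True
  hence "T * \<bar>x\<bar> \<le> T * R" using T by (intro mult_left_mono) auto
  hence "exp (T * \<bar>x\<bar>) \<le> exp (T * R)" by simp
  thus ?thesis using cmod_exp_le[OF z, of x] True by (simp add: hR_def tail_indicator_def)
qed (simp add: hR_def tail_indicator_def)

lemma hR_diff: assumes z: "cmod z \<le> T"
  shows "cmod (exp (z * complex_of_real x) - hR z x) \<le> exp (- T * R) * exp (2 * T * \<bar>x\<bar>)"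
proof -
  have "exp (z * complex_of_real x) - hR z x = tail_indicator R x *\<^sub>R exp (z * complex_of_real x)"
    by (simp add: hR_def scaleR_diff_left)
  also have "cmod \<dots> \<le> tail_indicator R x * exp (T * \<bar>x\<bar>)"
    using cmod_exp_le[OF z, of x] tail_indicator_bounds(1)[of R x] by (simp add: mult_left_mono)
  also note tail_exp_le
  finally show ?thesis .
qed

text \<open>
  Here \<open>W\<close> is replaced by the sum of the truncated variables.
\<close>

lemma hR_step_W: assumes z: "cmod z \<le> T"
  shows "cmod (expectation (\<lambda>\<omega>. hR z (W \<omega>)) - expectation (\<lambda>\<omega>. hR z (Wt \<omega>))) \<le> 24 * b * exp (T * R)"
proof -
  have i: "integrable M (\<lambda>\<omega>. hR z (V \<omega>))" if [measurable]: "random_variable borel V" for V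
    by (rule integrable_const_bound[where B = "exp (T * R)"]) (use hR_le[OF z] in auto)
  have it: "integrable M (\<lambda>\<omega>. tail_indicator N (V \<omega>))" if [measurable]: "random_variable borel V" for V
    by (rule integrable_const_bound[where B = 1]) (use tail_indicator_bounds in auto)
  have "expectation (\<lambda>\<omega>. hR z (W \<omega>)) - expectation (\<lambda>\<omega>. hR z (Wt \<omega>)) = expectation (\<lambda>\<omega>. hR z (W \<omega>) - hR z (Wt \<omega>))"
    by (rule Bochner_Integration.integral_diff[symmetric]) (intro i; measurable)+
  also have "cmod \<dots> \<le> expectation (\<lambda>\<omega>. 2 * exp (T * R) * (tail_indicator N (X \<omega>) + tail_indicator N (Y \<omega>)))"
  proof (rule norm_integral_le_integral)
    show "integrable M (\<lambda>\<omega>. hR z (W \<omega>) - hR z (Wt \<omega>))"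
      by (rule Bochner_Integration.integrable_diff) (intro i; measurable)+
    show "integrable M (\<lambda>\<omega>. 2 * exp (T * R) * (tail_indicator N (X \<omega>) + tail_indicator N (Y \<omega>)))"
      by (intro integrable_mult_right Bochner_Integration.integrable_add it rv)
    fix \<omega>
    show "norm (hR z (W \<omega>) - hR z (Wt \<omega>)) \<le> 2 * exp (T * R) * (tail_indicator N (X \<omega>) + tail_indicator N (Y \<omega>))"
    proof (cases "W \<omega> = Wt \<omega>")
      case True
      thus ?thesis using tail_indicator_bounds(1) by (auto intro!: mult_nonneg_nonneg add_nonneg_nonneg)
    next
      case False
      hence "trunc N (X \<omega>) \<noteq> X \<omega> \<or> trunc N (Y \<omega>) \<noteq> Y \<omega>" by (auto simp: W_def Wt_def Xt_def Yt_def)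
      hence "1 \<le> tail_indicator N (X \<omega>) + tail_indicator N (Y \<omega>)"
        using trunc_ne[of N "X \<omega>"] trunc_ne[of N "Y \<omega>"] tail_indicator_bounds(1)[of N "X \<omega>"]
          tail_indicator_bounds(1)[of N "Y \<omega>"] by auto
      hence "2 * exp (T * R) * 1 \<le> 2 * exp (T * R) * (tail_indicator N (X \<omega>) + tail_indicator N (Y \<omega>))"
        by (intro mult_left_mono) auto
      moreover have "norm (hR z (W \<omega>) - hR z (Wt \<omega>)) \<le> 2 * exp (T * R)"
        using norm_triangle_ineq4[of "hR z (W \<omega>)" "hR z (Wt \<omega>)"] hR_le[OF z, of "W \<omega>"] hR_le[OF z, of "Wt \<omega>"] by linarith
      ultimately show ?thesis by linarith
    qed
  qed
  also have "\<dots> = 2 * exp (T * R) * (expectation (\<lambda>\<omega>. tail_indicator N (X \<omega>)) + expectation (\<lambda>\<omega>. tail_indicator N (Y \<omega>)))"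
    using it[OF rv(1)] it[OF rv(2)] by simp
  also have "\<dots> \<le> 2 * exp (T * R) * (6 * b + 6 * b)"
    by (intro mult_left_mono add_mono tail_X tail_Y) auto
  finally show ?thesis by (simp add: mult_ac)
qed

lemma mgf_Wt:
  "integrable M (\<lambda>\<omega>. exp (z * complex_of_real (Wt \<omega>)))"
  "expectation (\<lambda>\<omega>. exp (z * complex_of_real (Wt \<omega>)))
    = expectation (\<lambda>\<omega>. exp (z * complex_of_real (Xt \<omega>))) * expectation (\<lambda>\<omega>. exp (z * complex_of_real (Yt \<omega>))) * exp (z\<^sup>2 * of_real (\<sigma>\<^sup>2))"
proof -
  let ?f = "\<lambda>x. exp (z * complex_of_real (trunc N x))"
  have i: "integrable M (\<lambda>\<omega>. ?f (V \<omega>))" if [measurable]: "random_variable borel V" for V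
  proof (rule integrable_const_bound[where B = "exp (cmod z * N)"])
    have "Re z * trunc N x \<le> cmod z * N" for x
    proof -
      have "Re z * trunc N x \<le> \<bar>Re z\<bar> * \<bar>trunc N x\<bar>" by (metis abs_ge_self abs_mult)
      also have "\<dots> \<le> cmod z * N" using abs_Re_le_cmod[of z] abs_trunc_le[OF N0] by (intro mult_mono) auto
      finally show ?thesis .
    qed
    thus "AE \<omega> in M. norm (?f (V \<omega>)) \<le> exp (cmod z * N)" by simp
  qed measurable
  note p = expectation_prod3[OF _ _ _ i[OF rv(1)] i[OF rv(2)] mgf_U(1)[of z]]
  have eq: "exp (z * complex_of_real (Wt \<omega>)) = ?f (X \<omega>) * ?f (Y \<omega>) * exp (z * complex_of_real (U \<omega>))" for \<omega>
    by (simp add: Wt_def Xt_def Yt_def distrib_left exp_add)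
  show "integrable M (\<lambda>\<omega>. exp (z * complex_of_real (Wt \<omega>)))" unfolding eq by (rule p(1)) measurable
  show "expectation (\<lambda>\<omega>. exp (z * complex_of_real (Wt \<omega>)))
    = expectation (\<lambda>\<omega>. exp (z * complex_of_real (Xt \<omega>))) * expectation (\<lambda>\<omega>. exp (z * complex_of_real (Yt \<omega>))) * exp (z\<^sup>2 * of_real (\<sigma>\<^sup>2))"
    unfolding eq Xt_def Yt_def mgf_U(2)[symmetric] by (rule p(2)) measurable
qed

text \<open>
  The cut-off is removed for the truncated sum: its exponential moments of order \<open>2 T\<close> are at most
  \<open>exp (4 T N)\<close> times those of \<open>U\<close>, and \<open>R\<close> exceeds \<open>4 N\<close>.
\<close>

lemma hR_step_Wt: assumes z: "cmod z \<le> T"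
  shows "cmod (expectation (\<lambda>\<omega>. exp (z * complex_of_real (Wt \<omega>))) - expectation (\<lambda>\<omega>. hR z (Wt \<omega>))) \<le> 2 * exp (- 16 * T\<^sup>2)"
proof -
  have i: "integrable M (\<lambda>\<omega>. hR z (Wt \<omega>))"
    by (rule integrable_const_bound[where B = "exp (T * R)"]) (use hR_le[OF z] in auto)
  have iU: "integrable M (\<lambda>\<omega>. exp (2 * T * \<bar>U \<omega>\<bar>))"
    by (subst expectation_distributed(2)[OF U', of "\<lambda>u. exp (2 * T * \<bar>u\<bar>)"]) (use exp_abs_moment_normal_density(1)[OF s(1), of "2 * T"] in auto)
  have eU: "expectation (\<lambda>\<omega>. exp (2 * T * \<bar>U \<omega>\<bar>)) \<le> 2 * exp (4 * T\<^sup>2)"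
  proof -
    have "expectation (\<lambda>\<omega>. exp (2 * T * \<bar>U \<omega>\<bar>)) = (\<integral>u. normal_density 0 s u * exp (2 * T * \<bar>u\<bar>) \<partial>lborel)"
      by (subst expectation_distributed(1)[OF U', of "\<lambda>u. exp (2 * T * \<bar>u\<bar>)"]) auto
    also have "\<dots> \<le> 2 * exp ((2 * T)\<^sup>2 * s\<^sup>2 / 2)" by (rule exp_abs_moment_normal_density(2)[OF s(1)])
    also have "\<dots> \<le> 2 * exp (4 * T\<^sup>2)"
    proof -
      have "(2 * T)\<^sup>2 * s\<^sup>2 \<le> (2 * T)\<^sup>2 * 2" using s(3) by (intro mult_left_mono) auto
      thus ?thesis by (simp add: power_mult_distrib)
    qed
    finally show ?thesis .
  qed
  have diff: "expectation (\<lambda>\<omega>. exp (z * complex_of_real (Wt \<omega>))) - expectation (\<lambda>\<omega>. hR z (Wt \<omega>))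
      = expectation (\<lambda>\<omega>. exp (z * complex_of_real (Wt \<omega>)) - hR z (Wt \<omega>))"
    by (rule Bochner_Integration.integral_diff[symmetric, OF mgf_Wt(1) i])
  define k where "k = exp (- T * R) * exp (4 * T * N)"
  have pt: "norm (exp (z * complex_of_real (Wt \<omega>)) - hR z (Wt \<omega>)) \<le> k * exp (2 * T * \<bar>U \<omega>\<bar>)" for \<omega>
  proof -
    have "\<bar>Wt \<omega>\<bar> \<le> 2 * N + \<bar>U \<omega>\<bar>" using abs_truncated_le[of \<omega>] by (simp add: Wt_def)
    hence "2 * T * \<bar>Wt \<omega>\<bar> \<le> 2 * T * (2 * N + \<bar>U \<omega>\<bar>)" using T by (intro mult_left_mono) auto
    hence "2 * T * \<bar>Wt \<omega>\<bar> \<le> 4 * T * N + 2 * T * \<bar>U \<omega>\<bar>" by (simp add: distrib_left)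
    hence "exp (2 * T * \<bar>Wt \<omega>\<bar>) \<le> exp (4 * T * N) * exp (2 * T * \<bar>U \<omega>\<bar>)"
      by (simp only: exp_add[symmetric] exp_le_cancel_iff)
    hence "exp (- T * R) * exp (2 * T * \<bar>Wt \<omega>\<bar>) \<le> exp (- T * R) * (exp (4 * T * N) * exp (2 * T * \<bar>U \<omega>\<bar>))"
      by (rule mult_left_mono) simp
    hence "exp (- T * R) * exp (2 * T * \<bar>Wt \<omega>\<bar>) \<le> k * exp (2 * T * \<bar>U \<omega>\<bar>)"
      unfolding k_def mult.assoc .
    with hR_diff[OF z, of "Wt \<omega>"] show ?thesis by (rule order_trans)
  qed
  have "cmod (expectation (\<lambda>\<omega>. exp (z * complex_of_real (Wt \<omega>)) - hR z (Wt \<omega>))) \<le> expectation (\<lambda>\<omega>. k * exp (2 * T * \<bar>U \<omega>\<bar>))"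
    by (rule norm_integral_le_integral[OF Bochner_Integration.integrable_diff[OF mgf_Wt(1) i] integrable_mult_right[OF iU] pt])
  moreover have "expectation (\<lambda>\<omega>. k * exp (2 * T * \<bar>U \<omega>\<bar>)) = k * expectation (\<lambda>\<omega>. exp (2 * T * \<bar>U \<omega>\<bar>))"
    by (rule integral_mult_right_zero)
  moreover have "k * expectation (\<lambda>\<omega>. exp (2 * T * \<bar>U \<omega>\<bar>)) \<le> k * (2 * exp (4 * T\<^sup>2))"
    by (rule mult_left_mono[OF eU]) (simp add: k_def)
  moreover have "k * (2 * exp (4 * T\<^sup>2)) = 2 * exp (- 16 * T\<^sup>2)"
  proof -
    have "exp p * exp q * (2 * exp l) = 2 * exp (p + q + l)" for p q l :: real by (simp add: exp_add)
    moreover have "- T * R + 4 * T * N + 4 * T\<^sup>2 = - 16 * T\<^sup>2" by (simp add: R_def N_def power2_eq_square)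
    ultimately show ?thesis unfolding k_def by (simp only:)
  qed
  ultimately show ?thesis unfolding diff by linarith
qed

lemma hR_step_normal: assumes z: "cmod z \<le> T"
  shows "cmod (exp (z\<^sup>2 * of_real (1 + \<sigma>\<^sup>2)) - (\<integral>x. normal_density 0 r x *\<^sub>R hR z x \<partial>lborel)) \<le> 2 * exp (- 16 * T\<^sup>2)"
proof -
  note i1 = complex_mgf_normal_density(1)[OF r(1), of z]
  have e1: "(\<integral>x. normal_density 0 r x *\<^sub>R exp (z * complex_of_real x) \<partial>lborel) = exp (z\<^sup>2 * of_real (1 + \<sigma>\<^sup>2))"
  proof -
    have "z\<^sup>2 * of_real (2 + 2 * \<sigma>\<^sup>2) / 2 = z\<^sup>2 * of_real (1 + \<sigma>\<^sup>2)"
      by (simp add: algebra_simps add_divide_distrib)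
    thus ?thesis unfolding complex_mgf_normal_density(2)[OF r(1), of z] r(2) by (simp only:)
  qed
  have i2: "integrable lborel (\<lambda>x. normal_density 0 r x *\<^sub>R hR z x)"
  proof (rule Bochner_Integration.integrable_bound)
    show "integrable lborel (\<lambda>x. exp (T * R) * normal_density 0 r x)" using r(1) by simp
    show "AE x in lborel. norm (normal_density 0 r x *\<^sub>R hR z x) \<le> norm (exp (T * R) * normal_density 0 r x)"
      using hR_le[OF z] by (intro always_eventually allI) (auto simp: abs_mult mult.commute[of "exp (T * R)"] intro!: mult_left_mono)
  qed measurable
  have "exp (z\<^sup>2 * of_real (1 + \<sigma>\<^sup>2)) - (\<integral>x. normal_density 0 r x *\<^sub>R hR z x \<partial>lborel)
     = (\<integral>x. normal_density 0 r x *\<^sub>R (exp (z * complex_of_real x) - hR z x) \<partial>lborel)"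
    unfolding e1[symmetric] scaleR_diff_right using i1 i2 by simp
  also have "cmod \<dots> \<le> (\<integral>x. exp (- T * R) * (normal_density 0 r x * exp (2 * T * \<bar>x\<bar>)) \<partial>lborel)"
  proof (rule norm_integral_le_integral)
    show "integrable lborel (\<lambda>x. normal_density 0 r x *\<^sub>R (exp (z * complex_of_real x) - hR z x))"
      unfolding scaleR_diff_right using i1 i2 by simp
    show "integrable lborel (\<lambda>x. exp (- T * R) * (normal_density 0 r x * exp (2 * T * \<bar>x\<bar>)))"
      by (intro integrable_mult_right exp_abs_moment_normal_density r)
    fix x
    have "normal_density 0 r x * cmod (exp (z * complex_of_real x) - hR z x) \<le> normal_density 0 r x * (exp (- T * R) * exp (2 * T * \<bar>x\<bar>))"
      by (intro mult_left_mono hR_diff z) auto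
    thus "norm (normal_density 0 r x *\<^sub>R (exp (z * complex_of_real x) - hR z x)) \<le> exp (- T * R) * (normal_density 0 r x * exp (2 * T * \<bar>x\<bar>))"
      by (simp only: norm_scaleR real_norm_def abs_of_nonneg normal_density_nonneg mult.left_commute)
  qed
  also have "\<dots> = exp (- T * R) * (\<integral>x. normal_density 0 r x * exp (2 * T * \<bar>x\<bar>) \<partial>lborel)"
    by (rule integral_mult_right_zero)
  also have "\<dots> \<le> exp (- T * R) * (2 * exp ((2 * T)\<^sup>2 * r\<^sup>2 / 2))"
    by (intro mult_left_mono exp_abs_moment_normal_density r) auto
  also have "\<dots> = 2 * exp (- T * R + (2 * T)\<^sup>2 * r\<^sup>2 / 2)" by (subst exp_add) (simp only: mult_ac)
  also have "\<dots> \<le> 2 * exp (- 16 * T\<^sup>2)"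
  proof -
    have "(2 * T)\<^sup>2 * r\<^sup>2 \<le> (2 * T)\<^sup>2 * 4" using r(3) by (intro mult_left_mono) auto
    hence "- T * R + (2 * T)\<^sup>2 * r\<^sup>2 / 2 \<le> - 820 * T\<^sup>2 + 8 * T\<^sup>2"
      by (simp add: R_def power2_eq_square)
    also have "\<dots> \<le> - 16 * T\<^sup>2" using T2 by linarith
    finally show ?thesis by simp
  qed
  finally show ?thesis .
qed

text \<open>
  The comparison runs through the cut-off exponentials: from the truncated sum to \<open>W\<close>, from \<open>W\<close>
  to the normal law with the same variance, and back to the uncut exponential. Finally, the factor
  coming from \<open>U\<close> is divided out; its modulus is at least \<open>exp (- T\<^sup>2)\<close>.
\<close>

lemma mgf_product_close: assumes z: "cmod z \<le> T"
  shows "cmod (expectation (\<lambda>\<omega>. exp (z * complex_of_real (Xt \<omega>))) * expectation (\<lambda>\<omega>. exp (z * complex_of_real (Yt \<omega>))) - exp (z\<^sup>2)) \<le> exp (- 2 * T\<^sup>2)"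
proof -
  define F where "F = expectation (\<lambda>\<omega>. exp (z * complex_of_real (Xt \<omega>))) * expectation (\<lambda>\<omega>. exp (z * complex_of_real (Yt \<omega>)))"
  \<comment> \<open>the expectation for \<open>U\<close>\<close>
  define e where "e = exp (z\<^sup>2 * of_real (\<sigma>\<^sup>2))"
  define \<alpha> where "\<alpha> = expectation (\<lambda>\<omega>. hR z (Wt \<omega>))"
  define \<beta> where "\<beta> = expectation (\<lambda>\<omega>. hR z (W \<omega>))"
  define \<gamma> where "\<gamma> = (\<integral>x. normal_density 0 r x *\<^sub>R hR z x \<partial>lborel)"
  have "cmod (F * e - exp (z\<^sup>2 * of_real (1 + \<sigma>\<^sup>2))) \<le> cmod (F * e - \<alpha>) + cmod (\<beta> - \<alpha>) + cmod (\<beta> - \<gamma>) + cmod (exp (z\<^sup>2 * of_real (1 + \<sigma>\<^sup>2)) - \<gamma>)"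
  proof -
    have "F * e - exp (z\<^sup>2 * of_real (1 + \<sigma>\<^sup>2)) = (F * e - \<alpha>) - (\<beta> - \<alpha>) + (\<beta> - \<gamma>) - (exp (z\<^sup>2 * of_real (1 + \<sigma>\<^sup>2)) - \<gamma>)" by simp
    moreover have "cmod (p - q + u - v) \<le> cmod p + cmod q + cmod u + cmod v" for p q u v
      using norm_triangle_ineq4[of "p - q + u" v] norm_triangle_ineq[of "p - q" u] norm_triangle_ineq4[of p q] by linarith
    ultimately show ?thesis by metis
  qed
  also have "cmod (F * e - \<alpha>) \<le> 2 * exp (- 16 * T\<^sup>2)"
    using hR_step_Wt[OF z] by (simp add: mgf_Wt(2) F_def e_def \<alpha>_def)
  also have "cmod (\<beta> - \<alpha>) \<le> 24 * b * exp (T * R)" using hR_step_W[OF z] by (simp add: \<alpha>_def \<beta>_def)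
  also have "cmod (\<beta> - \<gamma>) \<le> 2 * b * exp (T * R)"
    unfolding \<beta>_def \<gamma>_def by (rule W_close[OF measurable_hR hR_le[OF z]])
  also have "cmod (exp (z\<^sup>2 * of_real (1 + \<sigma>\<^sup>2)) - \<gamma>) \<le> 2 * exp (- 16 * T\<^sup>2)"
    unfolding \<gamma>_def by (rule hR_step_normal[OF z])
  also have "2 * exp (- 16 * T\<^sup>2) + 24 * b * exp (T * R) + 2 * b * exp (T * R) + 2 * exp (- 16 * T\<^sup>2) \<le> 30 * exp (- 16 * T\<^sup>2)"
  proof -
    have "b * exp (T * R) = exp (- 1180 * T\<^sup>2)" by (simp add: b_def R_def power2_eq_square flip: exp_add)
    also have "\<dots> \<le> exp (- 16 * T\<^sup>2)" using T2 by simp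
    finally show ?thesis by simp
  qed
  finally have main: "cmod (F * e - exp (z\<^sup>2 * of_real (1 + \<sigma>\<^sup>2))) \<le> 30 * exp (- 16 * T\<^sup>2)" by simp
  have "exp (z\<^sup>2 * of_real (1 + \<sigma>\<^sup>2)) = exp (z\<^sup>2) * e" by (simp add: e_def distrib_left flip: exp_add)
  hence "F - exp (z\<^sup>2) = (F * e - exp (z\<^sup>2 * of_real (1 + \<sigma>\<^sup>2))) * inverse e"
    by (simp add: e_def field_simps)
  hence "cmod (F - exp (z\<^sup>2)) = cmod (F * e - exp (z\<^sup>2 * of_real (1 + \<sigma>\<^sup>2))) * cmod (inverse e)"
    by (simp only: norm_mult)
  also have "\<dots> \<le> (30 * exp (- 16 * T\<^sup>2)) * exp (T\<^sup>2)"
  proof (intro mult_mono main)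
    have "\<bar>Re (z\<^sup>2 * of_real (\<sigma>\<^sup>2))\<bar> \<le> cmod (z\<^sup>2 * of_real (\<sigma>\<^sup>2))" by (rule abs_Re_le_cmod)
    also have "\<dots> = (cmod z)\<^sup>2 * \<sigma>\<^sup>2" by (simp add: norm_mult norm_power)
    also have "\<dots> \<le> T\<^sup>2 * 1" using z \<sigma> by (intro mult_mono power_mono power_le_one) auto
    finally have "- Re (z\<^sup>2 * of_real (\<sigma>\<^sup>2)) \<le> T\<^sup>2" by linarith
    moreover have "inverse e = exp (- (z\<^sup>2 * of_real (\<sigma>\<^sup>2)))" by (simp add: e_def exp_minus)
    ultimately show "cmod (inverse e) \<le> exp (T\<^sup>2)" by simp
  qed auto
  also have "\<dots> = 30 * exp (- 15 * T\<^sup>2)" by (simp flip: exp_add)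
  also have "\<dots> \<le> exp (13 * T\<^sup>2) * exp (- 15 * T\<^sup>2)"
  proof (rule mult_right_mono)
    have "30 \<le> 1 + 13 + (13::real)\<^sup>2 / 2" by simp
    also have "\<dots> \<le> exp 13" by (rule exp_lower_Taylor_quadratic) simp
    also have "\<dots> \<le> exp (13 * T\<^sup>2)" using T2 by simp
    finally show "30 \<le> exp (13 * T\<^sup>2)" .
  qed simp
  also have "\<dots> = exp (- 2 * T\<^sup>2)" by (simp flip: exp_add)
  finally show ?thesis by (simp add: F_def)
qed

text \<open>
  As the mean of \<open>V\<close> is \<open>0\<close>, the mean of the truncated variable is minus that of the part cut off,
  and the latter is at most \<open>V\<^sup>2 / N\<close> in modulus.
\<close>

lemma trunc_moments:
  assumes [measurable]: "random_variable borel V" and V: "integrable M (\<lambda>\<omega>. (V \<omega>)\<^sup>2)" "expectation V = 0" "expectation (\<lambda>\<omega>. (V \<omega>)\<^sup>2) = 1"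
  shows "expectation (\<lambda>\<omega>. (trunc N (V \<omega>))\<^sup>2) \<le> 1" "\<bar>expectation (\<lambda>\<omega>. trunc N (V \<omega>))\<bar> \<le> 1 / T"
proof -
  have Np: "0 < N" using T by (simp add: N_def)
  have i: "integrable M (\<lambda>\<omega>. trunc N (V \<omega>))"
    by (rule integrable_const_bound[where B = N]) (use abs_trunc_le[OF N0] in auto)
  have iV: "integrable M V" by (rule square_integrable_imp_integrable) (use V in auto)
  have "expectation (\<lambda>\<omega>. (trunc N (V \<omega>))\<^sup>2) \<le> expectation (\<lambda>\<omega>. (V \<omega>)\<^sup>2)"
  proof (rule Bochner_Integration.integral_mono)
    show "integrable M (\<lambda>\<omega>. (trunc N (V \<omega>))\<^sup>2)"
      by (rule Bochner_Integration.integrable_bound[OF V(1)]) (use trunc_sq_le in auto)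
  qed (use V trunc_sq_le in auto)
  thus "expectation (\<lambda>\<omega>. (trunc N (V \<omega>))\<^sup>2) \<le> 1" using V by simp
  have "\<bar>expectation (\<lambda>\<omega>. trunc N (V \<omega>))\<bar> = \<bar>expectation (\<lambda>\<omega>. trunc N (V \<omega>) - V \<omega>)\<bar>" using i iV V by simp
  also have "\<dots> \<le> expectation (\<lambda>\<omega>. \<bar>trunc N (V \<omega>) - V \<omega>\<bar>)" by (rule integral_abs_bound)
  also have "\<dots> \<le> expectation (\<lambda>\<omega>. (V \<omega>)\<^sup>2 / N)"
  proof (rule Bochner_Integration.integral_mono)
    fix \<omega>
    show "\<bar>trunc N (V \<omega>) - V \<omega>\<bar> \<le> (V \<omega>)\<^sup>2 / N"
    proof (cases "\<bar>V \<omega>\<bar> \<le> N")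
      case False
      hence "\<bar>V \<omega>\<bar> * N \<le> \<bar>V \<omega>\<bar> * \<bar>V \<omega>\<bar>" by (intro mult_left_mono) auto
      thus ?thesis using False Np by (simp add: trunc_def power2_eq_square pos_le_divide_eq)
    qed (use Np in \<open>simp add: trunc_def\<close>)
  qed (use i iV V in auto)
  also have "\<dots> = 1 / N" using V by simp
  also have "\<dots> \<le> 1 / T" using T by (simp add: N_def field_simps)
  finally show "\<bar>expectation (\<lambda>\<omega>. trunc N (V \<omega>))\<bar> \<le> 1 / T" .
qed

text \<open>
  The Sapogov estimate for the truncated variables, and the probability that \<open>X\<close> is truncated.
\<close>

lemma char_close: assumes t: "\<bar>t\<bar> \<le> T / 20000"
  shows "cmod (char (distr M borel X) t - char std_normal_distribution t)
    \<le> 2304 * exp 2 / T * ((\<bar>t\<bar> + t\<^sup>2 + \<bar>t\<bar> ^ 3) * exp (- 3 / 8 * t\<^sup>2)) + 1 / T\<^sup>2"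
proof -
  have S: "cmod (expectation (\<lambda>\<omega>. exp (\<i> * t * complex_of_real (Xt \<omega>))) - exp (- (complex_of_real t)\<^sup>2 / 2))
     \<le> 2304 * exp 2 / T * ((\<bar>t\<bar> + t\<^sup>2 + \<bar>t\<bar> ^ 3) * exp (- 3 / 8 * t\<^sup>2))"
    by (rule Sapogov_char_estimate[where V = Yt and N = N])
      (use abs_truncated_le T t mgf_product_close trunc_moments[OF rv(1) X2] trunc_moments[OF rv(2) Y2] in \<open>auto simp: Xt_def[abs_def] Yt_def[abs_def]\<close>)
  have c: "char (distr M borel X) t = expectation (\<lambda>\<omega>. iexp (t * X \<omega>))"
    unfolding char_def by (rule integral_distr) measurable
  have it: "integrable M (\<lambda>\<omega>. iexp (t * V \<omega>))" if [measurable]: "random_variable borel V" for V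
    by (rule integrable_const_bound[where B = 1]) auto
  have "cmod (expectation (\<lambda>\<omega>. iexp (t * X \<omega>)) - expectation (\<lambda>\<omega>. iexp (t * Xt \<omega>))) = cmod (expectation (\<lambda>\<omega>. iexp (t * X \<omega>) - iexp (t * Xt \<omega>)))"
    by (subst Bochner_Integration.integral_diff[OF it it]) auto
  also have "\<dots> \<le> expectation (\<lambda>\<omega>. 2 * tail_indicator N (X \<omega>))"
  proof (rule norm_integral_le_integral)
    show "integrable M (\<lambda>\<omega>. 2 * tail_indicator N (X \<omega>))"
      by (rule integrable_const_bound[where B = 2]) (use tail_indicator_bounds in auto)
    show "integrable M (\<lambda>\<omega>. iexp (t * X \<omega>) - iexp (t * Xt \<omega>))" by (intro Bochner_Integration.integrable_diff it) auto
    fix \<omega>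
    show "norm (iexp (t * X \<omega>) - iexp (t * Xt \<omega>)) \<le> 2 * tail_indicator N (X \<omega>)"
    proof (cases "Xt \<omega> = X \<omega>")
      case True thus ?thesis using tail_indicator_bounds(1) by simp
    next
      case False
      hence "tail_indicator N (X \<omega>) = 1" using trunc_ne[of N "X \<omega>"] by (simp add: Xt_def)
      moreover have "norm (iexp (t * X \<omega>) - iexp (t * Xt \<omega>)) \<le> 1 + 1"
        by (rule order_trans[OF norm_triangle_ineq4]) (simp only: norm_exp_i_times order_refl)
      ultimately show ?thesis by simp
    qed
  qed
  also have "\<dots> \<le> 2 * (6 * b)" using tail_X by simp
  also have "\<dots> \<le> 1 / T\<^sup>2"
  proof -
    have "12 * T\<^sup>2 \<le> 2000 * T\<^sup>2 + 1" by simp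
    also have "\<dots> \<le> exp (2000 * T\<^sup>2)" using exp_ge_add_one_self[of "2000 * T\<^sup>2"] by linarith
    finally have "12 * T\<^sup>2 * b \<le> exp (2000 * T\<^sup>2) * b" unfolding b_def by (intro mult_right_mono) auto
    also have "\<dots> = 1" by (simp add: b_def flip: exp_add)
    finally have "12 * T\<^sup>2 * b \<le> 1" .
    moreover have "2 * (6 * b) * T\<^sup>2 = 12 * T\<^sup>2 * b" by simp
    ultimately have "2 * (6 * b) * T\<^sup>2 \<le> 1" by linarith
    moreover have "0 < T\<^sup>2" using T2 by linarith
    ultimately show ?thesis by (simp only: pos_le_divide_eq)
  qed
  finally have d: "cmod (expectation (\<lambda>\<omega>. iexp (t * X \<omega>)) - expectation (\<lambda>\<omega>. iexp (t * Xt \<omega>))) \<le> 1 / T\<^sup>2" .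
  have e: "exp (- (complex_of_real t)\<^sup>2 / 2) = char std_normal_distribution t"
    unfolding char_std_normal_distribution by (subst exp_of_real[symmetric]) simp
  have f: "exp (\<i> * t * complex_of_real x) = iexp (t * x)" for x
    by (simp only: of_real_mult mult.assoc)
  define \<alpha> where "\<alpha> = expectation (\<lambda>\<omega>. iexp (t * X \<omega>))"
  define \<beta> where "\<beta> = expectation (\<lambda>\<omega>. iexp (t * Xt \<omega>))"
  define \<gamma> where "\<gamma> = char std_normal_distribution t"
  have S': "cmod (\<beta> - \<gamma>) \<le> 2304 * exp 2 / T * ((\<bar>t\<bar> + t\<^sup>2 + \<bar>t\<bar> ^ 3) * exp (- 3 / 8 * t\<^sup>2))"
    using S unfolding f e \<beta>_def \<gamma>_def .
  have d': "cmod (\<alpha> - \<beta>) \<le> 1 / T\<^sup>2" using d unfolding \<alpha>_def \<beta>_def .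
  have "cmod (\<alpha> - \<gamma>) \<le> cmod (\<alpha> - \<beta>) + cmod (\<beta> - \<gamma>)"
    using norm_triangle_ineq[of "\<alpha> - \<beta>" "\<beta> - \<gamma>"] by simp
  hence "cmod (\<alpha> - \<gamma>) \<le> 2304 * exp 2 / T * ((\<bar>t\<bar> + t\<^sup>2 + \<bar>t\<bar> ^ 3) * exp (- 3 / 8 * t\<^sup>2)) + 1 / T\<^sup>2"
    using S' d' by linarith
  thus ?thesis unfolding c \<alpha>_def \<gamma>_def .
qed

end

end

section \<open>Closeness of densities\<close>

text \<open>
  The \<open>L\<^sup>1\<close> norm of the error term in the estimate of the characteristic function.
\<close>

definition taylor_mass :: real where
  "taylor_mass = (\<integral>t. (\<bar>t\<bar> + t\<^sup>2 + \<bar>t\<bar> ^ 3) * exp (- 3 / 8 * t\<^sup>2) \<partial>lborel)"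

lemma integrable_taylor_mass: "integrable lborel (\<lambda>t::real. (\<bar>t\<bar> + t\<^sup>2 + \<bar>t\<bar> ^ 3) * exp (- 3 / 8 * t\<^sup>2))"
proof -
  define s :: real where "s = sqrt (4 / 3)"
  have s: "0 < s" "s\<^sup>2 = 4 / 3" by (simp_all add: s_def)
  define c where "c = sqrt (2 * pi * s\<^sup>2)"
  have c: "0 < c" using s by (simp add: c_def)
  have nd: "c * normal_density 0 s t = exp (- 3 / 8 * t\<^sup>2)" for t :: real
    using c unfolding normal_density_def c_def[symmetric] by (simp add: s(2))
  have i: "integrable lborel (\<lambda>t::real. \<bar>t\<bar> ^ k * exp (- 3 / 8 * t\<^sup>2))" for k
  proof -
    have eq: "\<bar>t\<bar> ^ k * exp (- 3 / 8 * t\<^sup>2) = c * (normal_density 0 s t * \<bar>t - 0\<bar> ^ k)" for t :: real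
      unfolding nd[symmetric] by simp
    show ?thesis unfolding eq by (intro integrable_mult_right integrable_normal_moment_abs s)
  qed
  have "integrable lborel (\<lambda>t::real. \<bar>t\<bar> ^ 1 * exp (- 3 / 8 * t\<^sup>2) + \<bar>t\<bar> ^ 2 * exp (- 3 / 8 * t\<^sup>2) + \<bar>t\<bar> ^ 3 * exp (- 3 / 8 * t\<^sup>2))"
    by (intro Bochner_Integration.integrable_add i)
  thus ?thesis by (simp add: distrib_right)
qed

lemma taylor_mass_nonneg: "0 \<le> taylor_mass"
  unfolding taylor_mass_def by (intro integral_nonneg_AE) auto

definition char_constant :: real where "char_constant = 2304 * exp 2 * taylor_mass + 1"

text \<open>
  The factor \<open>20000\<close> is the ratio of the radius of the disc to half the length of the interval on which the
  characteristic function is controlled.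
\<close>

definition density_constant :: real where
  "density_constant = 20000 * (char_constant + 3 * smoothing_constant)"

lemma char_constant_ge_1: "1 \<le> char_constant"
  using taylor_mass_nonneg by (simp add: char_constant_def)

lemma density_constant_ge_1: "1 \<le> density_constant"
  using char_constant_ge_1 smoothing_constant_ge_1 by (simp add: density_constant_def)

context sum_with_gaussian
begin

lemma char_L1_close:
  assumes T: "1 \<le> T" and close: "entropic_distance M W \<le> ereal (exp (- 4000 * T\<^sup>2))"
  shows "(\<integral>t. indicator {-(T / 20000)..T / 20000} t * cmod (char (distr M borel X) t - char std_normal_distribution t) \<partial>lborel)
    \<le> char_constant / (T / 20000)"
proof -
  interpret \<mu>: real_distribution "distr M borel X" by (rule real_distribution_distr) simp
  interpret \<nu>: real_distribution std_normal_distribution by (rule real_dist_normal_dist)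
  let ?I = "indicator {-(T / 20000)..T / 20000} :: real \<Rightarrow> real"
  let ?d = "\<lambda>t. cmod (char (distr M borel X) t - char std_normal_distribution t)"
  let ?P = "\<lambda>t::real. (\<bar>t\<bar> + t\<^sup>2 + \<bar>t\<bar> ^ 3) * exp (- 3 / 8 * t\<^sup>2)"
  let ?g = "\<lambda>t. 2304 * exp 2 / T * ?P t + 1 / T\<^sup>2 * ?I t"
  have T0: "0 < T" using T by simp
  have iI: "integrable lborel ?I"
    by (rule integrable_real_indicator) (use T0 in \<open>auto simp: emeasure_lborel_Icc_eq\<close>)
  have g: "integrable lborel ?g"
    by (intro Bochner_Integration.integrable_add integrable_mult_right integrable_taylor_mass iI)
  have P0: "0 \<le> ?P t" for t by simp
  have pt: "?I t * ?d t \<le> ?g t" for t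
  proof (cases "\<bar>t\<bar> \<le> T / 20000")
    case True
    thus ?thesis using char_close[OF T close True] by (simp add: indicator_def abs_le_iff)
  next
    case False
    hence "?I t = 0" by (auto simp: indicator_def)
    moreover have "0 \<le> 2304 * exp 2 / T * ?P t" using T0 P0[of t] by (intro mult_nonneg_nonneg) auto
    ultimately show ?thesis by simp
  qed
  have "(\<integral>t. ?I t * ?d t \<partial>lborel) \<le> (\<integral>t. ?g t \<partial>lborel)"
  proof (rule Bochner_Integration.integral_mono[OF _ g pt])
    show "integrable lborel (\<lambda>t. ?I t * ?d t)"
    proof (rule Bochner_Integration.integrable_bound[OF g])
      show "AE t in lborel. norm (?I t * ?d t) \<le> norm (?g t)"
      proof (intro always_eventually allI)
        fix t
        have "norm (?I t * ?d t) = ?I t * ?d t" by (simp add: abs_mult)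
        also note pt
        also have "?g t \<le> norm (?g t)" unfolding real_norm_def by (rule abs_ge_self)
        finally show "norm (?I t * ?d t) \<le> norm (?g t)" .
      qed
    qed measurable
  qed
  also have "(\<integral>t. ?g t \<partial>lborel) = 2304 * exp 2 / T * taylor_mass + 1 / T\<^sup>2 * (2 * (T / 20000))"
  proof -
    have "(\<integral>t. ?g t \<partial>lborel) = (\<integral>t. 2304 * exp 2 / T * ?P t \<partial>lborel) + (\<integral>t. 1 / T\<^sup>2 * ?I t \<partial>lborel)"
      by (intro Bochner_Integration.integral_add integrable_mult_right integrable_taylor_mass iI)
    also have "(\<integral>t. 2304 * exp 2 / T * ?P t \<partial>lborel) = 2304 * exp 2 / T * taylor_mass"
      unfolding taylor_mass_def by (rule integral_mult_right_zero)
    also have "(\<integral>t. 1 / T\<^sup>2 * ?I t \<partial>lborel) = 1 / T\<^sup>2 * (2 * (T / 20000))"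
      using T0 by (subst integral_mult_right_zero) simp
    finally show ?thesis .
  qed
  also have "\<dots> = (2304 * exp 2 * taylor_mass + 1 / 10000) / T"
    using T0 by (simp add: field_simps power2_eq_square)
  also have "\<dots> \<le> char_constant / T"
    using T0 by (intro divide_right_mono) (auto simp: char_constant_def)
  also have "\<dots> \<le> char_constant / (T / 20000)"
    using T0 char_constant_ge_1 by (intro divide_left_mono) auto
  finally show ?thesis .
qed

text \<open>
  For \<open>T < 1\<close> the trivial bound \<open>1/\<sigma>\<close> for the densities is good enough.
\<close>

lemma density_close:
  assumes T: "0 < T" and close: "entropic_distance M W \<le> ereal (exp (- 4000 * T\<^sup>2))"
  shows "\<bar>gauss_smoothing (distr M borel X) \<sigma> x - normal_density 0 (sqrt (1 + \<sigma>\<^sup>2)) x\<bar> \<le> density_constant / (\<sigma> * T)"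
proof -
  have mu: "real_distribution (distr M borel X)" by (rule real_distribution_distr) simp
  show ?thesis
  proof (cases "1 \<le> T")
    case True
    have "\<bar>gauss_smoothing (distr M borel X) \<sigma> x - normal_density 0 (sqrt (1 + \<sigma>\<^sup>2)) x\<bar>
        \<le> (char_constant + 3 * smoothing_constant) / (\<sigma> * (T / 20000))"
      by (rule gauss_smoothing_sup_bound[OF mu _ \<sigma> char_L1_close[OF True close]]) (use T char_constant_ge_1 in auto)
    also have "\<dots> = density_constant / (\<sigma> * T)" using T \<sigma> by (simp add: density_constant_def field_simps)
    finally show ?thesis .
  next
    case False
    have "gauss_smoothing (distr M borel X) \<sigma> x \<le> 1 / \<sigma>" "0 \<le> gauss_smoothing (distr M borel X) \<sigma> x"
      using real_distribution.gauss_smoothing_le[OF mu \<sigma>(1)] real_distribution.gauss_smoothing_nonneg[OF mu] by auto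
    moreover have "normal_density 0 (sqrt (1 + \<sigma>\<^sup>2)) x \<le> 1 / \<sigma>"
    proof -
      have "\<sigma> \<le> sqrt (1 + \<sigma>\<^sup>2)" using \<sigma> by (intro real_le_rsqrt) auto
      hence "1 / sqrt (1 + \<sigma>\<^sup>2) \<le> 1 / \<sigma>" using \<sigma> by (intro frac_le) auto
      moreover have "0 < sqrt (1 + \<sigma>\<^sup>2)" by (simp add: add_pos_nonneg)
      ultimately show ?thesis using normal_density_le_inverse[of "sqrt (1 + \<sigma>\<^sup>2)" 0 x] by linarith
    qed
    moreover have "1 / \<sigma> \<le> density_constant / (\<sigma> * T)"
      using False T \<sigma> density_constant_ge_1 by (intro frac_le) (auto simp: mult_le_cancel_left1)
    ultimately show ?thesis using normal_density_nonneg[of 0 "sqrt (1 + \<sigma>\<^sup>2)" x] by linarith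
  qed
qed

end

text \<open>
  Two of the variables are kept in either order, and the other two are merged. The choice of \<open>a\<close> and \<open>b\<close>
  provides the symmetry between the summands.
\<close>

lemma (in prob_space) indep_vars_group:
  fixes V :: "nat \<Rightarrow> 'a \<Rightarrow> real"
  assumes ind: "indep_vars (\<lambda>_. borel) V {..<4}" and ab: "a < 2" "b < 2" "a \<noteq> b"
  shows "indep_vars (\<lambda>_. borel) (\<lambda>i::nat. [V a, V b, \<lambda>\<omega>. \<sigma> * V 2 \<omega> + \<sigma> * V 3 \<omega>] ! i) {..<3}"
proof -
  let ?K = "\<lambda>i::nat. [{a}, {b}, {2, 3}] ! i"
  let ?f = "\<lambda>i::nat. [\<lambda>v. v a, \<lambda>v. v b, \<lambda>v. \<sigma> * v 2 + \<sigma> * v (3::nat)] ! i :: (nat \<Rightarrow> real) \<Rightarrow> real"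
  have c: "i = 0 \<or> i = 1 \<or> i = 2" if "i \<in> {..<3::nat}" for i using that by auto
  have "indep_vars (\<lambda>j. PiM (?K j) (\<lambda>_. borel)) (\<lambda>j \<omega>. restrict (\<lambda>i. V i \<omega>) (?K j)) {..<3}"
  proof (rule indep_vars_restrict[OF ind])
    show "?K j \<subseteq> {..<4}" if "j \<in> {..<3}" for j using c[OF that] ab by auto
    show "disjoint_family_on ?K {..<3}"
      unfolding disjoint_family_on_def
    proof (intro ballI impI)
      fix i j assume "i \<in> {..<3::nat}" "j \<in> {..<3::nat}" "i \<noteq> j"
      thus "?K i \<inter> ?K j = {}" using c[of i] c[of j] ab by auto
    qed
  qed
  moreover have "?f j \<in> measurable (PiM (?K j) (\<lambda>_. borel)) borel" if "j \<in> {..<3}" for j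
    using c[OF that] by (auto intro!: borel_measurable_add borel_measurable_times measurable_component_singleton)
  ultimately have "indep_vars (\<lambda>_. borel) (\<lambda>j \<omega>. ?f j (restrict (\<lambda>i. V i \<omega>) (?K j))) {..<3}"
    by (rule indep_vars_compose2)
  moreover have "(\<lambda>\<omega>. ?f j (restrict (\<lambda>i. V i \<omega>) (?K j))) = [V a, V b, \<lambda>\<omega>. \<sigma> * V 2 \<omega> + \<sigma> * V 3 \<omega>] ! j" if "j \<in> {..<3}" for j
    using c[OF that] by auto
  ultimately show ?thesis
    by (subst (asm) indep_vars_cong[OF refl _ refl]) auto
qed

section \<open>Lower bound for the entropic distance\<close>

text \<open>
  What is needed about a single regularized variable: it has a density with the expected moments, so its
  entropic distance compares that density with a normal one of standard deviation \<open>v\<close>.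
\<close>

lemma (in prob_space) gaussian_regularization:
  assumes ind: "indep_var borel X borel Z" and Z: "distributed M lborel Z std_normal_density"
    and X: "integrable M (\<lambda>\<omega>. (X \<omega>)\<^sup>2)" "expectation X = 0" "expectation (\<lambda>\<omega>. (X \<omega>)\<^sup>2) = 1"
    and \<sigma>: "0 < \<sigma>"
  defines "p \<equiv> gauss_smoothing (distr M borel X) \<sigma>" and "v \<equiv> sqrt (1 + \<sigma>\<^sup>2)"
  shows "distributed M lborel (regularize X \<sigma> Z) (\<lambda>x. ennreal (p x))"
    and "p \<in> borel_measurable borel" "\<And>x. 0 \<le> p x"
    and "(\<integral>\<^sup>+ x. ennreal (p x) \<partial>lborel) = 1" "(\<integral>\<^sup>+ x. ennreal (x\<^sup>2 * p x) \<partial>lborel) = ennreal (v\<^sup>2)"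
    and "integrable M (regularize X \<sigma> Z)"
    and "entropic_distance M (regularize X \<sigma> Z) = relative_entropy p (normal_density 0 v)"
proof -
  have [measurable]: "random_variable borel X" "random_variable borel Z"
    using indep_var_rv1[OF ind] indep_var_rv2[OF ind] .
  interpret \<mu>: real_distribution "distr M borel X" by (rule real_distribution_distr) simp
  have ind': "indep_var borel X borel (\<lambda>\<omega>. \<sigma> * Z \<omega>)"
    using indep_var_compose[OF ind, of id borel "(*) \<sigma>" borel] by (simp add: comp_def)
  have V: "distributed M lborel (\<lambda>\<omega>. \<sigma> * Z \<omega>) (normal_density 0 \<sigma>)"
    using normal_density_affine[OF Z, of \<sigma> 0] \<sigma> by simp
  show D: "distributed M lborel (regularize X \<sigma> Z) (\<lambda>x. ennreal (p x))"
    unfolding regularize_def p_def by (rule distributed_add_normal[OF ind' V \<sigma>])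
  show pm[measurable]: "p \<in> borel_measurable borel" unfolding p_def by (rule \<mu>.measurable_gauss_smoothing)
  show p0: "0 \<le> p x" for x unfolding p_def by (rule \<mu>.gauss_smoothing_nonneg)
  have V2: "integrable M (\<lambda>\<omega>. (\<sigma> * Z \<omega>)\<^sup>2)"
  proof -
    have "integrable lborel (\<lambda>x. normal_density 0 \<sigma> x *\<^sub>R x\<^sup>2)"
      using integrable_normal_moment[OF \<sigma>, of 0 2] by simp
    thus ?thesis by (subst expectation_distributed(2)[OF V, of "\<lambda>x. x\<^sup>2"]) auto
  qed
  have V1: "expectation (\<lambda>\<omega>. \<sigma> * Z \<omega>) = 0" by (rule normal_distributed_expectation[OF \<sigma> V])
  have V3: "expectation (\<lambda>\<omega>. (\<sigma> * Z \<omega>)\<^sup>2) = \<sigma>\<^sup>2" using normal_distributed_variance[OF \<sigma> V] unfolding V1 by simp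
  note m = sum_second_moment[OF ind' X(1,2) V2 V1]
  have R1: "expectation (regularize X \<sigma> Z) = 0" using m(2) by (simp add: regularize_def)
  have R2i: "integrable M (\<lambda>\<omega>. (regularize X \<sigma> Z \<omega>)\<^sup>2)" using m(1) by (simp add: regularize_def)
  have R2: "expectation (\<lambda>\<omega>. (regularize X \<sigma> Z \<omega>)\<^sup>2) = v\<^sup>2"
    using m(3) X(3) V3 by (simp add: regularize_def v_def add_nonneg_nonneg)
  have [measurable]: "random_variable borel (regularize X \<sigma> Z)" unfolding regularize_def by measurable
  show "integrable M (regularize X \<sigma> Z)" by (rule square_integrable_imp_integrable[OF _ R2i]) measurable
  have "(\<integral>\<^sup>+ x. ennreal (p x) \<partial>lborel) = emeasure (distr M lborel (regularize X \<sigma> Z)) UNIV"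
    unfolding distributed_distr_eq_density[OF D] by (simp add: emeasure_density)
  also have "\<dots> = 1" using emeasure_space_1 by (simp add: emeasure_distr)
  finally show "(\<integral>\<^sup>+ x. ennreal (p x) \<partial>lborel) = 1" .
  have "integrable lborel (\<lambda>x. p x *\<^sub>R x\<^sup>2)"
    using R2i by (subst (asm) expectation_distributed(2)[OF D p0, of "\<lambda>x. x\<^sup>2"]) auto
  moreover have "(\<integral>x. p x *\<^sub>R x\<^sup>2 \<partial>lborel) = v\<^sup>2"
    using R2 by (subst (asm) expectation_distributed(1)[OF D p0, of "\<lambda>x. x\<^sup>2"]) auto
  ultimately show "(\<integral>\<^sup>+ x. ennreal (x\<^sup>2 * p x) \<partial>lborel) = ennreal (v\<^sup>2)"
    using p0 by (subst nn_integral_eq_integral) (auto simp: mult.commute)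
  show "entropic_distance M (regularize X \<sigma> Z) = relative_entropy p (normal_density 0 v)"
    by (rule entropic_distance_eq_relative_entropy[OF D p0 pm R1]) (use R2 R1 in \<open>auto simp: v_def\<close>)
qed

lemma regularized_pairE:
  assumes "regularized_pair M X Y Z Z'"
  shows "prob_space M" "prob_space.indep_vars M (\<lambda>_. borel) (\<lambda>i::nat. [X, Y, Z, Z'] ! i) {..<4}"
    "distributed M lborel Z std_normal_density" "distributed M lborel Z' std_normal_density"
    "integrable M (\<lambda>\<omega>. (X \<omega>)\<^sup>2)" "prob_space.variance M X = 1"
    "integrable M (\<lambda>\<omega>. (Y \<omega>)\<^sup>2)" "prob_space.variance M Y = 1"
    "X \<in> borel_measurable M" "Y \<in> borel_measurable M" "Z \<in> borel_measurable M" "Z' \<in> borel_measurable M"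
proof -
  show *: "prob_space M" "prob_space.indep_vars M (\<lambda>_. borel) (\<lambda>i::nat. [X, Y, Z, Z'] ! i) {..<4}"
    "distributed M lborel Z std_normal_density" "distributed M lborel Z' std_normal_density"
    "integrable M (\<lambda>\<omega>. (X \<omega>)\<^sup>2)" "prob_space.variance M X = 1"
    "integrable M (\<lambda>\<omega>. (Y \<omega>)\<^sup>2)" "prob_space.variance M Y = 1"
    using assms by (auto simp: regularized_pair_def)
  interpret prob_space M by fact
  have "random_variable borel ([X, Y, Z, Z'] ! i)" if "i < 4" for i using *(2) that by (auto simp: indep_vars_def)
  from this[of 0] this[of 1] this[of 2] this[of 3]
  show "X \<in> borel_measurable M" "Y \<in> borel_measurable M" "Z \<in> borel_measurable M" "Z' \<in> borel_measurable M"
    by (simp_all add: eval_nat_numeral)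
qed

lemma (in prob_space) sum_with_gaussian_of_pair:
  assumes pair: "regularized_pair M X Y Z Z'" and m: "expectation X = 0" "expectation Y = 0"
    and \<sigma>: "0 < \<sigma>" "\<sigma> \<le> 1"
  shows "sum_with_gaussian M X Y (\<lambda>\<omega>. \<sigma> * Z \<omega> + \<sigma> * Z' \<omega>) \<sigma>"
    and "sum_with_gaussian M Y X (\<lambda>\<omega>. \<sigma> * Z \<omega> + \<sigma> * Z' \<omega>) \<sigma>"
    and "indep_var borel X borel Z" "indep_var borel Y borel Z'"
proof -
  note p = regularized_pairE[OF pair]
  let ?V = "\<lambda>i::nat. [X, Y, Z, Z'] ! i"
  have mi: "(\<lambda>v. v i) \<in> borel_measurable (PiM {i} (\<lambda>_. borel))" for i :: nat
    by (rule measurable_component_singleton) simp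
  show "indep_var borel X borel Z"
    using indep_var_of_indep_vars[OF p(2) _ _ _ mi[of 0] mi[of 2]] by (simp add: eval_nat_numeral)
  show "indep_var borel Y borel Z'"
    using indep_var_of_indep_vars[OF p(2) _ _ _ mi[of 1] mi[of 3]] by (simp add: eval_nat_numeral)
  have ZZ: "indep_var borel (\<lambda>\<omega>. \<sigma> * Z \<omega>) borel (\<lambda>\<omega>. \<sigma> * Z' \<omega>)"
  proof -
    have "indep_var borel Z borel Z'"
      using indep_var_of_indep_vars[OF p(2) _ _ _ mi[of 2] mi[of 3]] by (simp add: eval_nat_numeral)
    from indep_var_compose[OF this, of "(*) \<sigma>" borel "(*) \<sigma>" borel] show ?thesis by (simp add: comp_def)
  qed
  have Zs: "distributed M lborel (\<lambda>\<omega>. \<sigma> * Z \<omega>) (normal_density 0 \<sigma>)"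
    "distributed M lborel (\<lambda>\<omega>. \<sigma> * Z' \<omega>) (normal_density 0 \<sigma>)"
    using normal_density_affine[OF p(3), of \<sigma> 0] normal_density_affine[OF p(4), of \<sigma> 0] \<sigma> by simp_all
  have "sqrt (\<sigma>\<^sup>2 + \<sigma>\<^sup>2) = sqrt 2 * \<sigma>"
    using \<sigma> real_sqrt_mult[of 2 "\<sigma>\<^sup>2"] by simp
  hence U: "distributed M lborel (\<lambda>\<omega>. \<sigma> * Z \<omega> + \<sigma> * Z' \<omega>) (normal_density 0 (sqrt 2 * \<sigma>))"
    using add_indep_normal[OF ZZ \<sigma>(1) \<sigma>(1) Zs] by simp
  have i: "indep_vars (\<lambda>_. borel) (\<lambda>i::nat. [X, Y, \<lambda>\<omega>. \<sigma> * Z \<omega> + \<sigma> * Z' \<omega>] ! i) {..<3}"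
    "indep_vars (\<lambda>_. borel) (\<lambda>i::nat. [Y, X, \<lambda>\<omega>. \<sigma> * Z \<omega> + \<sigma> * Z' \<omega>] ! i) {..<3}"
    using indep_vars_group[OF p(2), of 0 1 \<sigma>] indep_vars_group[OF p(2), of 1 0 \<sigma>] by (simp_all add: eval_nat_numeral)
  show "sum_with_gaussian M X Y (\<lambda>\<omega>. \<sigma> * Z \<omega> + \<sigma> * Z' \<omega>) \<sigma>"
    and "sum_with_gaussian M Y X (\<lambda>\<omega>. \<sigma> * Z \<omega> + \<sigma> * Z' \<omega>) \<sigma>"
    by unfold_locales (use i U p m \<sigma> in auto)
qed

text \<open>
  The bound for the relative entropy of densities at uniform distance \<open>\<eta>\<close>.
\<close>

definition entropy_bound :: "real \<Rightarrow> real" where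
  "entropy_bound \<eta> = 80 * \<eta> * (ln (2 + 1 / \<eta>) * sqrt (ln (2 + 1 / \<eta>)))"

lemma centered_pair_entropy:
  assumes pair: "regularized_pair M X Y Z Z'" and m: "prob_space.expectation M X = 0" "prob_space.expectation M Y = 0"
    and \<sigma>: "0 < \<sigma>" "\<sigma> \<le> 1"
  defines "W \<equiv> \<lambda>\<omega>. regularize X \<sigma> Z \<omega> + regularize Y \<sigma> Z' \<omega>"
  shows "0 \<le> entropic_distance M W"
    and "0 \<le> entropic_distance M (regularize X \<sigma> Z)" "0 \<le> entropic_distance M (regularize Y \<sigma> Z')"
    and "\<And>T. 0 < T \<Longrightarrow> entropic_distance M W \<le> ereal (exp (- 4000 * T\<^sup>2)) \<Longrightarrow>
       entropic_distance M (regularize X \<sigma> Z) \<le> ereal (entropy_bound (density_constant / (\<sigma> * T))) \<and>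
       entropic_distance M (regularize Y \<sigma> Z') \<le> ereal (entropy_bound (density_constant / (\<sigma> * T)))"
    and "\<exists>p. distributed M lborel (regularize X \<sigma> Z) (\<lambda>x. ennreal (p x)) \<and> (\<forall>x. 0 \<le> p x) \<and> p \<in> borel_measurable borel"
      "\<exists>p. distributed M lborel (regularize Y \<sigma> Z') (\<lambda>x. ennreal (p x)) \<and> (\<forall>x. 0 \<le> p x) \<and> p \<in> borel_measurable borel"
      "\<exists>p. distributed M lborel W (\<lambda>x. ennreal (p x)) \<and> (\<forall>x. 0 \<le> p x) \<and> p \<in> borel_measurable borel"
    and "integrable M (regularize X \<sigma> Z)" "integrable M (regularize Y \<sigma> Z')"
proof -
  note p = regularized_pairE[OF pair]
  interpret prob_space M by fact
  note swg = sum_with_gaussian_of_pair[OF pair m \<sigma>]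
  interpret A: sum_with_gaussian M X Y "\<lambda>\<omega>. \<sigma> * Z \<omega> + \<sigma> * Z' \<omega>" \<sigma> by (rule swg)
  interpret B: sum_with_gaussian M Y X "\<lambda>\<omega>. \<sigma> * Z \<omega> + \<sigma> * Z' \<omega>" \<sigma> by (rule swg)
  have WA: "W = A.W" by (simp add: W_def A.W_def fun_eq_iff regularize_def)
  have WB: "W = B.W" by (simp add: W_def B.W_def fun_eq_iff regularize_def)
  note rX = gaussian_regularization[OF swg(3) p(3) A.X2 \<sigma>(1)]
  note rY = gaussian_regularization[OF swg(4) p(4) A.Y2 \<sigma>(1)]
  define v where "v = sqrt (1 + \<sigma>\<^sup>2)"
  have v: "1 \<le> v" "v\<^sup>2 \<le> 2" "0 < v" using \<sigma> by (auto simp: v_def power_le_one add_pos_nonneg)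
  have nd: "\<And>x. 0 < normal_density 0 u x" "(\<integral>\<^sup>+ x. ennreal (normal_density 0 u x) \<partial>lborel) = 1" if "0 < u" for u
    using that by (auto intro: normal_density_pos simp: nn_integral_eq_integral)
  show "0 \<le> entropic_distance M (regularize X \<sigma> Z)"
    unfolding rX(7) v_def[symmetric] by (rule relative_entropy_nonneg) (use rX nd v in auto)
  show "0 \<le> entropic_distance M (regularize Y \<sigma> Z')"
    unfolding rY(7) v_def[symmetric] by (rule relative_entropy_nonneg) (use rY nd v in auto)
  have pW1: "(\<integral>\<^sup>+ x. ennreal (A.pW x) \<partial>lborel) = 1"
  proof -
    have "(\<integral>\<^sup>+ x. ennreal (A.pW x) \<partial>lborel) = emeasure (distr M lborel A.W) UNIV"
      using A.pW(3) unfolding distributed_distr_eq_density[OF A.pW(1)] by (simp add: emeasure_density)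
    also have "\<dots> = 1" using emeasure_space_1 A.measurable_W by (simp add: emeasure_distr)
    finally show ?thesis .
  qed
  show "0 \<le> entropic_distance M W"
    unfolding WA A.entropic_distance_W by (rule relative_entropy_nonneg) (use A.pW pW1 nd A.r(1) in auto)
  show "\<exists>p. distributed M lborel (regularize X \<sigma> Z) (\<lambda>x. ennreal (p x)) \<and> (\<forall>x. 0 \<le> p x) \<and> p \<in> borel_measurable borel"
      "\<exists>p. distributed M lborel (regularize Y \<sigma> Z') (\<lambda>x. ennreal (p x)) \<and> (\<forall>x. 0 \<le> p x) \<and> p \<in> borel_measurable borel"
      "\<exists>p. distributed M lborel W (\<lambda>x. ennreal (p x)) \<and> (\<forall>x. 0 \<le> p x) \<and> p \<in> borel_measurable borel"
    using rX(1-3) rY(1-3) A.pW unfolding WA by blast+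
  show "integrable M (regularize X \<sigma> Z)" "integrable M (regularize Y \<sigma> Z')" using rX rY by auto
  fix T :: real assume T: "0 < T" and close: "entropic_distance M W \<le> ereal (exp (- 4000 * T\<^sup>2))"
  define \<eta> where "\<eta> = density_constant / (\<sigma> * T)"
  have \<eta>: "0 < \<eta>" using density_constant_ge_1 \<sigma> T by (simp add: \<eta>_def)
  have "entropic_distance M (regularize X \<sigma> Z) \<le> ereal (entropy_bound \<eta>)"
    unfolding rX(7) entropy_bound_def
    by (rule relative_entropy_le_of_sup_close[OF rX(2-5)])
       (use v A.density_close[OF T close[unfolded WA]] \<eta> in \<open>auto simp: v_def \<eta>_def\<close>)
  moreover have "entropic_distance M (regularize Y \<sigma> Z') \<le> ereal (entropy_bound \<eta>)"
    unfolding rY(7) entropy_bound_def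
    by (rule relative_entropy_le_of_sup_close[OF rY(2-5)])
       (use v B.density_close[OF T close[unfolded WB]] \<eta> in \<open>auto simp: v_def \<eta>_def\<close>)
  ultimately show "entropic_distance M (regularize X \<sigma> Z) \<le> ereal (entropy_bound (density_constant / (\<sigma> * T))) \<and>
       entropic_distance M (regularize Y \<sigma> Z') \<le> ereal (entropy_bound (density_constant / (\<sigma> * T)))"
    by (simp add: \<eta>_def)
qed

lemma rv_density_distr:
  assumes "T \<in> measurable M N" "X \<in> borel_measurable N"
  shows "rv_density (distr M N T) X = rv_density M (\<lambda>\<omega>. X (T \<omega>))"
  using assms by (simp add: rv_density_def distr_distr comp_def)

text \<open>
  The entropic distance depends on the law only.
\<close>

lemma entropic_distance_distr:
  assumes [measurable]: "T \<in> measurable M N" "X \<in> borel_measurable N"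
  shows "entropic_distance (distr M N T) X = entropic_distance M (\<lambda>\<omega>. X (T \<omega>))"
  unfolding entropic_distance_def by (simp add: rv_density_distr integral_distr)

lemma regularized_pair_distr:
  assumes pair: "regularized_pair M X Y Z Z'"
  defines "T \<equiv> \<lambda>\<omega>. (X \<omega>, Y \<omega>, Z \<omega>, Z' \<omega>)"
  shows "T \<in> measurable M borel"
    and "regularized_pair (distr M borel T) fst (fst \<circ> snd) (fst \<circ> snd \<circ> snd) (snd \<circ> snd \<circ> snd)"
proof -
  interpret prob_space M using pair by (simp add: regularized_pair_def)
  have ind: "indep_vars (\<lambda>_. borel) (\<lambda>i::nat. [X, Y, Z, Z'] ! i) {..<4}"
    using pair by (simp add: regularized_pair_def)
  hence rv: "random_variable borel ([X, Y, Z, Z'] ! i)" if "i < 4" for i using that by (auto simp: indep_vars_def)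
  have [measurable]: "random_variable borel X" "random_variable borel Y" "random_variable borel Z" "random_variable borel Z'"
    using rv[of 0] rv[of 1] rv[of 2] rv[of 3] by (simp_all add: eval_nat_numeral)
  show T[measurable]: "T \<in> measurable M borel"
    unfolding T_def borel_prod[symmetric] by measurable
  interpret N: prob_space "distr M borel T" by (rule prob_space_distr) simp
  have fm[measurable]: "(fst \<circ> snd) \<in> borel_measurable (borel :: (real \<times> real \<times> real \<times> real) measure)"
     "(fst \<circ> snd \<circ> snd) \<in> borel_measurable (borel :: (real \<times> real \<times> real \<times> real) measure)"
     "(snd \<circ> snd \<circ> snd) \<in> borel_measurable (borel :: (real \<times> real \<times> real \<times> real) measure)"
     "fst \<in> borel_measurable (borel :: (real \<times> real \<times> real \<times> real) measure)"
    unfolding borel_prod[symmetric] by measurable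
  let ?P = "[fst, fst \<circ> snd, fst \<circ> snd \<circ> snd, snd \<circ> snd \<circ> snd] :: (real \<times> real \<times> real \<times> real \<Rightarrow> real) list"
  have P[measurable]: "?P ! i \<in> borel_measurable borel" if "i < 4" for i
    using that by (auto simp: less_Suc_eq eval_nat_numeral)
  have PT: "(?P ! i) (T \<omega>) = ([X, Y, Z, Z'] ! i) \<omega>" if "i < 4" for i \<omega>
    using that by (auto simp: less_Suc_eq eval_nat_numeral T_def)
  have "N.indep_vars (\<lambda>_. borel) (\<lambda>i. ?P ! i) {..<4}"
  proof (subst N.indep_vars_iff_distr_eq_PiM')
    have "distr (distr M borel T) (Pi\<^sub>M {..<4} (\<lambda>_. borel)) (\<lambda>x. \<lambda>i\<in>{..<4}. (?P ! i) x)
       = distr M (Pi\<^sub>M {..<4} (\<lambda>_. borel)) (\<lambda>x. \<lambda>i\<in>{..<4}. ([X, Y, Z, Z'] ! i) x)"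
      by (subst distr_distr) (auto intro!: measurable_restrict distr_cong P simp: PT)
    also have "\<dots> = Pi\<^sub>M {..<4} (\<lambda>i. distr M borel ([X, Y, Z, Z'] ! i))"
      using ind by (subst (asm) indep_vars_iff_distr_eq_PiM') (auto intro: rv simp: lessThan_empty_iff)
    also have "\<dots> = Pi\<^sub>M {..<4} (\<lambda>i. distr (distr M borel T) borel (?P ! i))"
    proof (intro PiM_cong refl)
      fix i :: nat assume "i \<in> {..<4}"
      hence i: "i < 4" by simp
      have "distr (distr M borel T) borel (?P ! i) = distr M borel ((?P ! i) \<circ> T)"
        by (rule distr_distr[OF P[OF i] T])
      also have "(?P ! i) \<circ> T = [X, Y, Z, Z'] ! i"
        using PT[OF i] by (intro ext) (simp only: comp_apply)
      finally show "distr M borel ([X, Y, Z, Z'] ! i) = distr (distr M borel T) borel (?P ! i)" by (rule sym)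
    qed
    finally show "distr (distr M borel T) (Pi\<^sub>M {..<4} (\<lambda>_. borel)) (\<lambda>x. \<lambda>i\<in>{..<4}. (?P ! i) x)
      = Pi\<^sub>M {..<4} (\<lambda>i. distr (distr M borel T) borel (?P ! i))" .
  qed (use P in \<open>auto simp: lessThan_empty_iff\<close>)
  note indN = this
  have FT: "fst (T \<omega>) = X \<omega>" "(fst \<circ> snd) (T \<omega>) = Y \<omega>" "(fst \<circ> snd \<circ> snd) (T \<omega>) = Z \<omega>"
    "(snd \<circ> snd \<circ> snd) (T \<omega>) = Z' \<omega>" for \<omega>
    by (simp_all add: T_def)
  have int_eq: "integrable (distr M borel T) (\<lambda>x. (f x)\<^sup>2) \<longleftrightarrow> integrable M (\<lambda>\<omega>. (f (T \<omega>))\<^sup>2)"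
    and var_eq: "N.variance f = variance (\<lambda>\<omega>. f (T \<omega>))"
    if [measurable]: "f \<in> borel_measurable borel" for f :: "real \<times> real \<times> real \<times> real \<Rightarrow> real"
    by (simp_all add: integrable_distr_eq integral_distr)
  have dist_eq: "distributed (distr M borel T) lborel f std_normal_density"
    if [measurable]: "f \<in> borel_measurable borel" and "distributed M lborel (\<lambda>\<omega>. f (T \<omega>)) std_normal_density"
    for f :: "real \<times> real \<times> real \<times> real \<Rightarrow> real"
    using that(2) unfolding distributed_def by (simp add: distr_distr comp_def)
  show "regularized_pair (distr M borel T) fst (fst \<circ> snd) (fst \<circ> snd \<circ> snd) (snd \<circ> snd \<circ> snd)"
    unfolding regularized_pair_def
  proof (intro conjI indN N.prob_space_axioms)
    have p: "distributed M lborel Z std_normal_density" "distributed M lborel Z' std_normal_density"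
      "integrable M (\<lambda>\<omega>. (X \<omega>)\<^sup>2)" "variance X = 1" "integrable M (\<lambda>\<omega>. (Y \<omega>)\<^sup>2)" "variance Y = 1"
      using pair by (auto simp: regularized_pair_def)
    show "distributed (distr M borel T) lborel (fst \<circ> snd \<circ> snd) std_normal_density"
      by (rule dist_eq[OF fm(2)]) (simp only: FT p)
    show "distributed (distr M borel T) lborel (snd \<circ> snd \<circ> snd) std_normal_density"
      by (rule dist_eq[OF fm(3)]) (simp only: FT p)
    show "integrable (distr M borel T) (\<lambda>\<omega>. (fst \<omega>)\<^sup>2)" "N.variance fst = 1"
      by (simp_all only: int_eq[OF fm(4)] var_eq[OF fm(4)] FT p)
    show "integrable (distr M borel T) (\<lambda>\<omega>. ((fst \<circ> snd) \<omega>)\<^sup>2)" "N.variance (fst \<circ> snd) = 1"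
      by (simp_all only: int_eq[OF fm(1)] var_eq[OF fm(1)] FT p)
  qed
qed

lemma admissible_constant_transfer:
  assumes "\<forall>M :: (real \<times> real \<times> real \<times> real) measure. admissible_constant C M"
  shows "admissible_constant C (M :: 'a measure)"
  unfolding admissible_constant_def
proof (intro allI impI)
  fix X Y Z Z' :: "'a \<Rightarrow> real" and \<sigma> :: real
  assume pair: "regularized_pair M X Y Z Z'" and \<sigma>: "0 < \<sigma>" "\<sigma> \<le> 1"
  define T where "T = (\<lambda>\<omega>. (X \<omega>, Y \<omega>, Z \<omega>, Z' \<omega>))"
  note T = regularized_pair_distr[OF pair, folded T_def]
  note [measurable] = T(1)
  have [measurable]: "(\<lambda>x. fst (snd x)) \<in> borel_measurable (borel :: (real \<times> real \<times> real \<times> real) measure)"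
     "(\<lambda>x. fst (snd (snd x))) \<in> borel_measurable (borel :: (real \<times> real \<times> real \<times> real) measure)"
     "(\<lambda>x. snd (snd (snd x))) \<in> borel_measurable (borel :: (real \<times> real \<times> real \<times> real) measure)"
     "fst \<in> borel_measurable (borel :: (real \<times> real \<times> real \<times> real) measure)"
    unfolding borel_prod[symmetric] by measurable
  have "admissible_constant C (distr M borel T)" using assms by simp
  from this[unfolded admissible_constant_def, rule_format, OF T(2) \<sigma>]
  show "let X\<^sub>\<sigma> = regularize X \<sigma> Z; Y\<^sub>\<sigma> = regularize Y \<sigma> Z'; D = entropic_distance M X\<^sub>\<sigma> + entropic_distance M Y\<^sub>\<sigma>
       in entropic_distance M (\<lambda>\<omega>. X\<^sub>\<sigma> \<omega> + Y\<^sub>\<sigma> \<omega>) \<ge> entropic_lower_bound C \<sigma> D"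
    unfolding Let_def regularize_def comp_def
    by (simp add: entropic_distance_distr) (simp add: T_def)
qed

lemma regularized_pair_center:
  assumes pair: "regularized_pair M X Y Z Z'"
  shows "regularized_pair M (\<lambda>\<omega>. X \<omega> - a) (\<lambda>\<omega>. Y \<omega> - b) Z Z'"
    and "prob_space.expectation M (\<lambda>\<omega>. X \<omega> - prob_space.expectation M X) = 0"
      "prob_space.expectation M (\<lambda>\<omega>. Y \<omega> - prob_space.expectation M Y) = 0"
proof -
  note p = regularized_pairE[OF pair]
  interpret prob_space M by fact
  have i: "integrable M X" "integrable M Y"
    using square_integrable_imp_integrable[OF p(9) p(5)] square_integrable_imp_integrable[OF p(10) p(7)] by auto
  show "expectation (\<lambda>\<omega>. X \<omega> - expectation X) = 0" "expectation (\<lambda>\<omega>. Y \<omega> - expectation Y) = 0"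
    using i by (simp_all add: prob_space)
  have c: "i = 0 \<or> i = 1 \<or> i = 2 \<or> i = 3" if "i \<in> {..<4::nat}" for i using that by auto
  have "indep_vars (\<lambda>_. borel) (\<lambda>i \<omega>. ([\<lambda>x. x - a, \<lambda>x. x - b, id, id] ! i) (([X, Y, Z, Z'] ! i) \<omega>)) {..<4::nat}"
  proof (rule indep_vars_compose2[OF p(2)])
    fix i :: nat assume "i \<in> {..<4}"
    from c[OF this] show "[\<lambda>x. x - a, \<lambda>x. x - b, id, id] ! i \<in> borel_measurable borel" by auto
  qed
  moreover have "(\<lambda>\<omega>. ([\<lambda>x. x - a, \<lambda>x. x - b, id, id] ! i) (([X, Y, Z, Z'] ! i) \<omega>)) = [\<lambda>\<omega>. X \<omega> - a, \<lambda>\<omega>. Y \<omega> - b, Z, Z'] ! i"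
    if "i \<in> {..<4}" for i using c[OF that] by auto
  ultimately have ind: "indep_vars (\<lambda>_. borel) (\<lambda>i::nat. [\<lambda>\<omega>. X \<omega> - a, \<lambda>\<omega>. Y \<omega> - b, Z, Z'] ! i) {..<4}"
    by (subst (asm) indep_vars_cong[OF refl _ refl]) auto
  have sq: "integrable M (\<lambda>\<omega>. (V \<omega> - c)\<^sup>2)" if "integrable M (\<lambda>\<omega>. (V \<omega>)\<^sup>2)" "integrable M V" for V :: "'a \<Rightarrow> real" and c
    using that by (simp add: power2_diff)
  have var: "variance (\<lambda>\<omega>. V \<omega> - c) = variance V" if "integrable M V" for V :: "'a \<Rightarrow> real" and c
    using that by (simp add: prob_space)
  show "regularized_pair M (\<lambda>\<omega>. X \<omega> - a) (\<lambda>\<omega>. Y \<omega> - b) Z Z'"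
    unfolding regularized_pair_def
    using p ind sq[OF p(5) i(1), of a] sq[OF p(7) i(2), of b] var[OF i(1), of a] var[OF i(2), of b] by auto
qed

lemma regularized_pair_entropy:
  assumes pair: "regularized_pair M X Y Z Z'" and \<sigma>: "0 < \<sigma>" "\<sigma> \<le> 1"
  defines "W \<equiv> \<lambda>\<omega>. regularize X \<sigma> Z \<omega> + regularize Y \<sigma> Z' \<omega>"
  shows "0 \<le> entropic_distance M W"
    and "0 \<le> entropic_distance M (regularize X \<sigma> Z)" "0 \<le> entropic_distance M (regularize Y \<sigma> Z')"
    and "\<And>T. 0 < T \<Longrightarrow> entropic_distance M W \<le> ereal (exp (- 4000 * T\<^sup>2)) \<Longrightarrow>
       entropic_distance M (regularize X \<sigma> Z) \<le> ereal (entropy_bound (density_constant / (\<sigma> * T))) \<and>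
       entropic_distance M (regularize Y \<sigma> Z') \<le> ereal (entropy_bound (density_constant / (\<sigma> * T)))"
proof -
  note p = regularized_pairE[OF pair]
  interpret prob_space M by fact
  define a b where "a = expectation X" and "b = expectation Y"
  define X' Y' where "X' = (\<lambda>\<omega>. X \<omega> - a)" and "Y' = (\<lambda>\<omega>. Y \<omega> - b)"
  have pair': "regularized_pair M X' Y' Z Z'" and m: "expectation X' = 0" "expectation Y' = 0"
    using regularized_pair_center[OF pair] by (auto simp: X'_def Y'_def a_def b_def)
  note c = centered_pair_entropy[OF pair' m \<sigma>]
  have eX: "entropic_distance M (regularize X \<sigma> Z) = entropic_distance M (regularize X' \<sigma> Z)"
  proof -
    obtain q where q: "distributed M lborel (regularize X' \<sigma> Z) (\<lambda>x. ennreal (q x))" "\<And>x. 0 \<le> q x" "q \<in> borel_measurable borel"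
      using c(5) by blast
    have "regularize X \<sigma> Z = (\<lambda>\<omega>. regularize X' \<sigma> Z \<omega> + a)" by (simp add: regularize_def X'_def fun_eq_iff)
    thus ?thesis using entropic_distance_translate[OF q c(8), of a] by simp
  qed
  have eY: "entropic_distance M (regularize Y \<sigma> Z') = entropic_distance M (regularize Y' \<sigma> Z')"
  proof -
    obtain q where q: "distributed M lborel (regularize Y' \<sigma> Z') (\<lambda>x. ennreal (q x))" "\<And>x. 0 \<le> q x" "q \<in> borel_measurable borel"
      using c(6) by blast
    have "regularize Y \<sigma> Z' = (\<lambda>\<omega>. regularize Y' \<sigma> Z' \<omega> + b)" by (simp add: regularize_def Y'_def fun_eq_iff)
    thus ?thesis using entropic_distance_translate[OF q c(9), of b] by simp
  qed
  have eW: "entropic_distance M W = entropic_distance M (\<lambda>\<omega>. regularize X' \<sigma> Z \<omega> + regularize Y' \<sigma> Z' \<omega>)"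
  proof -
    obtain q where q: "distributed M lborel (\<lambda>\<omega>. regularize X' \<sigma> Z \<omega> + regularize Y' \<sigma> Z' \<omega>) (\<lambda>x. ennreal (q x))" "\<And>x. 0 \<le> q x" "q \<in> borel_measurable borel"
      using c(7) by blast
    have "W = (\<lambda>\<omega>. (regularize X' \<sigma> Z \<omega> + regularize Y' \<sigma> Z' \<omega>) + (a + b))"
      by (simp add: W_def regularize_def X'_def Y'_def fun_eq_iff)
    thus ?thesis using entropic_distance_translate[OF q Bochner_Integration.integrable_add[OF c(8,9)], of "a + b"] by simp
  qed
  show "0 \<le> entropic_distance M W" "0 \<le> entropic_distance M (regularize X \<sigma> Z)" "0 \<le> entropic_distance M (regularize Y \<sigma> Z')"
    unfolding eX eY eW by (rule c(1-3))+
  show "entropic_distance M (regularize X \<sigma> Z) \<le> ereal (entropy_bound (density_constant / (\<sigma> * T))) \<and>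
       entropic_distance M (regularize Y \<sigma> Z') \<le> ereal (entropy_bound (density_constant / (\<sigma> * T)))"
    if "0 < T" "entropic_distance M W \<le> ereal (exp (- 4000 * T\<^sup>2))" for T
    using c(4)[OF that(1)] that(2) unfolding eX eY eW by blast
qed

definition cramer_constant :: real where
  "cramer_constant = density_constant\<^sup>2 * 311475200"

text \<open>
  The bound for the two entropic distances, inverted. That their sum is finite is part of the claim.
\<close>

lemma cramer_T_bound:
  assumes pair: "regularized_pair M X Y Z Z'" and \<sigma>: "0 < \<sigma>" "\<sigma> \<le> 1" and T: "0 < T"
    and close: "entropic_distance M (\<lambda>\<omega>. regularize X \<sigma> Z \<omega> + regularize Y \<sigma> Z' \<omega>) \<le> ereal (exp (- 4000 * T\<^sup>2))"
    and D: "entropic_distance M (regularize X \<sigma> Z) + entropic_distance M (regularize Y \<sigma> Z') \<noteq> 0"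
  obtains d where "0 < d" "entropic_distance M (regularize X \<sigma> Z) + entropic_distance M (regularize Y \<sigma> Z') = ereal d"
    "T\<^sup>2 \<le> cramer_constant * (ln (2 + 1 / d) ^ 3 / (\<sigma>\<^sup>2 * d\<^sup>2))"
proof -
  note e = regularized_pair_entropy[OF pair \<sigma>]
  let ?D1 = "entropic_distance M (regularize X \<sigma> Z)" and ?D2 = "entropic_distance M (regularize Y \<sigma> Z')"
  define \<eta> where "\<eta> = density_constant / (\<sigma> * T)"
  have \<eta>: "0 < \<eta>" using density_constant_ge_1 \<sigma> T by (simp add: \<eta>_def)
  have b: "?D1 \<le> ereal (entropy_bound \<eta>)" "?D2 \<le> ereal (entropy_bound \<eta>)"
    using e(4)[OF T close] by (auto simp: \<eta>_def)
  obtain d1 where d1: "?D1 = ereal d1" using b(1) e(2) by (cases ?D1) auto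
  obtain d2 where d2: "?D2 = ereal d2" using b(2) e(3) by (cases ?D2) auto
  define d where "d = d1 + d2"
  have Dd: "?D1 + ?D2 = ereal d" by (simp add: d1 d2 d_def)
  have d0: "0 < d" using e(2,3) D unfolding d1 d2 d_def by (auto simp: zero_ereal_def)
  have "d \<le> entropy_bound \<eta> + entropy_bound \<eta>" using b unfolding d1 d2 d_def by simp
  hence "d \<le> 160 * \<eta> * (ln (2 + 1 / \<eta>) * sqrt (ln (2 + 1 / \<eta>)))" by (simp add: entropy_bound_def)
  from log_inversion[OF d0 \<eta> this]
  have "\<sigma>\<^sup>2 * T\<^sup>2 / density_constant\<^sup>2 \<le> 311475200 * ln (2 + 1 / d) ^ 3 / d\<^sup>2"
    by (simp add: \<eta>_def power_divide power_mult_distrib)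
  moreover have "0 < density_constant\<^sup>2" "0 < \<sigma>\<^sup>2" using density_constant_ge_1 \<sigma> by auto
  ultimately have "T\<^sup>2 \<le> cramer_constant * (ln (2 + 1 / d) ^ 3 / (\<sigma>\<^sup>2 * d\<^sup>2))"
    using d0 by (simp add: cramer_constant_def field_simps)
  with d0 Dd show thesis by (rule that)
qed

lemma entropic_lower_bound_le_1:
  assumes "0 \<le> C" "0 \<le> D" shows "entropic_lower_bound C \<sigma> D \<le> 1"
proof (cases D)
  case (real d)
  have "0 \<le> C * ln (2 + 1 / d) ^ 3 / (\<sigma>\<^sup>2 * d\<^sup>2)"
    using assms real by (intro divide_nonneg_nonneg mult_nonneg_nonneg zero_le_power2 zero_le_power ln_ge_zero) auto
  thus ?thesis by (auto simp: entropic_lower_bound_def Let_def real one_ereal_def)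
qed (use assms in \<open>auto simp: entropic_lower_bound_def\<close>)

text \<open>
  If the distance \<open>\<delta>\<close> of the sum is at least \<open>1\<close>, the bound is trivial. If it were \<open>0\<close> with \<open>D > 0\<close>,
  the inequality for \<open>T\<close> would hold for all \<open>T\<close>, which is absurd; this is the classical theorem of Cramer.
  Otherwise \<open>T\<close> is chosen such that \<open>\<delta> = exp (- 4000 T\<^sup>2)\<close>.
\<close>

lemma admissible_constant_cramer: "admissible_constant (4000 * cramer_constant) M"
  unfolding admissible_constant_def Let_def
proof (intro allI impI)
  fix X Y Z Z' and \<sigma> :: real
  assume pair: "regularized_pair M X Y Z Z'" and \<sigma>: "0 < \<sigma>" "\<sigma> \<le> 1"
  let ?W = "\<lambda>\<omega>. regularize X \<sigma> Z \<omega> + regularize Y \<sigma> Z' \<omega>"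
  let ?D = "entropic_distance M (regularize X \<sigma> Z) + entropic_distance M (regularize Y \<sigma> Z')"
  let ?C = "4000 * cramer_constant"
  note e = regularized_pair_entropy[OF pair \<sigma>]
  have C: "0 \<le> ?C" by (simp add: cramer_constant_def)
  have D0: "0 \<le> ?D" using e(2,3) by (rule add_nonneg_nonneg)
  show "entropic_lower_bound ?C \<sigma> ?D \<le> entropic_distance M ?W"
  proof (cases "?D = 0 \<or> 1 \<le> entropic_distance M ?W")
    case True
    thus ?thesis
    proof
      assume "?D = 0"
      thus ?thesis using e(1) by (simp add: entropic_lower_bound_def)
    next
      assume "1 \<le> entropic_distance M ?W"
      with entropic_lower_bound_le_1[OF C D0, of \<sigma>] show ?thesis by (rule order_trans)
    qed
  next
    case False
    hence D: "?D \<noteq> 0" and lt: "entropic_distance M ?W < 1" by auto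
    obtain \<delta> where \<delta>: "entropic_distance M ?W = ereal \<delta>" using e(1) lt by (cases "entropic_distance M ?W") auto
    have \<delta>1: "0 \<le> \<delta>" "\<delta> < 1" using e(1) lt unfolding \<delta> by (auto simp: one_ereal_def)
    have \<delta>0: "0 < \<delta>"
    proof (rule ccontr)
      assume "\<not> 0 < \<delta>"
      hence z: "entropic_distance M ?W = 0" using \<delta> \<delta>1 by (simp add: zero_ereal_def)
      have cl: "entropic_distance M ?W \<le> ereal (exp (- 4000 * T\<^sup>2))" for T :: real
        unfolding z by (simp add: zero_ereal_def)
      obtain d where d: "0 < d" "?D = ereal d" using cramer_T_bound[OF pair \<sigma> zero_less_one cl D] by blast
      define q where "q = cramer_constant * (ln (2 + 1 / d) ^ 3 / (\<sigma>\<^sup>2 * d\<^sup>2))"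
      define T where "T = q + 1"
      have "0 \<le> q" unfolding q_def
        using d by (intro mult_nonneg_nonneg divide_nonneg_nonneg zero_le_power2 zero_le_power ln_ge_zero) (auto simp: cramer_constant_def)
      hence T: "1 \<le> T" by (simp add: T_def)
      hence "0 < T" by simp
      obtain d' where d': "?D = ereal d'" "T\<^sup>2 \<le> cramer_constant * (ln (2 + 1 / d') ^ 3 / (\<sigma>\<^sup>2 * d'\<^sup>2))"
        using cramer_T_bound[OF pair \<sigma> \<open>0 < T\<close> cl D] by blast
      have "d' = d" using d'(1) d(2) by simp
      hence "T\<^sup>2 \<le> T - 1" using d'(2) by (simp add: T_def q_def)
      moreover have "T * 1 \<le> T * T" using T by (intro mult_left_mono) auto
      ultimately show False by (simp add: power2_eq_square)
    qed
    define T where "T = sqrt (ln (1 / \<delta>) / 4000)"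
    have ln0: "0 < ln (1 / \<delta>)" using \<delta>0 \<delta>1 by (simp add: ln_div)
    have T: "0 < T" "4000 * T\<^sup>2 = ln (1 / \<delta>)" using ln0 by (auto simp: T_def)
    have "exp (- 4000 * T\<^sup>2) = \<delta>" using T(2) \<delta>0 by (simp add: ln_div)
    hence "entropic_distance M ?W \<le> ereal (exp (- 4000 * T\<^sup>2))" by (simp add: \<delta>)
    then obtain d where d: "0 < d" "?D = ereal d" "T\<^sup>2 \<le> cramer_constant * (ln (2 + 1 / d) ^ 3 / (\<sigma>\<^sup>2 * d\<^sup>2))"
      using cramer_T_bound[OF pair \<sigma> T(1) _ D] by blast
    have "ln (1 / \<delta>) \<le> ?C * ln (2 + 1 / d) ^ 3 / (\<sigma>\<^sup>2 * d\<^sup>2)" using d(3) unfolding T(2)[symmetric] by simp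
    hence "- (?C * ln (2 + 1 / d) ^ 3 / (\<sigma>\<^sup>2 * d\<^sup>2)) \<le> ln \<delta>" using \<delta>0 by (simp add: ln_div)
    hence "exp (- (?C * ln (2 + 1 / d) ^ 3 / (\<sigma>\<^sup>2 * d\<^sup>2))) \<le> exp (ln \<delta>)"
      by (simp only: exp_le_cancel_iff)
    hence "exp (- (?C * ln (2 + 1 / d) ^ 3 / (\<sigma>\<^sup>2 * d\<^sup>2))) \<le> \<delta>" using \<delta>0 by (simp only: exp_ln)
    thus ?thesis using d(1) unfolding d(2) \<delta> by (simp add: entropic_lower_bound_def Let_def)
  qed
qed

theorem proposition10p2:
  "(\<exists>C>0. \<forall>M :: (real \<times> real \<times> real \<times> real) measure. admissible_constant C M) \<and>
   (\<forall>C>0. (\<forall>M :: (real \<times> real \<times> real \<times> real) measure. admissible_constant C M) \<longrightarrow>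
     (\<forall>M :: 'a measure. admissible_constant C M))"
proof (intro conjI allI impI)
  show "\<exists>C>0. \<forall>M :: (real \<times> real \<times> real \<times> real) measure. admissible_constant C M"
  proof (intro exI conjI allI)
    show "0 < 4000 * cramer_constant" using density_constant_ge_1 by (simp add: cramer_constant_def)
  qed (rule admissible_constant_cramer)
qed (rule admissible_constant_transfer)

end
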